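(* Let $N\ge2$, let $\mathcal{N}$ be a norm on $\mathbb{R}^N$, and assume that $u\in C^2(\mathbb{R}^N)$ and $x\in\mathbb{R}^N$ is such that $|Du(x)|\ne0$. Then $$\kappa^\alpha[x,u]\to\frac{1}{2|Du(x)|}\operatorname{tr}\left(\left(\int_{\mathbb{S}^{N-1}\cap Du(x)^\perp}\theta\otimes\theta\,\frac{d\mathcal{H}^{N-2}(\theta)}{\mathcal{N}(\theta)^{N+1}}\right)D^2u(x)\right)$$ as $\alpha\nearrow1$.
   Context: For $\alpha\in(0,1)$, $\nu^\alpha(dz)=(1-\alpha)\frac{dz}{\mathcal{N}(z)^{N+\alpha}}$ on $\mathbb{R}^N$, and for $u$ of class $C^{1,1}$ with $|Du(x)|\ne0$, $$\kappa^\alpha[x,u]=\nu^\alpha(\{z: u(x+z)\ge u(x),\ \langle Du(x),z\rangle\le0\})-\nu^\alpha(\{z:u(x+z)<u(x),\ \langle Du(x),z\rangle>0\})$$ (both quantities are finite). $p^\perp=\{y\in\mathbb{R}^N:\langle y,p\rangle=0\}$. *)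

theory Defs
  imports "HOL-Analysis.Analysis"
begin

subsection \<open>Norms, gradients and Hessians\<close>

text \<open>
  The Euclidean norm of \<^typ>\<open>real ^ 'n\<close> is the library function \<^const>\<open>norm\<close>. The following
  predicate describes an arbitrary second norm on the same space.
\<close>

definition is_norm :: "('a::real_vector \<Rightarrow> real) \<Rightarrow> bool" where
  "is_norm nrm \<longleftrightarrow>
     (\<forall>x. 0 \<le> nrm x) \<and>
     (\<forall>x. nrm x = 0 \<longleftrightarrow> x = 0) \<and>
     (\<forall>c x. nrm (c *\<^sub>R x) = \<bar>c\<bar> * nrm x) \<and>
     (\<forall>x y. nrm (x + y) \<le> nrm x + nrm y)"

definition grad :: "(real ^ 'n \<Rightarrow> real) \<Rightarrow> real ^ 'n \<Rightarrow> real ^ 'n" where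
  "grad u x = (\<chi> i. frechet_derivative u (at x) (axis i 1))"

definition hessian :: "(real ^ 'n \<Rightarrow> real) \<Rightarrow> real ^ 'n \<Rightarrow> real ^ 'n ^ 'n" where
  "hessian u x = matrix (frechet_derivative (grad u) (at x))"

definition C2 :: "(real ^ 'n \<Rightarrow> real) \<Rightarrow> bool" where
  "C2 u \<longleftrightarrow>
     (\<forall>x. u differentiable (at x)) \<and>
     (\<forall>x. grad u differentiable (at x)) \<and>
     continuous_on UNIV (hessian u)"

lemma GDERIV_grad:
  assumes "u differentiable (at x)"
  shows "GDERIV u x :> grad u x"
proof -
  let ?D = "frechet_derivative u (at x)"
  have D: "(u has_derivative ?D) (at x)"
    using assms by (simp add: frechet_derivative_works)
  then interpret bounded_linear ?D by (rule has_derivative_bounded_linear)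
  have "?D h = inner h (grad u x)" for h
  proof -
    have "?D h = ?D (\<Sum>i\<in>UNIV. (h $ i) *\<^sub>R axis i 1)"
      by (simp add: basis_expansion scalar_mult_eq_scaleR [symmetric])
    also have "\<dots> = inner h (grad u x)"
      by (simp add: sum scaleR inner_vec_def grad_def)
    finally show ?thesis .
  qed
  then have "?D = (\<lambda>h. inner h (grad u x))" by blast
  with D show ?thesis by (simp add: gderiv_def)
qed

subsection \<open>The nonlocal curvature\<close>

text \<open>
  At the origin, the density below takes the value 0, by the library conventions for
  \<^term>\<open>0 powr a :: real\<close> and for division by zero; the origin is a null set.
\<close>

definition nu :: "real \<Rightarrow> (real ^ 'n \<Rightarrow> real) \<Rightarrow> (real ^ 'n) measure" where
  "nu \<alpha> nrm = density lborel
     (\<lambda>z. ennreal ((1 - \<alpha>) / nrm z powr (real CARD('n) + \<alpha>)))"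

definition kappa ::
  "real \<Rightarrow> (real ^ 'n \<Rightarrow> real) \<Rightarrow> real ^ 'n \<Rightarrow> (real ^ 'n \<Rightarrow> real) \<Rightarrow> real" where
  "kappa \<alpha> nrm x u =
     measure (nu \<alpha> nrm) {z. u (x + z) \<ge> u x \<and> inner (grad u x) z \<le> 0} -
     measure (nu \<alpha> nrm) {z. u (x + z) < u x \<and> inner (grad u x) z > 0}"

definition tensor :: "real ^ 'n \<Rightarrow> real ^ 'n \<Rightarrow> real ^ 'n ^ 'n" where
  "tensor v w = (\<chi> i j. v $ i * w $ j)"

definition orth_compl :: "'a::real_inner \<Rightarrow> 'a set" where
  "orth_compl p = {y. inner y p = 0}"

subsection \<open>Hausdorff measure\<close>

text \<open>
  The normalisation is the usual one: a set of diameter \<open>d\<close> is charged the \<open>m\<close>-dimensional volume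
  of a Euclidean ball of diameter \<open>d\<close>. The empty set is treated separately because
  \<^prop>\<open>(0::real) ^ 0 = 1\<close>; thus for \<open>m = 0\<close> every nonempty bounded set is charged 1, and one
  obtains the counting measure.

  The covering sets are required to be bounded because \<^const>\<open>diameter\<close> is real-valued and carries
  no information for unbounded sets.
\<close>

definition hausdorff_gauge :: "nat \<Rightarrow> 'a::metric_space set \<Rightarrow> ennreal" where
  "hausdorff_gauge m E =
     (if E = {} then 0 else ennreal (unit_ball_vol (real m) * (diameter E / 2) ^ m))"

definition hausdorff_pre :: "nat \<Rightarrow> real \<Rightarrow> 'a::metric_space set \<Rightarrow> ennreal" where
  "hausdorff_pre m \<delta> A =
     (INF E \<in> {E :: nat \<Rightarrow> 'a set. A \<subseteq> (\<Union>i. E i) \<and> (\<forall>i. bounded (E i) \<and> diameter (E i) \<le> \<delta>)}.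
        (\<Sum>i. hausdorff_gauge m (E i)))"

definition hausdorff_outer :: "nat \<Rightarrow> 'a::metric_space set \<Rightarrow> ennreal" where
  "hausdorff_outer m A = (SUP \<delta> \<in> {0<..}. hausdorff_pre m \<delta> A)"

definition hausdorff_measure :: "nat \<Rightarrow> 'a::metric_space measure" where
  "hausdorff_measure m = measure_of UNIV (sets borel) (hausdorff_outer m)"

lemma space_hausdorff_measure [simp]: "space (hausdorff_measure m) = UNIV"
  unfolding hausdorff_measure_def by (rule space_measure_of) simp

lemma sets_hausdorff_measure [simp, measurable_cong]:
  "sets (hausdorff_measure m :: 'a::metric_space measure) = sets borel"
proof -
  have "sigma_sets UNIV (sets (borel :: 'a measure)) = sets borel"
    using sets.sigma_sets_eq [of "borel :: 'a measure"] by simp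
  then show ?thesis by (simp add: hausdorff_measure_def)
qed

text \<open>
  A measure built by \<^const>\<open>measure_of\<close> carries the given set function only if that
  function is countably additive. The remaining lemmas show, by Caratheodory's criterion for
  metric outer measures, that this is the case here.
\<close>

lemma hausdorff_pre_mono: "A \<subseteq> B \<Longrightarrow> hausdorff_pre m \<delta> A \<le> hausdorff_pre m \<delta> B"
  unfolding hausdorff_pre_def by (rule INF_superset_mono) auto

lemma hausdorff_pre_antimono: "\<delta> \<le> \<delta>' \<Longrightarrow> hausdorff_pre m \<delta>' A \<le> hausdorff_pre m \<delta> A"
  unfolding hausdorff_pre_def by (rule INF_superset_mono) (auto intro: order_trans)

lemma hausdorff_pre_le_outer: "0 < \<delta> \<Longrightarrow> hausdorff_pre m \<delta> A \<le> hausdorff_outer m A"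
  unfolding hausdorff_outer_def by (rule SUP_upper) simp

lemma hausdorff_outer_mono: "A \<subseteq> B \<Longrightarrow> hausdorff_outer m A \<le> hausdorff_outer m B"
  unfolding hausdorff_outer_def by (rule SUP_mono) (blast intro: hausdorff_pre_mono)

lemma hausdorff_outer_empty [simp]: "hausdorff_outer m {} = 0"
proof -
  have "hausdorff_pre m \<delta> ({} :: 'a set) \<le> 0" if "0 < \<delta>" for \<delta>
    unfolding hausdorff_pre_def
    by (rule INF_lower2 [where i = "\<lambda>_. {}"])
      (use that in \<open>auto simp: hausdorff_gauge_def diameter_def\<close>)
  then show ?thesis
    unfolding hausdorff_outer_def by (auto intro!: antisym SUP_least)
qed

lemma hausdorff_pre_countably_subadditive:
  "hausdorff_pre m \<delta> (\<Union>n. A n) \<le> (\<Sum>n. hausdorff_pre m \<delta> (A (n::nat)))"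
proof (rule ennreal_le_epsilon)
  fix e :: real
  let ?P = "hausdorff_pre m \<delta>"
  assume e: "0 < e" and fin: "(\<Sum>n. ?P (A n)) < top"
  have "?P (A n) < ?P (A n) + ennreal (e * (1/2) ^ Suc n)" for n
    using e fin by (auto simp add: less_top dest!: ennreal_suminf_lessD)
  then have ex: "\<exists>E. A n \<subseteq> (\<Union>i. E i) \<and> (\<forall>i. bounded (E i) \<and> diameter (E i) \<le> \<delta>) \<and>
      (\<Sum>i. hausdorff_gauge m (E (i::nat))) < ?P (A n) + ennreal (e * (1/2) ^ Suc n)" for n
    unfolding hausdorff_pre_def INF_less_iff by (simp only: mem_Collect_eq Bex_def conj_assoc)
  have "\<exists>E. A n \<subseteq> (\<Union>i. E i) \<and> (\<forall>i. bounded (E i) \<and> diameter (E i) \<le> \<delta>) \<and>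
      (\<Sum>i. hausdorff_gauge m (E (i::nat))) \<le> ?P (A n) + ennreal (e * (1/2) ^ Suc n)" for n
    using ex [of n] by (blast intro: less_imp_le)
  then obtain E where E: "\<And>n. A n \<subseteq> (\<Union>i. E n i)"
      "\<And>n i. bounded (E n i) \<and> diameter (E n i) \<le> \<delta>"
      "\<And>n. (\<Sum>i. hausdorff_gauge m (E n (i::nat))) \<le> ?P (A n) + ennreal (e * (1/2) ^ Suc n)"
    by metis
  define C where "C = (\<lambda>k. case_prod E (prod_decode k))"
  have "(\<Union>n. A n) \<subseteq> (\<Union>k. C k)"
    using E(1) by (auto simp: C_def subset_eq) (metis prod.case prod_encode_inverse)
  moreover have "\<forall>k. bounded (C k) \<and> diameter (C k) \<le> \<delta>"
    using E(2) by (simp add: C_def split: prod.split)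
  ultimately have "?P (\<Union>n. A n) \<le> (\<Sum>k. hausdorff_gauge m (C k))"
    unfolding hausdorff_pre_def by (intro INF_lower) simp
  also have "\<dots> = (\<Sum>n. \<Sum>i. hausdorff_gauge m (E n i))"
    using suminf_ennreal_2dimen [of "\<lambda>n. \<Sum>i. hausdorff_gauge m (E n i)"
        "\<lambda>(n, i). hausdorff_gauge m (E n i)"]
    by (simp add: C_def split_def)
  also have "\<dots> \<le> (\<Sum>n. ?P (A n) + ennreal (e * (1/2) ^ Suc n))"
    by (intro suminf_le allI E(3)) auto
  also have "\<dots> = (\<Sum>n. ?P (A n)) + (\<Sum>n. ennreal e * ennreal ((1/2) ^ Suc n))"
    using e by (subst suminf_add [symmetric])
      (auto simp del: ennreal_suminf_cmult simp add: ennreal_mult [symmetric])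
  also have "\<dots> = (\<Sum>n. ?P (A n)) + ennreal e"
    unfolding ennreal_suminf_cmult
    by (subst suminf_ennreal_eq [OF zero_le_power power_half_series]) auto
  finally show "?P (\<Union>n. A n) \<le> (\<Sum>n. ?P (A n)) + ennreal e" .
qed

lemma hausdorff_outer_countably_subadditive:
  "hausdorff_outer m (\<Union>n. A n) \<le> (\<Sum>n. hausdorff_outer m (A (n::nat)))"
  unfolding hausdorff_outer_def [of m "\<Union>n. A n"]
proof (rule SUP_least)
  fix \<delta> :: real assume "\<delta> \<in> {0<..}"
  then have "(\<Sum>n. hausdorff_pre m \<delta> (A n)) \<le> (\<Sum>n. hausdorff_outer m (A n))"
    by (intro suminf_le hausdorff_pre_le_outer) auto
  with hausdorff_pre_countably_subadditive
  show "hausdorff_pre m \<delta> (\<Union>n. A n) \<le> (\<Sum>n. hausdorff_outer m (A n))"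
    by (rule order_trans)
qed

lemma hausdorff_outer_subadditive:
  "hausdorff_outer m (A \<union> B) \<le> hausdorff_outer m A + hausdorff_outer m B"
proof -
  define C where "C = (\<lambda>n::nat. if n = 0 then A else if n = 1 then B else {})"
  have "A \<union> B = (\<Union>n. C n)"
    by (auto simp: C_def split: if_splits)
  moreover have "(\<Sum>n. hausdorff_outer m (C n)) = (\<Sum>n\<in>{0, 1}. hausdorff_outer m (C n))"
    by (rule suminf_finite) (auto simp: C_def)
  ultimately show ?thesis
    using hausdorff_outer_countably_subadditive [of m C] by (simp add: C_def)
qed

lemma hausdorff_pre_separated:
  assumes "0 \<le> \<delta>" "\<delta> < d" and sep: "\<And>x y. x \<in> A \<Longrightarrow> y \<in> B \<Longrightarrow> d \<le> dist x y"
  shows "hausdorff_pre m \<delta> A + hausdorff_pre m \<delta> B \<le> hausdorff_pre m \<delta> (A \<union> B)"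
  unfolding hausdorff_pre_def [of m \<delta> "A \<union> B"]
proof (rule INF_greatest, safe)
  fix E :: "nat \<Rightarrow> 'a set"
  assume cov: "A \<union> B \<subseteq> (\<Union>i. E i)" and E: "\<forall>i. bounded (E i) \<and> diameter (E i) \<le> \<delta>"
  define R where "R = (\<lambda>S i. if E i \<inter> S = {} then {} else E i)"
  have le: "hausdorff_pre m \<delta> S \<le> (\<Sum>i. hausdorff_gauge m (R S i))" if "S \<subseteq> (\<Union>i. E i)" for S
    unfolding hausdorff_pre_def
  proof (rule INF_lower, safe)
    show "\<And>x. x \<in> S \<Longrightarrow> x \<in> (\<Union>i. R S i)"
      using that by (fastforce simp: R_def)
    show "\<And>i. bounded (R S i)" "\<And>i. diameter (R S i) \<le> \<delta>"
      using E \<open>0 \<le> \<delta>\<close> by (auto simp: R_def)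
  qed
  have "hausdorff_gauge m (R A i) + hausdorff_gauge m (R B i) \<le> hausdorff_gauge m (E i)" for i
  proof -
    have "E i \<inter> A = {} \<or> E i \<inter> B = {}"
    proof (rule ccontr)
      assume "\<not> ?thesis"
      then obtain x y where xy: "x \<in> E i" "x \<in> A" "y \<in> E i" "y \<in> B" by blast
      then have "dist x y \<le> diameter (E i)"
        using E diameter_bounded_bound by blast
      moreover have "d \<le> dist x y" using sep xy by blast
      moreover have "diameter (E i) \<le> \<delta>" using E by blast
      ultimately show False using \<open>\<delta> < d\<close> by linarith
    qed
    then show ?thesis by (auto simp: R_def hausdorff_gauge_def)
  qed
  then have "(\<Sum>i. hausdorff_gauge m (R A i)) + (\<Sum>i. hausdorff_gauge m (R B i))
      \<le> (\<Sum>i. hausdorff_gauge m (E i))"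
    by (subst suminf_add) (auto intro!: suminf_le)
  then show "hausdorff_pre m \<delta> A + hausdorff_pre m \<delta> B \<le> (\<Sum>i. hausdorff_gauge m (E i))"
    using le [of A] le [of B] cov by (meson Un_subset_iff add_mono order_trans)
qed

lemma hausdorff_outer_separated:
  assumes "0 < d" and sep: "\<And>x y. x \<in> A \<Longrightarrow> y \<in> B \<Longrightarrow> d \<le> dist x y"
  shows "hausdorff_outer m A + hausdorff_outer m B \<le> hausdorff_outer m (A \<union> B)"
proof -
  have "hausdorff_outer m A + hausdorff_outer m B =
      (SUP \<delta>\<in>{0<..}. hausdorff_pre m \<delta> A + hausdorff_pre m \<delta> B)"
    unfolding hausdorff_outer_def
  proof (rule SUP_add_directed_ennreal [symmetric])
    fix i j :: real assume ij: "i \<in> {0<..}" "j \<in> {0<..}"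
    then show "\<exists>k\<in>{0<..}. hausdorff_pre m i A + hausdorff_pre m j B
        \<le> hausdorff_pre m k A + hausdorff_pre m k B"
      by (intro bexI [of _ "min i j"] add_mono hausdorff_pre_antimono) auto
  qed
  also have "\<dots> \<le> hausdorff_outer m (A \<union> B)"
  proof (rule SUP_least)
    fix \<delta> :: real assume \<delta>: "\<delta> \<in> {0<..}"
    define \<eta> where "\<eta> = min \<delta> (d / 2)"
    have \<eta>: "0 < \<eta>" "\<eta> < d" "\<eta> \<le> \<delta>"
      using \<delta> \<open>0 < d\<close> by (auto simp: \<eta>_def)
    have "hausdorff_pre m \<delta> A + hausdorff_pre m \<delta> B
        \<le> hausdorff_pre m \<eta> A + hausdorff_pre m \<eta> B"
      using \<eta> by (intro add_mono hausdorff_pre_antimono)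
    also have "\<dots> \<le> hausdorff_pre m \<eta> (A \<union> B)"
      using \<eta> sep by (intro hausdorff_pre_separated [of _ d]) auto
    also have "\<dots> \<le> hausdorff_outer m (A \<union> B)"
      using \<eta> by (intro hausdorff_pre_le_outer)
    finally show "hausdorff_pre m \<delta> A + hausdorff_pre m \<delta> B \<le> hausdorff_outer m (A \<union> B)" .
  qed
  finally show ?thesis .
qed

lemma hausdorff_outer_closed:
  fixes F :: "'a::metric_space set"
  assumes "closed F"
  shows "hausdorff_outer m (X \<inter> F) + hausdorff_outer m (X - F) \<le> hausdorff_outer m X"
proof (cases "F = {} \<or> hausdorff_outer m X = top")
  case True
  then show ?thesis by (auto simp: top_greatest)
next
  case False
  let ?H = "hausdorff_outer m :: 'a set \<Rightarrow> ennreal"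
  have F: "F \<noteq> {}" and fin: "?H X \<noteq> top" using False by auto
  define Y where "Y = (\<lambda>n::nat. {x \<in> X. 1 / (real n + 1) \<le> infdist x F})"
  define R where "R = (\<lambda>n. Y (Suc n) - Y n)"
  have Y_mono: "Y i \<subseteq> Y j" if "i \<le> j" for i j
  proof -
    have "1 / (real j + 1) \<le> 1 / (real i + 1)"
      using that by (intro divide_left_mono) auto
    then show ?thesis by (auto simp: Y_def)
  qed
  have near: "?H (X \<inter> F) + ?H (Y n) \<le> ?H X" for n
  proof -
    have "1 / (real n + 1) \<le> dist x y" if "x \<in> X \<inter> F" "y \<in> Y n" for x y
    proof -
      have "infdist y F \<le> dist y x" using that by (intro infdist_le) auto
      then show ?thesis using that by (auto simp: Y_def dist_commute)
    qed
    then have "?H (X \<inter> F) + ?H (Y n) \<le> ?H (X \<inter> F \<union> Y n)"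
      by (intro hausdorff_outer_separated [of "1 / (real n + 1)"]) auto
    also have "\<dots> \<le> ?H X" by (rule hausdorff_outer_mono) (auto simp: Y_def)
    finally show ?thesis .
  qed
  have step: "?H (Y j) + ?H (R (Suc j)) \<le> ?H (Y j \<union> R (Suc j))" for j
  proof (rule hausdorff_outer_separated)
    let ?d = "1 / (real j + 1) - 1 / (real (Suc j) + 1)"
    show "0 < ?d" by (simp add: divide_strict_left_mono)
    fix y x assume y: "y \<in> Y j" and x: "x \<in> R (Suc j)"
    have "infdist y F \<le> infdist x F + dist y x" by (rule infdist_triangle)
    moreover have "infdist x F < 1 / (real (Suc j) + 1)"
      using x by (auto simp: R_def Y_def)
    moreover have "1 / (real j + 1) \<le> infdist y F" using y by (simp add: Y_def)
    ultimately show "?d \<le> dist y x" by linarith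
  qed
  have alternate: "(\<Sum>k<n. ?H (R (2 * k + p))) \<le> ?H (Y (2 * n + p - 1))"
    if "p \<le> 1" for n p
  proof (induction n)
    case 0
    then show ?case by simp
  next
    case (Suc n)
    show ?case
    proof (cases "2 * n + p")
      case 0
      then show ?thesis by (auto simp: R_def intro!: hausdorff_outer_mono)
    next
      case (Suc j)
      have "(\<Sum>k<Suc n. ?H (R (2 * k + p))) \<le> ?H (Y j) + ?H (R (Suc j))"
        using Suc.IH Suc by (simp add: add_right_mono)
      also have "\<dots> \<le> ?H (Y j \<union> R (Suc j))" by (rule step)
      also have "\<dots> \<le> ?H (Y (Suc (Suc j)))"
        using Y_mono [of j "Suc (Suc j)"] by (intro hausdorff_outer_mono) (auto simp: R_def)
      finally show ?thesis using Suc by simp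
    qed
  qed
  have YX: "?H (Y n) \<le> ?H X" for n by (rule hausdorff_outer_mono) (auto simp: Y_def)
  have partial: "(\<Sum>k<n. ?H (R k)) \<le> ?H X + ?H X" for n
  proof -
    have "(\<Sum>k<n. ?H (R k)) \<le> (\<Sum>k<2 * n. ?H (R k))" by (rule sum_mono2) auto
    also have "\<dots> = (\<Sum>k<n. ?H (R (2 * k + 0))) + (\<Sum>k<n. ?H (R (2 * k + 1)))"
      by (induction n) (simp_all add: algebra_simps)
    also have "\<dots> \<le> ?H X + ?H X"
      using alternate [of 0 n] alternate [of 1 n] YX by (intro add_mono) (meson order_trans le_numeral_extra(3,4) zero_le)+
    finally show ?thesis .
  qed
  define S where "S = (\<Sum>k. ?H (R k))"
  have "S \<le> ?H X + ?H X" unfolding S_def by (intro suminf_le_const partial) auto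
  then have S: "S \<noteq> top" using fin by (auto simp: top_unique)
  have split: "S = (\<Sum>k. ?H (R (k + n))) + (\<Sum>k<n. ?H (R k))" for n
    unfolding S_def by (rule suminf_offset) simp
  have "(\<lambda>n. S - (\<Sum>k<n. ?H (R k))) \<longlonglongrightarrow> S - S"
    using S by (intro tendsto_diff_ennreal tendsto_const)
      (auto simp: S_def intro: summable_LIMSEQ)
  moreover have "S - (\<Sum>k<n. ?H (R k)) = (\<Sum>k. ?H (R (k + n)))" for n
  proof -
    have "(\<Sum>k<n. ?H (R k)) \<noteq> top" using split [of n] S by auto
    then show ?thesis by (subst split [of n]) simp
  qed
  ultimately have tail: "(\<lambda>n. \<Sum>k. ?H (R (k + n))) \<longlonglongrightarrow> 0"
    using S by simp
  have bound: "?H (X \<inter> F) + ?H (X - F) \<le> ?H X + (\<Sum>k. ?H (R (k + n)))" for n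
  proof -
    have "X - F \<subseteq> Y n \<union> (\<Union>k. R (k + n))"
    proof
      fix x assume x: "x \<in> X - F"
      then have "0 < infdist x F"
        using assms F in_closed_iff_infdist_zero [of F x] infdist_nonneg [of x F] by auto
      then obtain k where "inverse (real (Suc k)) < infdist x F"
        using reals_Archimedean by blast
      then have ex: "x \<in> Y k" using x by (simp add: Y_def inverse_eq_divide add.commute)
      define k0 where "k0 = (LEAST k. x \<in> Y k)"
      have k0: "x \<in> Y k0" unfolding k0_def by (rule LeastI) (rule ex)
      show "x \<in> Y n \<union> (\<Union>k. R (k + n))"
      proof (cases "k0 \<le> n")
        case True
        then show ?thesis using k0 Y_mono by blast
      next
        case False
        then obtain j where j: "k0 = Suc (j + n)"
          by (metis add.commute less_iff_Suc_add not_le)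
        have "x \<notin> Y (j + n)"
          using not_less_Least [of "j + n" "\<lambda>k. x \<in> Y k"] j by (simp add: k0_def)
        with k0 j show ?thesis by (auto simp: R_def)
      qed
    qed
    then have "?H (X - F) \<le> ?H (Y n \<union> (\<Union>k. R (k + n)))" by (rule hausdorff_outer_mono)
    also have "\<dots> \<le> ?H (Y n) + ?H (\<Union>k. R (k + n))" by (rule hausdorff_outer_subadditive)
    also have "\<dots> \<le> ?H (Y n) + (\<Sum>k. ?H (R (k + n)))"
      by (intro add_left_mono hausdorff_outer_countably_subadditive)
    finally have "?H (X \<inter> F) + ?H (X - F) \<le> (?H (X \<inter> F) + ?H (Y n)) + (\<Sum>k. ?H (R (k + n)))"
      by (simp add: add.assoc add_left_mono)
    also have "\<dots> \<le> ?H X + (\<Sum>k. ?H (R (k + n)))"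
      by (intro add_right_mono near)
    finally show ?thesis .
  qed
  have "(\<lambda>n. ?H X + (\<Sum>k. ?H (R (k + n)))) \<longlonglongrightarrow> ?H X + 0"
    by (intro tendsto_add tendsto_const tail)
  then show ?thesis
    using bound by (intro LIMSEQ_le_const [of _ "?H X"]) auto
qed

theorem emeasure_hausdorff_measure:
  fixes A :: "'a::metric_space set"
  assumes "A \<in> sets borel"
  shows "emeasure (hausdorff_measure m) A = hausdorff_outer m A"
proof -
  let ?H = "hausdorff_outer m :: 'a set \<Rightarrow> ennreal"
  let ?L = "lambda_system UNIV (Pow UNIV) ?H"
  interpret P: sigma_algebra UNIV "Pow UNIV :: 'a set set" by (rule sigma_algebra_Pow)
  have "outer_measure_space (Pow UNIV) ?H"
    by (auto simp: outer_measure_space_def positive_def increasing_def countably_subadditive_def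
        intro: hausdorff_outer_mono hausdorff_outer_countably_subadditive)
  then have L: "measure_space UNIV ?L ?H" by (rule P.caratheodory_lemma)
  then interpret L: sigma_algebra UNIV ?L by (simp add: measure_space_def)
  have "Collect closed \<subseteq> ?L"
  proof
    fix F :: "'a set" assume "F \<in> Collect closed"
    then have "closed F" by simp
    have "?H (X \<inter> F) + ?H (X - F) = ?H X" for X
    proof (rule antisym)
      show "?H (X \<inter> F) + ?H (X - F) \<le> ?H X"
        by (rule hausdorff_outer_closed [OF \<open>closed F\<close>])
      show "?H X \<le> ?H (X \<inter> F) + ?H (X - F)"
        using hausdorff_outer_subadditive [of m "X \<inter> F" "X - F"] by (simp add: Int_Diff_Un)
    qed
    then show "F \<in> ?L" unfolding P.lambda_system_eq by simp
  qed
  then have "sets (borel :: 'a measure) \<subseteq> ?L"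
    using L.sigma_sets_subset [of "Collect closed"] by (simp add: borel_eq_closed)
  then have "measure_space UNIV (sets borel) ?H"
    using measure_down [OF L] sets.sigma_algebra_axioms [of "borel :: 'a measure"] by simp
  then show ?thesis
    unfolding hausdorff_measure_def using assms
    by (intro emeasure_measure_of_sigma) (simp_all add: measure_space_def)
qed

end

theory Submission
  imports Defs
begin

text \<open>
  Write \<open>p = Du(x)\<close>, \<open>n = p/|p|\<close> and \<open>z = y + s n\<close> with \<open>y\<close> orthogonal to \<open>n\<close>. Near the origin both
  sets in the definition of the curvature lie in \<open>|s| \<le> M |y|\<^sup>2\<close>. Averaging over the dilations
  \<open>y + s n \<mapsto> \<lambda> y + \<lambda>\<^sup>2 s n\<close> with \<open>\<lambda> = t powr (1 / (1 - \<alpha>))\<close>, \<open>t \<in> (0, 1)\<close>, absorbs the factor \<open>1 - \<alpha>\<close>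
  and turns the measure of such a set into an integral with a dominating function that does not
  depend on \<open>\<alpha>\<close>. As \<open>\<alpha>\<close> tends to 1, \<open>\<lambda>\<close> tends to 0 and the sets blow up to the regions
  between \<open>s = 0\<close> and the osculating paraboloid, whose thickness at \<open>y\<close> is \<open>\<langle>D\<^sup>2u(x) y, y\<rangle> / (2 |p|)\<close>.
  The limit is an integral against the cone measure of the unit sphere of the hyperplane.

  The cone measure is the Hausdorff measure: gnomonic projection and the isodiametric inequality
  (by Steiner symmetrization) bound it from above by gauges of covering sets; for the converse, if the
  Hausdorff measure is at most \<open>C\<close> times the cone measure with \<open>C > 1\<close>, a Vitali covering by small
  balls, whose gauges almost equal their cone measures, improves \<open>C\<close>.
\<close>

subsection \<open>Integration in slabs\<close>

text \<open>For t uniform on (0, 1), lambda has the density (1 - alpha) lambda^(-alpha), a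
  probability law that concentrates at 0. The vanishing factor 1 - alpha is thus spent on an average
  instead of competing with the singularity of the kernel. The average reproduces the kernel only up
  to the factor 1 - |y|^k; the rest, |y|^k times the kernel, is integrable over thin sets with a
  bound free of alpha, so the remaining 1 - alpha makes it disappear. The exponent k = N - 1 makes
  the limit integrand, the weight |y|^k / nrm(y)^(N+1) times a quadratic thickness, homogeneous of
  degree 0, hence a function of the direction y/|y| alone.

  The hyperplane gets no coordinates in that part: its (N-1)-dimensional volume is the N-dimensional
  volume of a slab of unit height. Coordinates enter only in the comparison with Hausdorff measure,
  as an orthonormal basis containing n and the centre t of the projection. Covers by arbitrary sets
  are what forces the isodiametric inequality; the opposite estimate is tested on balls, where
  volumes are explicit.\<close>

lemma nn_integral_lborel_translate:
  fixes g :: "'a::euclidean_space \<Rightarrow> ennreal"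
  assumes [measurable]: "g \<in> borel_measurable borel"
  shows "(\<integral>\<^sup>+z. g (c + z) \<partial>lborel) = (\<integral>\<^sup>+z. g z \<partial>lborel)"
proof -
  have "(\<integral>\<^sup>+z. g z \<partial>lborel) = (\<integral>\<^sup>+z. g z \<partial>distr lborel borel ((+) c))"
    by (simp add: lborel_distr_plus)
  also have "\<dots> = (\<integral>\<^sup>+z. g (c + z) \<partial>lborel)"
    by (subst nn_integral_distr) auto
  finally show ?thesis by simp
qed

lemma nn_integral_lborel_scaleR:
  fixes g :: "'a::euclidean_space \<Rightarrow> ennreal"
  assumes [measurable]: "g \<in> borel_measurable borel" and c: "c > 0"
  shows "(\<integral>\<^sup>+z. g z \<partial>lborel) = ennreal (c ^ DIM('a)) * (\<integral>\<^sup>+z. g (c *\<^sub>R z) \<partial>lborel)"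
proof -
  have "(\<integral>\<^sup>+z. g z \<partial>lborel)
      = (\<integral>\<^sup>+z. g z \<partial>density (distr lborel borel (\<lambda>x. 0 + c *\<^sub>R x)) (\<lambda>_. ennreal (\<bar>c\<bar> ^ DIM('a))))"
    using c by (subst lborel_affine[of c 0]) auto
  also have "\<dots> = ennreal (c ^ DIM('a)) * (\<integral>\<^sup>+z. g (c *\<^sub>R z) \<partial>lborel)"
    using c by (subst nn_integral_density) (auto simp: nn_integral_distr nn_integral_cmult)
  finally show ?thesis .
qed

lemma nn_integral_lborel_swap:
  fixes f :: "'a::euclidean_space \<Rightarrow> 'b::euclidean_space \<Rightarrow> ennreal"
  assumes [measurable]: "case_prod f \<in> borel_measurable (borel \<Otimes>\<^sub>M borel)"
  shows "(\<integral>\<^sup>+x. \<integral>\<^sup>+y. f x y \<partial>lborel \<partial>lborel) = (\<integral>\<^sup>+y. \<integral>\<^sup>+x. f x y \<partial>lborel \<partial>lborel)"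
  by (rule lborel_pair.Fubini') simp

definition perp :: "'a::real_inner \<Rightarrow> 'a \<Rightarrow> 'a" where
  "perp n z = z - (z \<bullet> n) *\<^sub>R n"

lemma perp_measurable [measurable]:
  "perp n \<in> borel_measurable (borel :: 'a::euclidean_space measure)"
  unfolding perp_def by measurable

lemma perp_inner: "norm n = 1 \<Longrightarrow> perp n z \<bullet> n = 0"
  by (simp add: perp_def inner_diff_left power2_norm_eq_inner [symmetric] norm_eq_1)

lemma perp_simps:
  assumes "norm n = 1"
  shows "perp n (z + s *\<^sub>R n) = perp n z"
    "perp n (c *\<^sub>R z) = c *\<^sub>R perp n z"
    "perp n (perp n z) = perp n z"
    "(z + s *\<^sub>R n) \<bullet> n = z \<bullet> n + s"
  using assms perp_inner[OF assms, of z]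
  by (simp_all add: perp_def inner_add_left inner_diff_left algebra_simps norm_eq_1)

lemma perp_split: "z = perp n z + (z \<bullet> n) *\<^sub>R n"
  by (simp add: perp_def)

lemma norm_perp_Pythagoras:
  assumes "norm n = 1"
  shows "(norm z)\<^sup>2 = (norm (perp n z))\<^sup>2 + (z \<bullet> n)\<^sup>2"
proof -
  have "(norm z)\<^sup>2 = (norm (perp n z + (z \<bullet> n) *\<^sub>R n))\<^sup>2"
    using perp_split by metis
  also have "\<dots> = (norm (perp n z))\<^sup>2 + (norm ((z \<bullet> n) *\<^sub>R n))\<^sup>2"
    by (rule norm_add_Pythagorean) (simp add: orthogonal_def perp_inner[OF assms])
  finally show ?thesis using assms by (simp add: power_mult_distrib)
qed

lemma norm_perp_le: "norm n = 1 \<Longrightarrow> norm (perp n z) \<le> norm z"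
  using norm_perp_Pythagoras[of n z]
  by (metis le_add_same_cancel1 norm_ge_zero power2_le_imp_le zero_le_power2)

text \<open>Averaging over the base point in a unit slab removes the need to choose coordinates
  on the hyperplane orthogonal to \<open>n\<close>.\<close>

lemma nn_integral_direction:
  fixes g :: "'a::euclidean_space \<Rightarrow> ennreal"
  assumes [measurable]: "g \<in> borel_measurable borel" and n: "norm n = 1"
  shows "(\<integral>\<^sup>+z. g z \<partial>lborel) =
    (\<integral>\<^sup>+z. indicator {0<..<1} (z \<bullet> n) * (\<integral>\<^sup>+s. g (perp n z + s *\<^sub>R n) \<partial>lborel) \<partial>lborel)"
proof -
  have nn: "n \<bullet> n = 1" using n by (simp add: norm_eq_1)
  \<comment> \<open>Shifting s by \<open>z \<bullet> n\<close> turns the base point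
    \<open>perp n z\<close> into z. After Fubini and the substitution of z - s n for z, the slab
    indicator is the only factor that contains s, and it integrates to 1.\<close>
  have inner: "(\<integral>\<^sup>+s. g (perp n z + s *\<^sub>R n) \<partial>lborel) = (\<integral>\<^sup>+s. g (z + s *\<^sub>R n) \<partial>lborel)" for z
    by (subst nn_integral_real_affine[where c = 1 and t = "z \<bullet> n"])
       (simp_all add: perp_def algebra_simps)
  have "(\<integral>\<^sup>+z. indicator {0<..<1} (z \<bullet> n) * (\<integral>\<^sup>+s. g (perp n z + s *\<^sub>R n) \<partial>lborel) \<partial>lborel)
      = (\<integral>\<^sup>+z. \<integral>\<^sup>+s. indicator {0<..<1::real} (z \<bullet> n) * g (z + s *\<^sub>R n) \<partial>lborel \<partial>lborel)"
    unfolding inner by (simp add: nn_integral_cmult)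
  also have "\<dots> = (\<integral>\<^sup>+s. \<integral>\<^sup>+z. indicator {0<..<1::real} (z \<bullet> n) * g (z + s *\<^sub>R n) \<partial>lborel \<partial>lborel)"
    by (rule nn_integral_lborel_swap) measurable
  also have "\<dots> = (\<integral>\<^sup>+s. \<integral>\<^sup>+z. indicator {0<..<1::real} (z \<bullet> n - s) * g z \<partial>lborel \<partial>lborel)"
  proof (rule nn_integral_cong)
    fix s :: real
    show "(\<integral>\<^sup>+z. indicator {0<..<1::real} (z \<bullet> n) * g (z + s *\<^sub>R n) \<partial>lborel)
        = (\<integral>\<^sup>+z. indicator {0<..<1::real} (z \<bullet> n - s) * g z \<partial>lborel)"
      using nn_integral_lborel_translate[of "\<lambda>z. indicator {0<..<1::real} (z \<bullet> n - s) * g z" "s *\<^sub>R n"]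
      by (simp add: inner_add_left nn add.commute)
  qed
  also have "\<dots> = (\<integral>\<^sup>+z. \<integral>\<^sup>+s. indicator {0<..<1::real} (z \<bullet> n - s) * g z \<partial>lborel \<partial>lborel)"
    by (rule nn_integral_lborel_swap) measurable
  also have "\<dots> = (\<integral>\<^sup>+z. g z \<partial>lborel)"
  proof (rule nn_integral_cong)
    fix z
    have "indicator {0<..<1::real} (z \<bullet> n - s) = (indicator {z \<bullet> n - 1<..<z \<bullet> n} s :: ennreal)" for s
      by (auto simp: indicator_def)
    then show "(\<integral>\<^sup>+s. indicator {0<..<1::real} (z \<bullet> n - s) * g z \<partial>lborel) = g z"
      by (simp add: nn_integral_multc)
  qed
  finally show ?thesis by simp
qed

definition aniso :: "'a::real_inner \<Rightarrow> real \<Rightarrow> 'a \<Rightarrow> 'a" where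
  "aniso n l z = l *\<^sub>R perp n z + (l\<^sup>2 * (z \<bullet> n)) *\<^sub>R n"

lemma aniso_measurable [measurable]:
  "(\<lambda>(l, z). aniso n l z) \<in> borel_measurable (borel \<Otimes>\<^sub>M (borel :: 'a::euclidean_space measure))"
  unfolding aniso_def by measurable

lemma aniso_measurable' [measurable]:
  "aniso n l \<in> borel_measurable (borel :: 'a::euclidean_space measure)"
  unfolding aniso_def by measurable

lemma aniso_simps:
  assumes "norm n = 1"
  shows "perp n (aniso n l z) = l *\<^sub>R perp n z" "aniso n l z \<bullet> n = l\<^sup>2 * (z \<bullet> n)"
  using assms perp_inner[OF assms, of z]
  by (simp_all add: aniso_def perp_simps inner_add_left norm_eq_1)

text \<open>The map is the homothety by l, with Jacobian l^N, combined with a further stretch by l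
  along n; \<open>h\<close> and \<open>k\<close> carry out the two substitutions separately.\<close>

lemma nn_integral_aniso:
  fixes g :: "'a::euclidean_space \<Rightarrow> ennreal"
  assumes [measurable]: "g \<in> borel_measurable borel" and n: "norm n = 1" and l: "l > 0"
  shows "(\<integral>\<^sup>+z. g z \<partial>lborel) = ennreal (l ^ (DIM('a) + 1)) * (\<integral>\<^sup>+z. g (aniso n l z) \<partial>lborel)"
proof -
  define h where "h z = g (l *\<^sub>R z)" for z
  define k where "k z = h (perp n z + (l * (z \<bullet> n)) *\<^sub>R n)" for z
  have [measurable]: "h \<in> borel_measurable borel" "k \<in> borel_measurable borel"
    unfolding h_def k_def by measurable
  have "(\<integral>\<^sup>+z. h z \<partial>lborel) =
      (\<integral>\<^sup>+z. indicator {0<..<1} (z \<bullet> n) * (\<integral>\<^sup>+s. h (perp n z + s *\<^sub>R n) \<partial>lborel) \<partial>lborel)"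
    by (rule nn_integral_direction) (use n in auto)
  also have "\<dots> = (\<integral>\<^sup>+z. indicator {0<..<1} (z \<bullet> n) * (ennreal l *
      (\<integral>\<^sup>+s. h (perp n z + (l * s) *\<^sub>R n) \<partial>lborel)) \<partial>lborel)"
    using l by (subst nn_integral_real_affine[where c = l and t = 0]) auto
  also have "\<dots> = ennreal l * (\<integral>\<^sup>+z. indicator {0<..<1} (z \<bullet> n) *
      (\<integral>\<^sup>+s. k (perp n z + s *\<^sub>R n) \<partial>lborel) \<partial>lborel)"
    by (subst nn_integral_cmult[symmetric])
       (auto simp: k_def perp_simps[OF n] perp_inner[OF n] mult_ac intro!: nn_integral_cong)
  also have "(\<integral>\<^sup>+z. indicator {0<..<1} (z \<bullet> n) *
      (\<integral>\<^sup>+s. k (perp n z + s *\<^sub>R n) \<partial>lborel) \<partial>lborel) = (\<integral>\<^sup>+z. k z \<partial>lborel)"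
    by (rule nn_integral_direction[symmetric]) (use n in auto)
  also have "\<dots> = (\<integral>\<^sup>+z. g (aniso n l z) \<partial>lborel)"
    by (simp add: k_def h_def aniso_def scaleR_add_right power2_eq_square mult.assoc)
  finally have "(\<integral>\<^sup>+z. h z \<partial>lborel) = ennreal l * (\<integral>\<^sup>+z. g (aniso n l z) \<partial>lborel)" .
  then show ?thesis
    using nn_integral_lborel_scaleR[of g l] l
    by (simp add: h_def ennreal_mult' mult_ac flip: mult.assoc)
qed

subsection \<open>The isodiametric inequality\<close>

text \<open>Each set lies between its infimum and its supremum, and the two differences Sup A - Inf
  B and Sup B - Inf A, both at most r, add up to the sum of the two lengths. This is the
  one-dimensional core of the diameter estimate for Steiner symmetrization.\<close>

lemma emeasure_add_le_of_diff_bounded: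
  fixes A B :: "real set"
  assumes ne: "A \<noteq> {}" "B \<noteq> {}" and r: "\<And>a b. a \<in> A \<Longrightarrow> b \<in> B \<Longrightarrow> \<bar>a - b\<bar> \<le> r"
  shows "emeasure lborel A + emeasure lborel B \<le> ennreal (2 * r)"
proof -
  obtain a0 b0 where ab: "a0 \<in> A" "b0 \<in> B" using ne by auto
  have r': "a - b \<le> r" "b - a \<le> r" if "a \<in> A" "b \<in> B" for a b
    using r[OF that] by linarith+
  have "a \<le> b0 + r" "b0 - r \<le> a" if "a \<in> A" for a using r'[OF that ab(2)] by linarith+
  then have bdA: "bdd_above A" "bdd_below A" by (meson bdd_aboveI bdd_belowI)+
  have "b \<le> a0 + r" "a0 - r \<le> b" if "b \<in> B" for b using r'[OF ab(1) that] by linarith+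
  then have bdB: "bdd_above B" "bdd_below B" by (meson bdd_aboveI bdd_belowI)+
  have box: "emeasure lborel X \<le> ennreal (Sup X - Inf X)"
    if "bdd_above X" "bdd_below X" "X \<noteq> {}" for X :: "real set"
  proof -
    have "Inf X \<le> Sup X" by (rule cInf_le_cSup[OF that(3,1,2)])
    moreover have "X \<subseteq> {Inf X..Sup X}" using that by (auto intro: cInf_lower cSup_upper)
    then have "emeasure lborel X \<le> emeasure lborel {Inf X..Sup X}" by (rule emeasure_mono) simp
    ultimately show ?thesis by simp
  qed
  have le: "Sup A \<le> b + r" if "b \<in> B" for b
  proof (rule cSup_least[OF ne(1)])
    show "a \<le> b + r" if "a \<in> A" for a using r'[OF that \<open>b \<in> B\<close>] by linarith
  qed
  have "Sup A - r \<le> Inf B"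
  proof (rule cInf_greatest[OF ne(2)])
    show "Sup A - r \<le> b" if "b \<in> B" for b using le[OF that] by linarith
  qed
  moreover have le': "Sup B \<le> a + r" if "a \<in> A" for a
  proof (rule cSup_least[OF ne(2)])
    show "b \<le> a + r" if "b \<in> B" for b using r'[OF \<open>a \<in> A\<close> that] by linarith
  qed
  have "Sup B - r \<le> Inf A"
  proof (rule cInf_greatest[OF ne(1)])
    show "Sup B - r \<le> a" if "a \<in> A" for a using le'[OF that] by linarith
  qed
  ultimately have sum: "(Sup A - Inf A) + (Sup B - Inf B) \<le> 2 * r" by simp
  have nn: "0 \<le> Sup A - Inf A" "0 \<le> Sup B - Inf B"
    using cInf_le_cSup[OF ne(1) bdA] cInf_le_cSup[OF ne(2) bdB] by simp_all
  have "emeasure lborel A + emeasure lborel B \<le> ennreal (Sup A - Inf A) + ennreal (Sup B - Inf B)"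
    by (intro add_mono box bdA bdB ne)
  also have "\<dots> \<le> ennreal (2 * r)"
    unfolding ennreal_plus[OF nn, symmetric] using sum by (rule ennreal_leI)
  finally show ?thesis .
qed

abbreviation lborel_PiM :: "'i set \<Rightarrow> ('i \<Rightarrow> real) measure" where
  "lborel_PiM I \<equiv> Pi\<^sub>M I (\<lambda>_. lborel)"

definition slice :: "'i \<Rightarrow> ('i \<Rightarrow> real) set \<Rightarrow> ('i \<Rightarrow> real) \<Rightarrow> real set" where
  "slice i E x = {t. x(i := t) \<in> E}"

text \<open>On every line parallel to the i-th axis the slice is replaced by the centred open
  interval of equal length. By the strict inequality a null slice becomes empty, so every point of
  the symmetrization certifies that the original slice is nonempty.\<close>

definition steiner :: "'i set \<Rightarrow> 'i \<Rightarrow> ('i \<Rightarrow> real) set \<Rightarrow> ('i \<Rightarrow> real) set" where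
  "steiner I i E = {x \<in> space (lborel_PiM I).
     ennreal (2 * \<bar>x i\<bar>) < emeasure lborel (slice i E x)}"

lemma slice_fun_upd [simp]: "slice i E (x(i := t)) = slice i E x"
  by (simp add: slice_def)

lemma sets_slice:
  assumes E: "E \<in> sets (lborel_PiM I)" and "i \<in> I" "x \<in> space (lborel_PiM (I - {i}))"
  shows "slice i E x \<in> sets borel"
proof -
  have "(\<lambda>t. x(i := t)) \<in> lborel \<rightarrow>\<^sub>M Pi\<^sub>M (insert i (I - {i})) (\<lambda>_. lborel)"
    using assms(3) by (intro measurable_fun_upd[where J = "I - {i}"]) auto
  then have "(\<lambda>t. x(i := t)) -` E \<inter> space lborel \<in> sets lborel"
    using assms by (intro measurable_sets[of _ lborel "lborel_PiM I"]) (auto simp: insert_absorb)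
  then show ?thesis by (simp add: slice_def vimage_def)
qed

lemma space_fun_upd_diff:
  "x \<in> space (lborel_PiM I) \<Longrightarrow> x(i := undefined) \<in> space (lborel_PiM (I - {i}))"
  by (auto simp: space_PiM PiE_iff extensional_def)

lemma emeasure_slice_eq:
  assumes "E \<in> sets (lborel_PiM I)" "i \<in> I" "x \<in> space (lborel_PiM (I - {i}))"
  shows "(\<integral>\<^sup>+t. indicator E (x(i := t)) \<partial>lborel) = emeasure lborel (slice i E x)"
proof -
  have "(\<integral>\<^sup>+t. indicator E (x(i := t)) \<partial>lborel) = (\<integral>\<^sup>+t. indicator (slice i E x) t \<partial>lborel)"
    by (intro nn_integral_cong) (auto simp: slice_def split: split_indicator)
  also have "\<dots> = emeasure lborel (slice i E x)"
    using sets_slice[OF assms] by simp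
  finally show ?thesis .
qed

lemma sets_steiner:
  fixes E :: "('i \<Rightarrow> real) set"
  assumes E: "E \<in> sets (lborel_PiM I)" and "finite I" "i \<in> I"
  shows "steiner I i E \<in> sets (lborel_PiM I)"
proof -
  let ?M = "lborel_PiM I"
  have ins: "insert i I = I" using \<open>i \<in> I\<close> by auto
  have "(\<lambda>(f, y). f(i := y)) \<in> ?M \<Otimes>\<^sub>M lborel \<rightarrow>\<^sub>M ?M"
    using measurable_add_dim[of i I "\<lambda>_. lborel"] by (simp add: ins)
  then have [measurable]: "(\<lambda>(x, t). indicator E (x(i := t)) :: ennreal) \<in> borel_measurable (?M \<Otimes>\<^sub>M lborel)"
    using measurable_compose[OF _ borel_measurable_indicator[OF E]] by (simp add: case_prod_beta')
  have [measurable]: "(\<lambda>x. \<integral>\<^sup>+t. indicator E (x(i := t)) \<partial>lborel) \<in> borel_measurable ?M"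
    by measurable
  have [measurable]: "(\<lambda>x. x i) \<in> borel_measurable ?M"
    using measurable_component_singleton[OF \<open>i \<in> I\<close>, of "\<lambda>_. lborel"] by simp
  have "steiner I i E = {x \<in> space ?M. ennreal (2 * \<bar>x i\<bar>) < (\<integral>\<^sup>+t. indicator E (x(i := t)) \<partial>lborel)}"
    unfolding steiner_def
  proof (intro Collect_cong conj_cong refl)
    fix x assume "x \<in> space ?M"
    from emeasure_slice_eq[OF E \<open>i \<in> I\<close> space_fun_upd_diff[OF this, of i]]
    show "(ennreal (2 * \<bar>x i\<bar>) < emeasure lborel (slice i E x)) =
        (ennreal (2 * \<bar>x i\<bar>) < (\<integral>\<^sup>+t. indicator E (x(i := t)) \<partial>lborel))" by simp
  qed
  also have "\<dots> \<in> sets ?M" by measurable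
  finally show ?thesis .
qed

lemma emeasure_centered_interval: "emeasure lborel {t::real. ennreal (2 * \<bar>t\<bar>) < l} = l"
proof (cases l)
  case (real r)
  then have "{t::real. ennreal (2 * \<bar>t\<bar>) < l} = {- (r/2)<..<r/2}"
    by (auto simp: ennreal_less_iff)
  then show ?thesis using real by simp
next
  case top
  then show ?thesis by (simp add: less_top)
qed

text \<open>Cavalieri's principle: corresponding slices have the same length.\<close>

lemma emeasure_steiner:
  fixes E :: "('i \<Rightarrow> real) set"
  assumes E: "E \<in> sets (lborel_PiM I)" and "finite I" "i \<in> I"
  shows "emeasure (lborel_PiM I) (steiner I i E) = emeasure (lborel_PiM I) E"
proof -
  interpret product_sigma_finite "\<lambda>_::'i. lborel :: real measure" by standard
  define J where "J = I - {i}"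
  have I: "I = insert i J" and J: "finite J" "i \<notin> J" using assms by (auto simp: J_def)
  let ?MJ = "lborel_PiM J"
  have rep: "emeasure (lborel_PiM I) A = (\<integral>\<^sup>+x. emeasure lborel (slice i A x) \<partial>?MJ)"
    if A: "A \<in> sets (lborel_PiM I)" for A
  proof -
    have "emeasure (lborel_PiM I) A = (\<integral>\<^sup>+x. indicator A x \<partial>lborel_PiM I)"
      using A by simp
    also have "\<dots> = (\<integral>\<^sup>+x. \<integral>\<^sup>+y. indicator A (x(i := y)) \<partial>lborel \<partial>?MJ)"
    proof -
      have "(indicator A :: _ \<Rightarrow> ennreal) \<in> borel_measurable (lborel_PiM (insert i J))"
        using A by (simp add: I[symmetric])
      from product_nn_integral_insert[OF J this] show ?thesis by (simp add: I[symmetric])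
    qed
    also have "\<dots> = (\<integral>\<^sup>+x. emeasure lborel (slice i A x) \<partial>?MJ)"
      by (intro nn_integral_cong emeasure_slice_eq[OF A \<open>i \<in> I\<close>]) (simp add: J_def)
    finally show ?thesis .
  qed
  have "slice i (steiner I i E) x = {t. ennreal (2 * \<bar>t\<bar>) < emeasure lborel (slice i E x)}"
    if "x \<in> space ?MJ" for x
  proof -
    have "x(i := t) \<in> space (lborel_PiM I)" for t
      using that by (auto simp: I space_PiM PiE_iff extensional_def)
    then show ?thesis by (simp add: slice_def[of i "steiner I i E" x] set_eq_iff) (simp add: steiner_def)
  qed
  then show ?thesis
    using rep[OF E] rep[OF sets_steiner[OF assms]]
    by (simp add: emeasure_centered_interval cong: nn_integral_cong)
qed

text \<open>The slices of E through x and y have lengths above 2 |x i| and 2 |y i|, so they contain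
  a and b with |a - b| > |x i| + |y i|. Putting a and b into the i-th coordinates gives points of E
  at least as far apart as x and y, since the other coordinates are unchanged.\<close>

lemma steiner_diameter:
  fixes E :: "('i \<Rightarrow> real) set"
  assumes E: "E \<in> sets (lborel_PiM I)" and "finite I" "i \<in> I"
    and d: "\<And>x y. x \<in> E \<Longrightarrow> y \<in> E \<Longrightarrow> (\<Sum>j\<in>I. (x j - y j)\<^sup>2) \<le> d"
    and xy: "x \<in> steiner I i E" "y \<in> steiner I i E"
  shows "(\<Sum>j\<in>I. (x j - y j)\<^sup>2) \<le> d"
proof -
  have lx: "ennreal (2 * \<bar>x i\<bar>) < emeasure lborel (slice i E x)"
    and ly: "ennreal (2 * \<bar>y i\<bar>) < emeasure lborel (slice i E y)"
    using xy by (auto simp: steiner_def)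
  have "ennreal (2 * (\<bar>x i\<bar> + \<bar>y i\<bar>)) = ennreal (2 * \<bar>x i\<bar>) + ennreal (2 * \<bar>y i\<bar>)"
    by (subst ennreal_plus[symmetric]) (auto simp: distrib_left)
  also have "\<dots> < emeasure lborel (slice i E x) + emeasure lborel (slice i E y)"
  proof -
    have "ennreal (2 * \<bar>x i\<bar>) + ennreal (2 * \<bar>y i\<bar>) < ennreal (2 * \<bar>x i\<bar>) + emeasure lborel (slice i E y)"
      using ly by (simp add: ennreal_add_left_cancel_less)
    also have "\<dots> \<le> emeasure lborel (slice i E x) + emeasure lborel (slice i E y)"
      using lx by (intro add_right_mono) simp
    finally show ?thesis .
  qed
  finally have lt: "ennreal (2 * (\<bar>x i\<bar> + \<bar>y i\<bar>)) < \<dots>" .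
  have "slice i E x \<noteq> {}" "slice i E y \<noteq> {}" using lx ly by auto
  then obtain a b where ab: "a \<in> slice i E x" "b \<in> slice i E y" "\<bar>a - b\<bar> > \<bar>x i\<bar> + \<bar>y i\<bar>"
    using emeasure_add_le_of_diff_bounded[of "slice i E x" "slice i E y" "\<bar>x i\<bar> + \<bar>y i\<bar>"] lt
    by (meson not_le)
  have "\<bar>x i - y i\<bar> \<le> \<bar>a - b\<bar>" using ab(3) by linarith
  then have "(x i - y i)\<^sup>2 \<le> (a - b)\<^sup>2" by (simp add: abs_le_square_iff)
  moreover have "(\<Sum>j\<in>I. ((x(i := a)) j - (y(i := b)) j)\<^sup>2) \<le> d"
    using ab(1,2) unfolding slice_def mem_Collect_eq by (rule d)
  moreover have "(\<Sum>j\<in>I. ((x(i := a)) j - (y(i := b)) j)\<^sup>2) = (a - b)\<^sup>2 + (\<Sum>j\<in>I - {i}. (x j - y j)\<^sup>2)"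
    using assms(2,3) by (subst sum.remove[of _ i]) auto
  moreover have "(\<Sum>j\<in>I. (x j - y j)\<^sup>2) = (x i - y i)\<^sup>2 + (\<Sum>j\<in>I - {i}. (x j - y j)\<^sup>2)"
    using assms(2,3) by (subst sum.remove[of _ i]) auto
  ultimately show ?thesis by linarith
qed

lemma steiner_reflect_same:
  "i \<in> I \<Longrightarrow> x \<in> steiner I i E \<Longrightarrow> x(i := - x i) \<in> steiner I i E"
  by (auto simp: steiner_def space_PiM PiE_iff extensional_def)

text \<open>Symmetries obtained in earlier coordinates survive later symmetrizations: if E is
  symmetric in the j-th coordinate, its slices over x and over the reflection of x coincide.\<close>

lemma steiner_reflect_other:
  assumes "i \<noteq> j" "j \<in> I" "\<And>x. x \<in> E \<Longrightarrow> x(j := - x j) \<in> E" "x \<in> steiner I i E"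
  shows "x(j := - x j) \<in> steiner I i E"
proof -
  have "slice i E (x(j := - x j)) = slice i E x"
  proof (intro equalityI subsetI)
    fix t assume "t \<in> slice i E x"
    with assms(3)[of "x(i := t)"] assms(1) show "t \<in> slice i E (x(j := - x j))"
      by (simp add: slice_def fun_upd_twist)
  next
    fix t assume "t \<in> slice i E (x(j := - x j))"
    with assms(3)[of "x(j := - x j, i := t)"] assms(1) have "x(j := - x j, i := t, j := x j) \<in> E"
      by (simp add: slice_def)
    moreover have "x(j := - x j, i := t, j := x j) = x(i := t)" using assms(1) by auto
    ultimately show "t \<in> slice i E x"
      by (simp add: slice_def)
  qed
  with assms show ?thesis
    by (auto simp: steiner_def space_PiM PiE_iff extensional_def)
qed

lemma steiner_symmetrization:
  fixes E :: "('i \<Rightarrow> real) set"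
  assumes E: "E \<in> sets (lborel_PiM I)" and I: "finite I"
    and d: "\<And>x y. x \<in> E \<Longrightarrow> y \<in> E \<Longrightarrow> (\<Sum>j\<in>I. (x j - y j)\<^sup>2) \<le> d"
    and K: "finite K" "K \<subseteq> I"
  shows "\<exists>F \<in> sets (lborel_PiM I).
    emeasure (lborel_PiM I) F = emeasure (lborel_PiM I) E \<and>
    (\<forall>x\<in>F. \<forall>y\<in>F. (\<Sum>j\<in>I. (x j - y j)\<^sup>2) \<le> d) \<and> (\<forall>k\<in>K. \<forall>x\<in>F. x(k := - x k) \<in> F)"
  using K
proof (induction K rule: finite_induct)
  case empty
  show ?case using E d by (intro bexI[of _ E]) auto
next
  case (insert k K)
  then have "K \<subseteq> I" by simp
  from insert.IH[OF this] obtain F where F: "F \<in> sets (lborel_PiM I)"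
    and F': "emeasure (lborel_PiM I) F = emeasure (lborel_PiM I) E \<and>
      (\<forall>x\<in>F. \<forall>y\<in>F. (\<Sum>j\<in>I. (x j - y j)\<^sup>2) \<le> d) \<and> (\<forall>k\<in>K. \<forall>x\<in>F. x(k := - x k) \<in> F)" ..
  have Fd: "(\<Sum>j\<in>I. (x j - y j)\<^sup>2) \<le> d" if "x \<in> F" "y \<in> F" for x y
    using F' that by blast
  have Fs: "x(k := - x k) \<in> F" if "k \<in> K" "x \<in> F" for k x
    using F' that by blast
  have k: "k \<in> I" using insert.prems by simp
  have "x(j := - x j) \<in> steiner I k F" if "j \<in> insert k K" "x \<in> steiner I k F" for j x
  proof (cases "j = k")
    case True
    then show ?thesis using steiner_reflect_same[OF k that(2)] by simp
  next
    case False
    then have j: "j \<in> K" "j \<in> I" "k \<noteq> j" using that insert.prems by auto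
    show ?thesis by (rule steiner_reflect_other[OF j(3,2) Fs[OF j(1)] that(2)])
  qed
  then have "\<forall>j\<in>insert k K. \<forall>x\<in>steiner I k F. x(j := - x j) \<in> steiner I k F" by blast
  moreover have "emeasure (lborel_PiM I) (steiner I k F) = emeasure (lborel_PiM I) E"
    unfolding emeasure_steiner[OF F I k] using F' by (rule conjunct1)
  moreover have "\<forall>x\<in>steiner I k F. \<forall>y\<in>steiner I k F. (\<Sum>j\<in>I. (x j - y j)\<^sup>2) \<le> d"
    using steiner_diameter[OF F I k Fd] by blast
  ultimately show ?case
    using sets_steiner[OF F I k] by (intro bexI[of _ "steiner I k F"] conjI)
qed

text \<open>After symmetrization in all coordinates the set contains with x also its opposite point,
  at distance 2 |x|. It therefore lies in the ball of radius d/2 about the origin, while its volume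
  has not changed.\<close>

theorem isodiametric_PiM:
  fixes E :: "('i \<Rightarrow> real) set"
  assumes E: "E \<in> sets (lborel_PiM I)" and I: "finite I" and d: "d > 0"
    and diam: "\<And>x y. x \<in> E \<Longrightarrow> y \<in> E \<Longrightarrow> sqrt (\<Sum>j\<in>I. (x j - y j)\<^sup>2) \<le> d"
  shows "emeasure (lborel_PiM I) E \<le> ennreal (unit_ball_vol (card I) * (d / 2) ^ card I)"
proof -
  have diam2: "(\<Sum>j\<in>I. (x j - y j)\<^sup>2) \<le> d\<^sup>2" if "x \<in> E" "y \<in> E" for x y
    using diam[OF that] by (rule sqrt_le_D)
  obtain F where F: "F \<in> sets (lborel_PiM I)"
    and F': "emeasure (lborel_PiM I) F = emeasure (lborel_PiM I) E \<and>
      (\<forall>x\<in>F. \<forall>y\<in>F. (\<Sum>j\<in>I. (x j - y j)\<^sup>2) \<le> d\<^sup>2) \<and> (\<forall>k\<in>I. \<forall>x\<in>F. x(k := - x k) \<in> F)"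
    using steiner_symmetrization[OF E I diam2 I order_refl] ..
  have Fd: "(\<Sum>j\<in>I. (x j - y j)\<^sup>2) \<le> d\<^sup>2" if "x \<in> F" "y \<in> F" for x y
    using F' that by blast
  have Fs: "x(k := - x k) \<in> F" if "k \<in> I" "x \<in> F" for k x
    using F' that by blast
  \<comment> \<open>Points of the product space are \<open>undefined\<close> outside I, so the
    opposite point must change only the coordinates in I; it is reached by reflecting one coordinate
    at a time.\<close>
  have refl: "(\<lambda>i. if i \<in> K then - x i else x i) \<in> F" if "x \<in> F" "finite K" "K \<subseteq> I" for x K
    using that(2,3)
  proof (induction K rule: finite_induct)
    case empty
    show ?case using that(1) by (simp only: empty_iff if_False)
  next
    case (insert k K)
    have "(\<lambda>i. if i \<in> insert k K then - x i else x i) =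
        (\<lambda>i. if i \<in> K then - x i else x i)(k := - (if k \<in> K then - x k else x k))"
      using insert.hyps by auto
    moreover have "k \<in> I" "K \<subseteq> I" using insert.prems by auto
    ultimately show ?case
      using Fs[OF \<open>k \<in> I\<close> insert.IH[OF \<open>K \<subseteq> I\<close>]] by (simp only:)
  qed
  have "F \<subseteq> {f. sqrt (\<Sum>i\<in>I. (f i)\<^sup>2) \<le> d / 2} \<inter> space (lborel_PiM I)"
  proof
    fix x assume x: "x \<in> F"
    have "(\<Sum>j\<in>I. (x j - (if j \<in> I then - x j else x j))\<^sup>2) \<le> d\<^sup>2"
      using Fd[OF x refl[OF x I order_refl]] .
    moreover have "(\<Sum>j\<in>I. (x j - (if j \<in> I then - x j else x j))\<^sup>2) = 4 * (\<Sum>j\<in>I. (x j)\<^sup>2)"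
      unfolding sum_distrib_left by (intro sum.cong) (auto simp: power2_eq_square)
    ultimately have "(\<Sum>j\<in>I. (x j)\<^sup>2) \<le> (d / 2)\<^sup>2" by (simp add: power2_eq_square)
    then have "sqrt (\<Sum>j\<in>I. (x j)\<^sup>2) \<le> d / 2" using d by (intro real_le_lsqrt) (auto intro: sum_nonneg)
    then show "x \<in> {f. sqrt (\<Sum>i\<in>I. (f i)\<^sup>2) \<le> d / 2} \<inter> space (lborel_PiM I)"
      using sets.sets_into_space[OF F] x by auto
  qed
  then have "emeasure (lborel_PiM I) F \<le>
      emeasure (lborel_PiM I) ({f. sqrt (\<Sum>i\<in>I. (f i)\<^sup>2) \<le> d / 2} \<inter> space (lborel_PiM I))"
    by (rule emeasure_mono) measurable
  also have "\<dots> = ennreal (unit_ball_vol (card I) * (d / 2) ^ card I)"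
    using d by (intro emeasure_cball_aux I) auto
  finally show ?thesis using conjunct1[OF F'] by (simp only:)
qed

subsection \<open>Lebesgue measure in orthonormal coordinates\<close>

definition orthonormal :: "'a::euclidean_space set \<Rightarrow> bool" where
  "orthonormal B \<longleftrightarrow> pairwise orthogonal B \<and> (\<forall>b\<in>B. norm b = 1)"

definition lincomb :: "'a::euclidean_space set \<Rightarrow> ('a \<Rightarrow> real) \<Rightarrow> 'a" where
  "lincomb B w = (\<Sum>b\<in>B. w b *\<^sub>R b)"

lemma orthonormal_subset: "orthonormal B \<Longrightarrow> C \<subseteq> B \<Longrightarrow> orthonormal C"
  by (auto simp: orthonormal_def pairwise_def)

lemma orthonormal_inner:
  "orthonormal B \<Longrightarrow> b \<in> B \<Longrightarrow> c \<in> B \<Longrightarrow> b \<bullet> c = (if b = c then 1 else 0)"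
  by (auto simp: orthonormal_def pairwise_def orthogonal_def norm_eq_1)

lemma lincomb_inner:
  assumes "orthonormal B" "finite B" "b \<in> B"
  shows "lincomb B w \<bullet> b = w b"
proof -
  have "lincomb B w \<bullet> b = (\<Sum>c\<in>B. w c * (if c = b then 1 else 0))"
    unfolding lincomb_def inner_sum_left using orthonormal_inner[OF assms(1) _ assms(3)]
    by (intro sum.cong) auto
  also have "\<dots> = (\<Sum>c\<in>B. if c = b then w c else 0)" by (intro sum.cong) auto
  finally show ?thesis using assms by simp
qed

lemma lincomb_norm:
  assumes "orthonormal B" "finite B"
  shows "norm (lincomb B w) = sqrt (\<Sum>b\<in>B. (w b)\<^sup>2)"
proof -
  have "lincomb B w \<bullet> lincomb B w = (\<Sum>b\<in>B. w b * (lincomb B w \<bullet> b))"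
    by (subst (2) lincomb_def) (simp add: inner_sum_right)
  then show ?thesis
    using lincomb_inner[OF assms] by (simp add: norm_eq_sqrt_inner power2_eq_square)
qed

lemma lincomb_diff: "lincomb B v - lincomb B w = lincomb B (\<lambda>b. v b - w b)"
  by (simp add: lincomb_def sum_subtractf scaleR_diff_left)

lemma lincomb_measurable [measurable]:
  "lincomb B \<in> borel_measurable (lborel_PiM B)"
  unfolding lincomb_def by measurable

lemma orthonormal_expansion:
  fixes B :: "'a::euclidean_space set"
  assumes B: "orthonormal B" "finite B" "card B = DIM('a)"
  shows "lincomb B (\<lambda>b. y \<bullet> b) = y"
proof -
  have "0 \<notin> B" using B(1) by (auto simp: orthonormal_def)
  then have ind: "independent B"
    using B(1) by (intro pairwise_orthogonal_independent) (auto simp: orthonormal_def)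
  then have "span B = UNIV"
    using card_ge_dim_independent[of B UNIV] B(3) by (auto simp: dim_UNIV)
  moreover have "orthogonal (y - lincomb B (\<lambda>b. y \<bullet> b)) x" if "x \<in> span B" for x
  proof (rule orthogonal_to_span[OF that])
    fix b assume "b \<in> B"
    then show "orthogonal (y - lincomb B (\<lambda>b. y \<bullet> b)) b"
      using lincomb_inner[OF B(1,2)] by (simp add: orthogonal_def inner_diff_left)
  qed
  ultimately have "orthogonal (y - lincomb B (\<lambda>b. y \<bullet> b)) (y - lincomb B (\<lambda>b. y \<bullet> b))" by blast
  then show ?thesis by (simp add: orthogonal_self)
qed

lemma distr_PiM_lborel_translate:
  fixes a :: "'i \<Rightarrow> real"
  assumes "finite I"
  shows "distr (lborel_PiM I) (lborel_PiM I) (\<lambda>w. \<lambda>i\<in>I. a i + w i) = lborel_PiM I"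
proof -
  interpret product_sigma_finite "\<lambda>_::'i. lborel :: real measure" by standard
  let ?M = "lborel_PiM I"
  show ?thesis
  proof (rule PiM_eqI[OF assms])
    fix A :: "'i \<Rightarrow> real set" assume A: "\<And>i. i \<in> I \<Longrightarrow> A i \<in> sets lborel"
    have A': "(+) (a i) -` A i \<in> sets lborel" if "i \<in> I" for i
      using measurable_sets[of "(+) (a i)" borel borel "A i"] A[OF that] by simp
    have "(\<lambda>w. \<lambda>i\<in>I. a i + w i) -` Pi\<^sub>E I A \<inter> space ?M = Pi\<^sub>E I (\<lambda>i. (+) (a i) -` A i)"
      by (auto simp: space_PiM PiE_iff)
    then have "emeasure (distr ?M ?M (\<lambda>w. \<lambda>i\<in>I. a i + w i)) (Pi\<^sub>E I A)
        = emeasure ?M (Pi\<^sub>E I (\<lambda>i. (+) (a i) -` A i))"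
      using A assms by (subst emeasure_distr) (auto intro!: sets_PiM_I_finite)
    also have "\<dots> = (\<Prod>i\<in>I. emeasure lborel ((+) (a i) -` A i))"
      using A' assms by (intro emeasure_PiM) auto
    also have "\<dots> = (\<Prod>i\<in>I. emeasure lborel (A i))"
    proof (intro prod.cong refl)
      fix i assume "i \<in> I"
      then have "emeasure (distr lborel borel ((+) (a i))) (A i) = emeasure lborel ((+) (a i) -` A i)"
        using A[OF \<open>i \<in> I\<close>] by (subst emeasure_distr) auto
      then show "emeasure lborel ((+) (a i) -` A i) = emeasure lborel (A i)"
        by (simp add: lborel_distr_plus)
    qed
    finally show "emeasure (distr ?M ?M (\<lambda>w. \<lambda>i\<in>I. a i + w i)) (Pi\<^sub>E I A) = (\<Prod>i\<in>I. emeasure lborel (A i))" .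
  qed simp
qed

text \<open>Uniqueness of Haar measure: both sides are translation invariant and agree on the unit ball.\<close>

theorem nn_integral_lborel_orthonormal:
  fixes B :: "'a::euclidean_space set" and g :: "'a \<Rightarrow> ennreal"
  assumes B: "orthonormal B" "finite B" "card B = DIM('a)" and [measurable]: "g \<in> borel_measurable borel"
  shows "(\<integral>\<^sup>+z. g z \<partial>lborel) = (\<integral>\<^sup>+w. g (lincomb B w) \<partial>lborel_PiM B)"
proof -
  let ?M = "lborel_PiM B"
  interpret product_sigma_finite "\<lambda>_::'a. lborel :: real measure" by standard
  interpret M: sigma_finite_measure ?M by (rule sigma_finite[OF B(2)])
  interpret P: pair_sigma_finite ?M "lborel :: 'a measure" by standard
  define h :: "'a \<Rightarrow> ennreal" where "h = indicator (cball 0 1)"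
  have [measurable]: "h \<in> borel_measurable borel"
    unfolding h_def by (intro borel_measurable_indicator) simp
  have shift: "(\<integral>\<^sup>+w. f (y + lincomb B w) \<partial>?M) = (\<integral>\<^sup>+w. f (lincomb B w) \<partial>?M)"
    if [measurable]: "f \<in> borel_measurable borel" for y and f :: "'a \<Rightarrow> ennreal"
  proof -
    have [measurable]: "(\<lambda>w. \<lambda>i\<in>B. y \<bullet> i + w i) \<in> ?M \<rightarrow>\<^sub>M ?M" by measurable
    have comb: "lincomb B (\<lambda>i\<in>B. y \<bullet> i + w i) = y + lincomb B w" for w
    proof -
      have "lincomb B (\<lambda>i\<in>B. y \<bullet> i + w i) = lincomb B (\<lambda>b. y \<bullet> b) + lincomb B w"
        by (simp add: lincomb_def scaleR_add_left sum.distrib cong: sum.cong)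
      then show ?thesis by (simp add: orthonormal_expansion[OF B])
    qed
    have "(\<integral>\<^sup>+w. f (lincomb B w) \<partial>?M) = (\<integral>\<^sup>+w. f (lincomb B w) \<partial>distr ?M ?M (\<lambda>w. \<lambda>i\<in>B. y \<bullet> i + w i))"
      by (simp add: distr_PiM_lborel_translate[OF B(2)])
    also have "\<dots> = (\<integral>\<^sup>+w. f (lincomb B (\<lambda>i\<in>B. y \<bullet> i + w i)) \<partial>?M)"
      by (subst nn_integral_distr) auto
    finally show ?thesis by (simp add: comb)
  qed
  \<comment> \<open>With L for \<open>lincomb B\<close>, the double integral of g(Lw) h(y - Lw) is
    evaluated in both orders. Translating y removes Lw from h; translating w by the coordinates of y
    instead, and then y by Lw, puts the integration over y on g. The ball indicator h is even, so
    both products contain the volume of the unit ball, which is positive and finite and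
    cancels.\<close>
  have "(\<integral>\<^sup>+w. g (lincomb B w) \<partial>?M) * (\<integral>\<^sup>+y. h y \<partial>lborel)
      = (\<integral>\<^sup>+w. \<integral>\<^sup>+y. g (lincomb B w) * h y \<partial>lborel \<partial>?M)"
    by (simp add: nn_integral_cmult nn_integral_multc)
  also have "\<dots> = (\<integral>\<^sup>+w. \<integral>\<^sup>+y. g (lincomb B w) * h (- lincomb B w + y) \<partial>lborel \<partial>?M)"
    by (intro nn_integral_cong nn_integral_lborel_translate[symmetric]) measurable
  also have "\<dots> = (\<integral>\<^sup>+y. \<integral>\<^sup>+w. g (lincomb B w) * h (- lincomb B w + y) \<partial>?M \<partial>lborel)"
    by (rule P.Fubini'[symmetric]) measurable
  also have "\<dots> = (\<integral>\<^sup>+y. \<integral>\<^sup>+w. g (y + lincomb B w) * h (- lincomb B w) \<partial>?M \<partial>lborel)"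
  proof (rule nn_integral_cong)
    fix y
    show "(\<integral>\<^sup>+w. g (lincomb B w) * h (- lincomb B w + y) \<partial>?M) =
        (\<integral>\<^sup>+w. g (y + lincomb B w) * h (- lincomb B w) \<partial>?M)"
      using shift[of "\<lambda>x. g x * h (- x + y)" y] by simp
  qed
  also have "\<dots> = (\<integral>\<^sup>+w. \<integral>\<^sup>+y. g (y + lincomb B w) * h (- lincomb B w) \<partial>lborel \<partial>?M)"
    by (rule P.Fubini') measurable
  also have "\<dots> = (\<integral>\<^sup>+w. (\<integral>\<^sup>+y. g y \<partial>lborel) * h (- lincomb B w) \<partial>?M)"
  proof (rule nn_integral_cong)
    fix w
    have "(\<integral>\<^sup>+y. g (y + lincomb B w) * h (- lincomb B w) \<partial>lborel)
        = (\<integral>\<^sup>+y. g (lincomb B w + y) \<partial>lborel) * h (- lincomb B w)"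
      by (subst nn_integral_multc) (auto simp: add.commute)
    then show "(\<integral>\<^sup>+y. g (y + lincomb B w) * h (- lincomb B w) \<partial>lborel)
        = (\<integral>\<^sup>+y. g y \<partial>lborel) * h (- lincomb B w)"
      by (simp add: nn_integral_lborel_translate)
  qed
  also have "\<dots> = (\<integral>\<^sup>+y. g y \<partial>lborel) * (\<integral>\<^sup>+w. h (lincomb B w) \<partial>?M)"
    by (simp add: nn_integral_cmult h_def indicator_def)
  also have "(\<integral>\<^sup>+w. h (lincomb B w) \<partial>?M) = (\<integral>\<^sup>+w. indicator ({f. sqrt (\<Sum>i\<in>B. (f i)\<^sup>2) \<le> 1} \<inter> space ?M) w \<partial>?M)"
    by (intro nn_integral_cong) (auto simp: h_def lincomb_norm[OF B(1,2)] split: split_indicator)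
  also have "\<dots> = emeasure ?M ({f. sqrt (\<Sum>i\<in>B. (f i)\<^sup>2) \<le> 1} \<inter> space ?M)"
    by (rule nn_integral_indicator) measurable
  also have "\<dots> = ennreal (unit_ball_vol (DIM('a)))"
    using emeasure_cball_aux[OF B(2), of 1] B(3) by simp
  finally have "(\<integral>\<^sup>+w. g (lincomb B w) \<partial>?M) * (\<integral>\<^sup>+y. h y \<partial>lborel)
      = (\<integral>\<^sup>+y. g y \<partial>lborel) * ennreal (unit_ball_vol (DIM('a)))" .
  moreover have "(\<integral>\<^sup>+y. h y \<partial>lborel) = ennreal (unit_ball_vol (DIM('a)))"
    by (simp add: h_def emeasure_cball)
  moreover have "0 < unit_ball_vol (DIM('a))" by simp
  ultimately show ?thesis
    by (auto simp: mult.commute[of _ "ennreal _"] ennreal_mult_cancel_left ennreal_eq_0_iff)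
qed

text \<open>Splits off the two coordinates used by the projection from the sphere: the height s over
  the hyperplane and the height h along the base point t.\<close>

corollary nn_integral_lborel_two_directions:
  fixes B :: "'a::euclidean_space set" and g :: "'a \<Rightarrow> ennreal"
  assumes B: "orthonormal (insert n (insert t B))" "finite B" "n \<notin> insert t B" "t \<notin> B"
    "card B + 2 = DIM('a)" and [measurable]: "g \<in> borel_measurable borel"
  shows "(\<integral>\<^sup>+z. g z \<partial>lborel) =
    (\<integral>\<^sup>+s. \<integral>\<^sup>+h. \<integral>\<^sup>+w. g (lincomb B w + h *\<^sub>R t + s *\<^sub>R n) \<partial>lborel_PiM B \<partial>lborel \<partial>lborel)"
proof -
  interpret product_sigma_finite "\<lambda>_::'a. lborel :: real measure" by standard
  have upd: "lincomb (insert i J) (w(i := s)) = lincomb J w + s *\<^sub>R i"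
    if "finite J" "i \<notin> J" for i :: 'a and J w s
  proof -
    have "lincomb J (w(i := s)) = lincomb J w"
      unfolding lincomb_def using that by (intro sum.cong) auto
    then show ?thesis using that by (simp add: lincomb_def add.commute)
  qed
  have "(\<integral>\<^sup>+z. g z \<partial>lborel) = (\<integral>\<^sup>+w. g (lincomb (insert n (insert t B)) w) \<partial>lborel_PiM (insert n (insert t B)))"
    using B by (intro nn_integral_lborel_orthonormal) auto
  also have "\<dots> = (\<integral>\<^sup>+s. \<integral>\<^sup>+w. g (lincomb (insert n (insert t B)) (w(n := s))) \<partial>lborel_PiM (insert t B) \<partial>lborel)"
    using B by (intro product_nn_integral_insert_rev) auto
  also have "\<dots> = (\<integral>\<^sup>+s. \<integral>\<^sup>+w. g (lincomb (insert t B) w + s *\<^sub>R n) \<partial>lborel_PiM (insert t B) \<partial>lborel)"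
    using B by (simp add: upd)
  also have "\<dots> = (\<integral>\<^sup>+s. \<integral>\<^sup>+h. \<integral>\<^sup>+w. g (lincomb (insert t B) (w(t := h)) + s *\<^sub>R n) \<partial>lborel_PiM B \<partial>lborel \<partial>lborel)"
    using B by (intro nn_integral_cong product_nn_integral_insert_rev) auto
  also have "\<dots> = (\<integral>\<^sup>+s. \<integral>\<^sup>+h. \<integral>\<^sup>+w. g (lincomb B w + h *\<^sub>R t + s *\<^sub>R n) \<partial>lborel_PiM B \<partial>lborel \<partial>lborel)"
    using B by (simp add: upd)
  finally show ?thesis .
qed

lemma orthonormal_completion:
  fixes n t :: "'a::euclidean_space"
  assumes nt: "norm n = 1" "norm t = 1" "t \<bullet> n = 0"
  obtains B where "orthonormal (insert n (insert t B))" "finite B" "n \<notin> insert t B" "t \<notin> B"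
    "card B + 2 = DIM('a)"
proof -
  have "n \<noteq> t" using nt by (auto simp: norm_eq_1)
  have S: "pairwise orthogonal {n, t}" "\<And>x. x \<in> {n, t} \<Longrightarrow> norm x = 1"
    using nt by (auto simp: pairwise_def orthogonal_def inner_commute)
  obtain U where U: "U \<inter> insert 0 {n, t} = {}" "pairwise orthogonal ({n, t} \<union> U)"
    "span ({n, t} \<union> U) = span ({n, t} \<union> (UNIV :: 'a set))"
    using orthogonal_extension_strong[OF S(1), of UNIV] by metis
  define B where "B = (\<lambda>u. u /\<^sub>R norm u) ` U"
  have U0: "u \<noteq> 0" "u \<noteq> n" "u \<noteq> t" if "u \<in> U" for u using U(1) that by auto
  have orthU: "orthogonal u v" if "u \<in> {n, t} \<union> U" "v \<in> {n, t} \<union> U" "u \<noteq> v" for u v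
    using U(2) that by (auto simp: pairwise_def)
  have orthB: "orthogonal b n \<and> orthogonal b t" if "b \<in> B" for b
    using that U0 orthU by (auto simp: B_def orthogonal_def)
  have normB: "norm b = 1" if "b \<in> B" for b
    using that U0 by (auto simp: B_def)
  have orthBB: "orthogonal b c" if "b \<in> B" "c \<in> B" "b \<noteq> c" for b c
  proof -
    from that obtain u v where uv: "u \<in> U" "v \<in> U" "b = u /\<^sub>R norm u" "c = v /\<^sub>R norm v"
      by (auto simp: B_def)
    then have "u \<noteq> v" using that by auto
    then show ?thesis using orthU[of u v] uv by (simp add: orthogonal_def)
  qed
  have on: "orthonormal (insert n (insert t B))"
    unfolding orthonormal_def
  proof
    show "pairwise orthogonal (insert n (insert t B))"
      using orthB orthBB nt by (auto simp: pairwise_insert pairwise_def orthogonal_def inner_commute)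
    show "\<forall>b\<in>insert n (insert t B). norm b = 1" using nt normB by auto
  qed
  then have ind: "independent (insert n (insert t B))"
    by (intro pairwise_orthogonal_independent) (auto simp: orthonormal_def)
  then have fin: "finite (insert n (insert t B))" by (rule independent_imp_finite)
  have notin: "n \<notin> B" "t \<notin> B" using orthB nt by (auto simp: orthogonal_def norm_eq_1)
  have "u \<in> span (insert n (insert t B))" if "u \<in> {n, t} \<union> U" for u
  proof (cases "u \<in> U")
    case True
    then have "norm u *\<^sub>R (u /\<^sub>R norm u) \<in> span (insert n (insert t B))"
      by (intro span_mul span_base) (auto simp: B_def)
    then show ?thesis using U0[OF True] by simp
  next
    case False
    then show ?thesis using that by (auto intro: span_base)
  qed
  then have "span ({n, t} \<union> U) \<subseteq> span (insert n (insert t B))"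
    by (intro span_minimal) auto
  then have "span (insert n (insert t B)) = UNIV" using U(3) by auto
  then have "card (insert n (insert t B)) = DIM('a)"
    using dim_eq_card_independent[OF ind] by (metis dim_UNIV dim_span)
  then have "card B + 2 = DIM('a)" using fin notin \<open>n \<noteq> t\<close> by simp
  then show ?thesis using that on fin notin \<open>n \<noteq> t\<close> by auto
qed

subsection \<open>The cone measure of the unit sphere of a hyperplane\<close>

definition hsphere :: "'a::euclidean_space \<Rightarrow> 'a set" where
  "hsphere n = {\<theta>. norm \<theta> = 1 \<and> \<theta> \<bullet> n = 0}"

text \<open>The punctured unit ball of the hyperplane times a unit interval along n, so that
  N-dimensional volume here is (N-1)-dimensional volume of the ball. Without the axis,
  \<open>perp_dir\<close> is a unit vector throughout.\<close>

definition slab :: "'a::euclidean_space \<Rightarrow> 'a set" where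
  "slab n = {z. 0 < z \<bullet> n \<and> z \<bullet> n < 1 \<and> 0 < norm (perp n z) \<and> norm (perp n z) < 1}"

definition perp_dir :: "'a::euclidean_space \<Rightarrow> 'a \<Rightarrow> 'a" where
  "perp_dir n z = perp n z /\<^sub>R norm (perp n z)"

text \<open>The factor is the ratio between the surface area of the unit sphere and the volume of
  the unit ball in dimension N - 1.\<close>

definition cone_measure :: "'a::euclidean_space \<Rightarrow> 'a measure" where
  "cone_measure n = distr (density lborel (\<lambda>z. ennreal (real (DIM('a) - 1)) * indicator (slab n) z))
     borel (perp_dir n)"

lemma sets_slab [measurable]: "slab n \<in> sets borel"
  unfolding slab_def by measurable

lemma perp_dir_measurable [measurable]: "perp_dir n \<in> borel_measurable borel"
  unfolding perp_dir_def by measurable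

lemma sets_cone_measure [simp, measurable_cong]: "sets (cone_measure n) = sets borel"
  by (simp add: cone_measure_def)

lemma space_cone_measure [simp]: "space (cone_measure n) = UNIV"
  by (simp add: cone_measure_def)

lemma emeasure_cone_measure:
  fixes n :: "'a::euclidean_space"
  assumes [measurable]: "E \<in> sets borel"
  shows "emeasure (cone_measure n) E =
    ennreal (real (DIM('a) - 1)) * (\<integral>\<^sup>+z. indicator (slab n \<inter> perp_dir n -` E) z \<partial>lborel)"
proof -
  have [measurable]: "perp_dir n -` E \<in> sets borel"
    using measurable_sets[OF perp_dir_measurable assms, of n] by simp
  have "emeasure (cone_measure n) E = emeasure (density lborel
      (\<lambda>z. ennreal (real (DIM('a) - 1)) * indicator (slab n) z)) (perp_dir n -` E)"
    unfolding cone_measure_def by (subst emeasure_distr) auto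
  also have "\<dots> = (\<integral>\<^sup>+z. ennreal (real (DIM('a) - 1)) * indicator (slab n \<inter> perp_dir n -` E) z \<partial>lborel)"
    by (subst emeasure_density) (auto simp: indicator_inter_arith mult.assoc)
  also have "\<dots> = ennreal (real (DIM('a) - 1)) * (\<integral>\<^sup>+z. indicator (slab n \<inter> perp_dir n -` E) z \<partial>lborel)"
    by (rule nn_integral_cmult) measurable
  finally show ?thesis .
qed

lemma slab_subset_ball:
  assumes "norm n = 1"
  shows "slab n \<subseteq> ball 0 2"
proof
  fix z assume z: "z \<in> slab n"
  have "(norm (perp n z))\<^sup>2 < 1\<^sup>2" "(z \<bullet> n)\<^sup>2 < 1\<^sup>2"
    using z power_strict_mono[of "norm (perp n z)" 1 2] power_strict_mono[of "z \<bullet> n" 1 2]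
    by (auto simp: slab_def)
  then have "(norm z)\<^sup>2 < 2\<^sup>2" using norm_perp_Pythagoras[OF assms, of z] by simp
  then show "z \<in> ball 0 2" using power2_less_imp_less[of "norm z" 2] by simp
qed

lemma finite_measure_cone_measure:
  fixes n :: "'a::euclidean_space"
  assumes "norm n = 1"
  shows "finite_measure (cone_measure n)"
proof
  have "(\<integral>\<^sup>+z. indicator (slab n \<inter> perp_dir n -` UNIV) z \<partial>lborel) = emeasure lborel (slab n)" by simp
  also have "\<dots> \<le> emeasure lborel (ball (0::'a) 2)"
    using slab_subset_ball[OF assms] by (rule emeasure_mono) simp
  also have "\<dots> < \<infinity>" by (rule emeasure_bounded_finite) simp
  finally have "emeasure (cone_measure n) UNIV < \<infinity>"
    by (subst emeasure_cone_measure) (auto simp: ennreal_mult_less_top)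
  then show "emeasure (cone_measure n) (space (cone_measure n)) \<noteq> \<infinity>" by simp
qed

lemma perp_dir_in_hsphere:
  assumes "norm n = 1" "z \<in> slab n"
  shows "perp_dir n z \<in> hsphere n"
  using assms perp_inner[OF assms(1), of z] by (auto simp: perp_dir_def hsphere_def slab_def)

lemma norm_diff_unit:
  "norm a = 1 \<Longrightarrow> norm b = 1 \<Longrightarrow> (norm (a - b))\<^sup>2 = 2 - 2 * (a \<bullet> b)"
  by (simp add: power2_norm_eq_inner inner_diff_left inner_diff_right inner_commute norm_eq_1)

text \<open>Both points have the same height over \<open>t\<close>, so their difference is a difference of gnomonic
  projections, and these distort distances by a factor tending to 1 near \<open>t\<close>.\<close>

lemma gnomonic_bound:
  fixes t y y' :: "'a::euclidean_space"
  assumes t: "norm t = 1" and h: "y \<bullet> t = h" "y' \<bullet> t = h" "h > 0" and d: "0 < d" "d \<le> 1/4"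
    and close: "norm (y /\<^sub>R norm y - t) \<le> d" "norm (y' /\<^sub>R norm y' - t) \<le> d"
      "norm (y /\<^sub>R norm y - y' /\<^sub>R norm y') \<le> d"
  shows "norm (y - y') \<le> h * (d * (1 + 4 * d))"
proof -
  have y0: "y \<noteq> 0" "y' \<noteq> 0" using h by auto
  define a b where "a = h / norm y" and "b = h / norm y'"
  define \<theta> \<phi> where "\<theta> = y /\<^sub>R norm y" and "\<phi> = y' /\<^sub>R norm y'"
  have n1: "norm \<theta> = 1" "norm \<phi> = 1" using y0 by (auto simp: \<theta>_def \<phi>_def)
  have ab: "\<theta> \<bullet> t = a" "\<phi> \<bullet> t = b" using h by (auto simp: \<theta>_def \<phi>_def a_def b_def divide_inverse mult.commute)
  have low: "1 - d\<^sup>2 / 2 \<le> c" if "norm p = 1" "norm (p - t) \<le> d" "p \<bullet> t = c" for p c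
  proof -
    have "(norm (p - t))\<^sup>2 = 2 - 2 * c"
      using norm_diff_unit[OF that(1) t] that(3) by simp
    moreover have "(norm (p - t))\<^sup>2 \<le> d\<^sup>2" using that by (intro power_mono) auto
    ultimately show ?thesis by simp
  qed
  \<comment> \<open>The cosine falls short of 1 only quadratically, by d^2 / 2, so for d at most 1/4
    a factor 1 + d makes up for it.\<close>
  have inv: "0 < c \<and> 1 / c \<le> 1 + d" if "1 - d\<^sup>2 / 2 \<le> c" for c
  proof -
    have d2: "d\<^sup>2 \<le> d / 4" using mult_left_mono[of d "1/4" d] d by (simp add: power2_eq_square)
    then have c0: "c > 0" using that d by linarith
    have "1 \<le> (1 + d) * (1 - d\<^sup>2 / 2)"
    proof -
      have "d * d\<^sup>2 \<le> d * (d / 4)" using d2 d by (intro mult_left_mono) auto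
      moreover have "(1 + d) * (1 - d\<^sup>2 / 2) = 1 + d - d\<^sup>2 / 2 - d * d\<^sup>2 / 2" by (simp add: algebra_simps)
      moreover have "d * (d / 4) = d\<^sup>2 / 4" by (simp add: power2_eq_square)
      ultimately show ?thesis using d d2 by linarith
    qed
    also have "\<dots> \<le> (1 + d) * c" using that d by (intro mult_left_mono) auto
    finally show ?thesis using c0 by (simp add: field_simps)
  qed
  have a: "0 < a" "1 / a \<le> 1 + d" and b: "0 < b" "1 / b \<le> 1 + d"
    using inv[OF low[OF n1(1) _ ab(1)]] inv[OF low[OF n1(2) _ ab(2)]] close by (auto simp: \<theta>_def \<phi>_def)
  have ya: "y = (h / a) *\<^sub>R \<theta>" and yb: "y' = (h / b) *\<^sub>R \<phi>"
    using h y0 by (auto simp: a_def b_def \<theta>_def \<phi>_def)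
  define v w where "v = perp t \<theta>" and "w = perp t \<phi>"
  have tv: "\<theta> = v + a *\<^sub>R t" "\<phi> = w + b *\<^sub>R t" using ab by (simp_all add: v_def w_def perp_def)
  \<comment> \<open>The components along t both equal h and cancel; only the tangential parts v / a
    and w / b remain.\<close>
  have "y - y' = h *\<^sub>R ((1 / a) *\<^sub>R v - (1 / b) *\<^sub>R w)"
    unfolding ya yb tv using a b by (simp add: scaleR_add_right scaleR_diff_right)
  also have "(1 / a) *\<^sub>R v - (1 / b) *\<^sub>R w = (1 / a) *\<^sub>R (v - w) + (1 / a - 1 / b) *\<^sub>R w"
    by (simp add: scaleR_diff_right scaleR_diff_left)
  finally have eq: "norm (y - y') = h * norm ((1 / a) *\<^sub>R (v - w) + (1 / a - 1 / b) *\<^sub>R w)"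
    using h by simp
  have vw: "norm (v - w) \<le> d"
  proof -
    have "v - w = perp t (\<theta> - \<phi>)"
      by (simp add: v_def w_def perp_def inner_diff_left scaleR_diff_left)
    then show ?thesis using norm_perp_le[OF t, of "\<theta> - \<phi>"] close(3) by (simp add: \<theta>_def \<phi>_def)
  qed
  have w: "norm w \<le> d"
  proof -
    have "w = perp t (\<phi> - t)"
      using t by (simp add: w_def perp_def inner_diff_left scaleR_diff_left norm_eq_1)
    then show ?thesis using norm_perp_le[OF t, of "\<phi> - t"] close(2) by (simp add: \<phi>_def)
  qed
  have "b - a = (\<phi> - \<theta>) \<bullet> t" using ab by (simp add: inner_diff_left)
  then have "\<bar>b - a\<bar> \<le> norm (\<phi> - \<theta>) * norm t" using Cauchy_Schwarz_ineq2 by metis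
  then have ba: "\<bar>b - a\<bar> \<le> d" using close(3) t by (simp add: \<theta>_def \<phi>_def norm_minus_commute)
  define q where "q = (1 / a) * (1 / b)"
  have q0: "0 \<le> q" using a b by (simp add: q_def)
  have q1: "q \<le> (1 + d) * (1 + d)" unfolding q_def using a b d by (intro mult_mono) auto
  have "1 / a - 1 / b = (b - a) * q" using a b by (simp add: q_def field_simps)
  then have "\<bar>1 / a - 1 / b\<bar> = \<bar>b - a\<bar> * q" using q0 by (simp add: abs_mult)
  also have "\<dots> \<le> d * ((1 + d) * (1 + d))"
    using ba q1 q0 d by (intro mult_mono) auto
  finally have iab: "\<bar>1 / a - 1 / b\<bar> \<le> d * ((1 + d) * (1 + d))" .
  have "norm ((1 / a - 1 / b) *\<^sub>R w) \<le> (d * ((1 + d) * (1 + d))) * d"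
    unfolding norm_scaleR using d by (intro mult_mono[OF iab w]) simp_all
  moreover have "\<bar>1 / a\<bar> \<le> 1 + d" using a by simp
  then have "norm ((1 / a) *\<^sub>R (v - w)) \<le> (1 + d) * d"
    unfolding norm_scaleR using d by (intro mult_mono[OF _ vw]) simp_all
  ultimately have "norm ((1 / a) *\<^sub>R (v - w) + (1 / a - 1 / b) *\<^sub>R w)
      \<le> (1 + d) * d + (d * ((1 + d) * (1 + d))) * d"
    by (intro order_trans[OF norm_triangle_ineq] add_mono)
  also have "\<dots> = d * (1 + d * (1 + (1 + d) * (1 + d)))" by (simp add: algebra_simps)
  \<comment> \<open>Origin of the 4: (1 + d)^2 is at most 25/16 for d up to 1/4, so 1 + (1 + d)^2
    stays below 4.\<close>
  also have "\<dots> \<le> d * (1 + d * 4)"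
  proof -
    have "(1 + d) * (1 + d) \<le> (5/4) * (5/4)" using d by (intro mult_mono) auto
    then have "d * (1 + (1 + d) * (1 + d)) \<le> d * 4" using d by (intro mult_left_mono) auto
    then show ?thesis using d by (intro mult_left_mono add_left_mono) auto
  qed
  finally have "norm ((1 / a) *\<^sub>R (v - w) + (1 / a - 1 / b) *\<^sub>R w) \<le> d * (1 + 4 * d)"
    by (simp only: mult.commute[of d 4])
  then show ?thesis unfolding eq using h by (intro mult_left_mono) auto
qed

lemma nn_integral_power_unit:
  assumes "c \<ge> 0" "a \<ge> 0"
  shows "(\<integral>\<^sup>+h. indicator {0<..<a} h * ennreal (c * h ^ m) \<partial>lborel) = ennreal (c * a ^ (m + 1) / (real m + 1))"
proof -
  have "(\<integral>\<^sup>+h. indicator {0<..<a} h * ennreal (c * h ^ m) \<partial>lborel)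
      = (\<integral>\<^sup>+h. ennreal (c * h ^ m) * indicator {0..a} h \<partial>lborel)"
  proof (rule nn_integral_cong_AE)
    have "AE h in lborel. h \<noteq> 0" "AE h in lborel. h \<noteq> a" by (rule AE_lborel_singleton)+
    then show "AE h in lborel. indicator {0<..<a} h * ennreal (c * h ^ m) = ennreal (c * h ^ m) * indicator {0..a} h"
      by eventually_elim (auto split: split_indicator)
  qed
  also have "\<dots> = ennreal (c * a ^ (m + 1) / (m + 1) - c * 0 ^ (m + 1) / (m + 1))"
  proof (rule nn_integral_FTC_Icc)
    fix h :: real
    have "((\<lambda>h. c * h ^ (m + 1) / (m + 1)) has_real_derivative c * (real (m + 1) * h ^ (m + 1 - 1)) / (m + 1)) (at h)"
      using DERIV_pow[of "m + 1" h] by (intro DERIV_cdivide DERIV_cmult) simp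
    then show "((\<lambda>h. c * h ^ (m + 1) / (m + 1)) has_real_derivative c * h ^ m) (at h)"
      by (simp del: power_Suc of_nat_Suc)
  qed (use assms in auto)
  finally show ?thesis by (simp add: add.commute)
qed

section \<open>Two-sided estimates of the cone measure near a point of the sphere\<close>

context
  fixes n t :: "'a::euclidean_space" and B :: "'a set"
  assumes B: "orthonormal (insert n (insert t B))" "finite B" "n \<notin> insert t B" "t \<notin> B"
    "card B + 2 = DIM('a)"
begin

lemma B_inner:
  "norm n = 1" "norm t = 1" "t \<bullet> n = 0" "lincomb B w \<bullet> n = 0" "lincomb B w \<bullet> t = 0" "orthonormal B"
proof -
  show nt: "norm n = 1" "norm t = 1" using B(1) by (auto simp: orthonormal_def)
  show "t \<bullet> n = 0" using orthonormal_inner[OF B(1), of t n] B(3) by auto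
  show "orthonormal B" using B(1) by (rule orthonormal_subset) auto
  have "b \<bullet> n = 0" "b \<bullet> t = 0" if "b \<in> B" for b
    using that B(3,4) orthonormal_inner[OF B(1), of b n] orthonormal_inner[OF B(1), of b t] by auto
  then show "lincomb B w \<bullet> n = 0" "lincomb B w \<bullet> t = 0"
    by (simp_all add: lincomb_def inner_sum_left)
qed

lemma perp_coords: "perp n (lincomb B w + h *\<^sub>R t + s *\<^sub>R n) = lincomb B w + h *\<^sub>R t"
    "(lincomb B w + h *\<^sub>R t + s *\<^sub>R n) \<bullet> n = s" "(lincomb B w + h *\<^sub>R t) \<bullet> t = h"
  using B_inner by (simp_all add: perp_def inner_add_left norm_eq_1)

lemma emeasure_cone_measure_coords:
  assumes [measurable]: "E \<in> sets borel"
  shows "emeasure (cone_measure n) E = ennreal (real (card B) + 1) *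
    (\<integral>\<^sup>+s. \<integral>\<^sup>+h. \<integral>\<^sup>+w. indicator (slab n \<inter> perp_dir n -` E) (lincomb B w + h *\<^sub>R t + s *\<^sub>R n)
      \<partial>lborel_PiM B \<partial>lborel \<partial>lborel)"
proof -
  have [measurable]: "perp_dir n -` E \<in> sets borel"
    using measurable_sets[OF perp_dir_measurable assms, of n] by simp
  have "real (DIM('a) - 1) = real (card B) + 1" using B(5) by linarith
  then show ?thesis
    using emeasure_cone_measure[OF assms, of n]
      nn_integral_lborel_two_directions[OF B, of "indicator (slab n \<inter> perp_dir n -` E)"]
    by (simp add: add.commute)
qed

text \<open>At height h along t the cone over E has a cross-section \<open>W h\<close> of diameter
  at most h d (1 + 4 d) by \<open>gnomonic_bound\<close>, so the isodiametric inequality bounds its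
  volume by a multiple of h^m with m = \<open>card B\<close>. Integrating h^m over (0, 1) produces 1
  / (m + 1), which the factor N - 1 of the cone measure cancels.\<close>

lemma cone_measure_upper:
  assumes E: "E \<in> sets borel" and d: "0 < d" "d \<le> 1/4"
    and near: "\<And>\<theta>. \<theta> \<in> E \<Longrightarrow> norm (\<theta> - t) \<le> d"
    and diam: "\<And>\<theta> \<phi>. \<theta> \<in> E \<Longrightarrow> \<phi> \<in> E \<Longrightarrow> norm (\<theta> - \<phi>) \<le> d"
  shows "emeasure (cone_measure n) E
    \<le> ennreal (unit_ball_vol (card B) * (d * (1 + 4 * d) / 2) ^ card B)"
proof -
  let ?M = "lborel_PiM B"
  let ?I = "\<lambda>s h w. indicator (slab n \<inter> perp_dir n -` E) (lincomb B w + h *\<^sub>R t + s *\<^sub>R n) :: ennreal"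
  define k where "k = d * (1 + 4 * d) / 2"
  have k: "k > 0" using d by (simp add: k_def)
  define W where "W h = {w \<in> space ?M. (lincomb B w + h *\<^sub>R t) /\<^sub>R norm (lincomb B w + h *\<^sub>R t) \<in> E}" for h
  have [measurable]: "E \<in> sets borel" by fact
  have W_sets: "W h \<in> sets ?M" for h
    unfolding W_def by measurable
  have W: "emeasure ?M (W h) \<le> ennreal (unit_ball_vol (card B) * (h * k) ^ card B)" if "h > 0" for h
  proof -
    have "emeasure ?M (W h) \<le> ennreal (unit_ball_vol (card B) * (h * (d * (1 + 4 * d)) / 2) ^ card B)"
    proof (rule isodiametric_PiM[OF W_sets B(2)])
      show "0 < h * (d * (1 + 4 * d))" using that d by simp
      fix v w assume vw: "v \<in> W h" "w \<in> W h"
      have "norm ((lincomb B v + h *\<^sub>R t) - (lincomb B w + h *\<^sub>R t)) \<le> h * (d * (1 + 4 * d))"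
        using vw that d near diam B_inner(2) perp_coords(3) unfolding W_def
        by (intro gnomonic_bound[where t = t]) auto
      then have "norm (lincomb B (\<lambda>b. v b - w b)) \<le> h * (d * (1 + 4 * d))"
        by (simp add: lincomb_diff[symmetric])
      then show "sqrt (\<Sum>j\<in>B. (v j - w j)\<^sup>2) \<le> h * (d * (1 + 4 * d))"
        by (simp add: lincomb_norm[OF B_inner(6) B(2)])
    qed
    then show ?thesis by (simp add: k_def)
  qed
  have "(\<integral>\<^sup>+s. \<integral>\<^sup>+h. \<integral>\<^sup>+w. ?I s h w \<partial>?M \<partial>lborel \<partial>lborel)
    \<le> (\<integral>\<^sup>+s. indicator {0<..<1::real} s * (\<integral>\<^sup>+h. indicator {0<..<1::real} h *
          ennreal ((unit_ball_vol (card B) * k ^ card B) * h ^ card B) \<partial>lborel) \<partial>lborel)"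
  proof (rule nn_integral_mono)
    fix s :: real
    have "(\<integral>\<^sup>+w. ?I s h w \<partial>?M)
        \<le> indicator {0<..<1} s * (indicator {0<..<1} h *
            ennreal ((unit_ball_vol (card B) * k ^ card B) * h ^ card B))" for h
    proof -
      have "?I s h w \<le>
          (indicator {0<..<1} s * (indicator {0<..<1} h * indicator (W h) w) :: ennreal)"
        if "w \<in> space ?M" for w
      proof (cases "lincomb B w + h *\<^sub>R t + s *\<^sub>R n \<in> slab n \<inter> perp_dir n -` E")
        case True
        define y where "y = lincomb B w + h *\<^sub>R t"
        have y: "0 < norm y" "norm y < 1" "0 < s" "s < 1" "y /\<^sub>R norm y \<in> E"
          using True by (auto simp: slab_def perp_dir_def perp_coords y_def)
        have "\<bar>h\<bar> \<le> norm y * norm t" using Cauchy_Schwarz_ineq2[of y t] by (simp add: y_def perp_coords)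
        then have h1: "h < 1" using y B_inner(2) by simp
        \<comment> \<open>A unit vector at distance less than 1 from t has positive inner product
          with t, which excludes the heights h below or equal to 0.\<close>
        have "norm (y /\<^sub>R norm y - t) < 1" using near[OF y(5)] d by linarith
        then have "(norm (y /\<^sub>R norm y - t))\<^sup>2 < 1" by (simp add: abs_square_less_1)
        moreover have "(norm (y /\<^sub>R norm y - t))\<^sup>2 = 2 - 2 * ((y /\<^sub>R norm y) \<bullet> t)"
          by (rule norm_diff_unit[OF _ B_inner(2)]) (use y in auto)
        ultimately have "0 < (y /\<^sub>R norm y) \<bullet> t" by linarith
        then have "0 < h" using y by (simp add: y_def perp_coords zero_less_mult_iff)
        then show ?thesis using h1 y that True by (simp add: W_def y_def indicator_def)
      qed simp
      then have "(\<integral>\<^sup>+w. ?I s h w \<partial>?M)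
          \<le> (\<integral>\<^sup>+w. indicator {0<..<1} s * (indicator {0<..<1} h * indicator (W h) w) \<partial>?M)"
        by (rule nn_integral_mono)
      also have "\<dots> = indicator {0<..<1} s * (indicator {0<..<1} h * emeasure ?M (W h))"
        using W_sets by (simp add: nn_integral_cmult)
      also have "\<dots> \<le> indicator {0<..<1} s * (indicator {0<..<1} h *
            ennreal ((unit_ball_vol (card B) * k ^ card B) * h ^ card B))"
        using W[of h] by (auto simp: power_mult_distrib mult_ac split: split_indicator)
      finally show ?thesis .
    qed
    then have "(\<integral>\<^sup>+h. \<integral>\<^sup>+w. ?I s h w \<partial>?M \<partial>lborel)
        \<le> (\<integral>\<^sup>+h. indicator {0<..<1} s * (indicator {0<..<1} h *
            ennreal ((unit_ball_vol (card B) * k ^ card B) * h ^ card B)) \<partial>lborel)"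
      by (intro nn_integral_mono)
    then show "(\<integral>\<^sup>+h. \<integral>\<^sup>+w. ?I s h w \<partial>?M \<partial>lborel)
        \<le> indicator {0<..<1} s * (\<integral>\<^sup>+h. indicator {0<..<1} h *
            ennreal ((unit_ball_vol (card B) * k ^ card B) * h ^ card B) \<partial>lborel)"
      by (simp add: nn_integral_cmult)
  qed
  also have "\<dots> = ennreal ((unit_ball_vol (card B) * k ^ card B) * 1 ^ (card B + 1) / (real (card B) + 1))"
    using k by (subst nn_integral_power_unit) (auto simp: nn_integral_multc)
  finally have "emeasure (cone_measure n) E \<le> ennreal (real (card B) + 1) *
      ennreal ((unit_ball_vol (card B) * k ^ card B) * 1 ^ (card B + 1) / (real (card B) + 1))"
    unfolding emeasure_cone_measure_coords[OF E] by (rule mult_left_mono) simp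
  also have "\<dots> = ennreal (unit_ball_vol (card B) * k ^ card B)"
    using k by (subst ennreal_mult'[symmetric]) (simp_all add: add_nonneg_eq_0_iff)
  finally show ?thesis by (simp add: k_def)
qed

text \<open>The cone over the tangent disk of radius r at t, cut off at height 1 / (1 + r), lies in
  the unit ball, and its directions stay within distance r of t. Its cross-sections are balls of
  radius h r, and integrating up to the cut-off gives the power m + 1 of 1 + r.\<close>

lemma cone_measure_cball_lower:
  assumes r: "0 < r"
  shows "ennreal (unit_ball_vol (card B) * r ^ card B / (1 + r) ^ (card B + 1))
    \<le> emeasure (cone_measure n) (cball t r)"
proof -
  let ?M = "lborel_PiM B"
  let ?I = "\<lambda>s h w. indicator (slab n \<inter> perp_dir n -` cball t r) (lincomb B w + h *\<^sub>R t + s *\<^sub>R n) :: ennreal"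
  define a where "a = 1 / (1 + r)"
  have a: "0 < a" using r by (simp add: a_def)
  define W where "W h = {f. sqrt (\<Sum>i\<in>B. (f i)\<^sup>2) \<le> h * r} \<inter> space ?M" for h :: real
  have W_sets: "W h \<in> sets ?M" for h unfolding W_def by measurable
  have "ennreal (unit_ball_vol (card B) * r ^ card B * a ^ (card B + 1) / (real (card B) + 1))
      = (\<integral>\<^sup>+s. indicator {0<..<1::real} s * (\<integral>\<^sup>+h. indicator {0<..<a} h *
          ennreal ((unit_ball_vol (card B) * r ^ card B) * h ^ card B) \<partial>lborel) \<partial>lborel)"
    using a r by (subst nn_integral_power_unit) (auto simp: nn_integral_multc)
  also have "\<dots> \<le> (\<integral>\<^sup>+s. \<integral>\<^sup>+h. \<integral>\<^sup>+w. ?I s h w \<partial>?M \<partial>lborel \<partial>lborel)"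
  proof (rule nn_integral_mono)
    fix s :: real
    have "indicator {0<..<1} s * (indicator {0<..<a} h *
            ennreal ((unit_ball_vol (card B) * r ^ card B) * h ^ card B))
        \<le> (\<integral>\<^sup>+w. ?I s h w \<partial>?M)" for h
    proof -
      have "(indicator {0<..<1} s * (indicator {0<..<a} h * indicator (W h) w) :: ennreal)
          \<le> ?I s h w" for w
      proof (cases "0 < s \<and> s < 1 \<and> 0 < h \<and> h < a \<and> w \<in> W h")
        case True
        define y where "y = lincomb B w + h *\<^sub>R t"
        have w: "norm (lincomb B w) \<le> h * r" using True by (simp add: W_def lincomb_norm[OF B_inner(6) B(2)])
        have ny: "(norm y)\<^sup>2 = (norm (lincomb B w))\<^sup>2 + h\<^sup>2"
          unfolding y_def using norm_add_Pythagorean[of "lincomb B w" "h *\<^sub>R t"] B_inner(2,5)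
          by (simp add: orthogonal_def power_mult_distrib)
        have hy: "h \<le> norm y" using True ny by (simp add: power2_le_imp_le)
        have y0: "0 < norm y" using hy True by linarith
        have "norm y \<le> norm (lincomb B w) + norm (h *\<^sub>R t)" unfolding y_def by (rule norm_triangle_ineq)
        also have "\<dots> \<le> h * (1 + r)" using w True B_inner(2) by (simp add: algebra_simps)
        also have "\<dots> < 1" using True r by (simp add: a_def field_simps)
        finally have y1: "norm y < 1" .
        have "norm (y /\<^sub>R norm y - t) \<le> r"
        proof (rule power2_le_imp_le)
          \<comment> \<open>k is the secant of the angle between y and t: the squared chord is 2 - 2
            / k, the squared tangent is k^2 - 1 and at most r^2, and the chord is at most the
            tangent.\<close>
          define k where "k = norm y / h"
          have k: "1 \<le> k" using hy True by (simp add: k_def)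
          have "(norm (y /\<^sub>R norm y - t))\<^sup>2 = 2 - 2 * ((y /\<^sub>R norm y) \<bullet> t)"
            by (rule norm_diff_unit[OF _ B_inner(2)]) (use y0 in simp)
          also have "(y /\<^sub>R norm y) \<bullet> t = 1 / k"
            by (simp add: k_def y_def perp_coords divide_inverse mult.commute)
          also have "2 - 2 * (1 / k) \<le> k\<^sup>2 - 1"
          proof -
            have "0 \<le> (k - 1)\<^sup>2 * (k + 2) / k" using k by simp
            also have "\<dots> = k\<^sup>2 - 1 - (2 - 2 * (1 / k))" using k by (simp add: field_simps power2_eq_square)
            finally show ?thesis by simp
          qed
          also have "\<dots> \<le> r\<^sup>2"
          proof -
            have "(norm (lincomb B w))\<^sup>2 \<le> (h * r)\<^sup>2" using w by (intro power_mono) auto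
            then have "(norm y)\<^sup>2 \<le> h\<^sup>2 * (1 + r\<^sup>2)" using ny by (simp add: algebra_simps power_mult_distrib)
            then show ?thesis using True by (simp add: k_def power_divide field_simps)
          qed
          finally show "(norm (y /\<^sub>R norm y - t))\<^sup>2 \<le> r\<^sup>2" .
        qed (use r in simp)
        moreover have pp: "perp n (y + s *\<^sub>R n) = y" "(y + s *\<^sub>R n) \<bullet> n = s"
          by (simp_all only: y_def perp_coords)
        ultimately have "lincomb B w + h *\<^sub>R t + s *\<^sub>R n \<in> slab n \<inter> perp_dir n -` cball t r"
          using True y1 y0 unfolding slab_def perp_dir_def vimage_def mem_cball dist_norm
            y_def[symmetric] norm_minus_commute[of t] by (auto simp: pp)
        then have "?I s h w = (1 :: ennreal)"
          by (rule indicator_simps)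
        then show ?thesis by (simp add: indicator_def)
      next
        case False
        then have "(indicator {0<..<1} s * (indicator {0<..<a} h * indicator (W h) w) :: ennreal) = 0"
          by (auto simp: indicator_def)
        then show ?thesis by (simp only: zero_le)
      qed
      then have "(\<integral>\<^sup>+w. indicator {0<..<1} s * (indicator {0<..<a} h * indicator (W h) w) \<partial>?M)
          \<le> (\<integral>\<^sup>+w. ?I s h w \<partial>?M)"
        by (intro nn_integral_mono)
      moreover have "(\<integral>\<^sup>+w. indicator {0<..<1} s * (indicator {0<..<a} h * indicator (W h) w) \<partial>?M)
          = indicator {0<..<1} s * (indicator {0<..<a} h * emeasure ?M (W h))"
        using W_sets by (simp add: nn_integral_cmult)
      moreover have "emeasure ?M (W h) = ennreal ((unit_ball_vol (card B) * r ^ card B) * h ^ card B)" if "h > 0"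
        unfolding W_def using emeasure_cball_aux[OF B(2), of "h * r"] that r
        by (simp add: power_mult_distrib mult_ac)
      then have "indicator {0<..<1} s * (indicator {0<..<a} h * emeasure ?M (W h)) = indicator {0<..<1} s *
          (indicator {0<..<a} h * ennreal ((unit_ball_vol (card B) * r ^ card B) * h ^ card B))"
        by (cases "h > 0") (simp_all add: indicator_def)
      ultimately show ?thesis by (simp only:)
    qed
    then have "(\<integral>\<^sup>+h. indicator {0<..<1} s * (indicator {0<..<a} h *
            ennreal ((unit_ball_vol (card B) * r ^ card B) * h ^ card B)) \<partial>lborel)
        \<le> (\<integral>\<^sup>+h. \<integral>\<^sup>+w. ?I s h w \<partial>?M \<partial>lborel)"
      by (intro nn_integral_mono)
    then show "indicator {0<..<1} s * (\<integral>\<^sup>+h. indicator {0<..<a} h *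
            ennreal ((unit_ball_vol (card B) * r ^ card B) * h ^ card B) \<partial>lborel)
        \<le> (\<integral>\<^sup>+h. \<integral>\<^sup>+w. ?I s h w \<partial>?M \<partial>lborel)"
      by (simp add: nn_integral_cmult)
  qed
  finally have "ennreal (real (card B) + 1) * ennreal (unit_ball_vol (card B) * r ^ card B * a ^ (card B + 1) / (real (card B) + 1))
      \<le> emeasure (cone_measure n) (cball t r)"
    by (subst emeasure_cone_measure_coords) (auto intro: mult_left_mono)
  moreover have "ennreal (real (card B) + 1) *
      ennreal (unit_ball_vol (card B) * r ^ card B * a ^ (card B + 1) / (real (card B) + 1))
      = ennreal (unit_ball_vol (card B) * r ^ card B * a ^ (card B + 1))"
    using r a by (subst ennreal_mult'[symmetric]) (simp_all add: add_nonneg_eq_0_iff)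
  moreover have "unit_ball_vol (card B) * r ^ card B * a ^ (card B + 1) =
      unit_ball_vol (card B) * r ^ card B / (1 + r) ^ (card B + 1)"
    unfolding a_def power_one_over by simp
  ultimately show ?thesis by simp
qed

end

subsection \<open>Hausdorff measure on the sphere\<close>

lemma hsphere_subset_sphere: "hsphere n \<subseteq> sphere 0 1"
  by (auto simp: hsphere_def)

lemma sets_hsphere [measurable]: "hsphere n \<in> sets borel"
  unfolding hsphere_def by measurable

lemma cone_measure_Int_hsphere:
  fixes n :: "'a::euclidean_space"
  assumes "norm n = 1" and [measurable]: "E \<in> sets borel"
  shows "emeasure (cone_measure n) (E \<inter> hsphere n) = emeasure (cone_measure n) E"
proof -
  have "slab n \<inter> perp_dir n -` (E \<inter> hsphere n) = slab n \<inter> perp_dir n -` E"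
    using perp_dir_in_hsphere[OF assms(1)] by auto
  then show ?thesis by (simp add: emeasure_cone_measure)
qed

lemma hausdorff_pre_subadditive:
  "hausdorff_pre m \<delta> (A \<union> B) \<le> hausdorff_pre m \<delta> A + hausdorff_pre m \<delta> B" if "0 \<le> \<delta>"
proof -
  define C where "C = (\<lambda>n::nat. if n = 0 then A else if n = 1 then B else {})"
  have "hausdorff_pre m \<delta> ({} :: 'a set) \<le> 0"
    unfolding hausdorff_pre_def
    by (rule INF_lower2[where i = "\<lambda>_. {}"]) (use that in \<open>auto simp: hausdorff_gauge_def diameter_def\<close>)
  then have "(\<Sum>n. hausdorff_pre m \<delta> (C n)) = (\<Sum>n\<in>{0, 1}. hausdorff_pre m \<delta> (C n))"
    by (intro suminf_finite) (auto simp: C_def)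
  moreover have "A \<union> B = (\<Union>n. C n)" by (auto simp: C_def split: if_splits)
  ultimately show ?thesis
    using hausdorff_pre_countably_subadditive[of m \<delta> C] by (simp add: C_def)
qed

lemma hausdorff_gauge_cball:
  fixes t :: "'a::euclidean_space"
  assumes "0 \<le> r"
  shows "hausdorff_gauge m (cball t r) = ennreal (unit_ball_vol m * r ^ m)"
  using assms by (simp add: hausdorff_gauge_def diameter_cball)

lemma ennreal_mult_divide_cancel:
  fixes x :: ennreal
  assumes "0 < c"
  shows "ennreal c * (x / ennreal c) = x"
  using assms by (simp add: ennreal_times_divide mult.commute[of "ennreal c"] ennreal_mult_divide_eq)

text \<open>Used to let constants tend to their limit within a product of extended reals; finiteness
  of y keeps the product continuous in the constant.\<close>

lemma ennreal_le_mult_limit: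
  fixes x y :: ennreal and f :: "real \<Rightarrow> real"
  assumes f: "(f \<longlongrightarrow> c) (at_right a)" and le: "\<And>d. a < d \<Longrightarrow> d < b \<Longrightarrow> x \<le> ennreal (f d) * y"
    and "a < b" "y \<noteq> top"
  shows "x \<le> ennreal c * y"
proof (rule tendsto_lowerbound)
  have "((\<lambda>d. y * ennreal (f d)) \<longlongrightarrow> y * ennreal c) (at_right a)"
    using assms by (intro ennreal_tendsto_cmult tendsto_ennrealI) (auto simp: less_top)
  then show "((\<lambda>d. ennreal (f d) * y) \<longlongrightarrow> ennreal c * y) (at_right a)"
    by (simp add: mult.commute)
  show "\<forall>\<^sub>F d in at_right a. x \<le> ennreal (f d) * y"
    using eventually_at_right_real[OF \<open>a < b\<close>] by eventually_elim (use le in auto)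
qed simp

context
  fixes n :: "'a::euclidean_space" and m :: nat
  assumes n: "norm n = 1" and m: "m + 2 = DIM('a)"
begin

abbreviation (input) \<mu> :: "'a set \<Rightarrow> ennreal" where "\<mu> \<equiv> emeasure (cone_measure n)"

lemma cone_measure_le_of_diameter:
  assumes E: "E \<in> sets borel" and t: "t \<in> hsphere n" "t \<in> E" and d: "0 \<le> d" "d < 1/4"
    and diam: "\<And>\<theta> \<phi>. \<theta> \<in> E \<Longrightarrow> \<phi> \<in> E \<Longrightarrow> norm (\<theta> - \<phi>) \<le> d"
  shows "\<mu> E \<le> ennreal (unit_ball_vol m * (d * (1 + 4 * d) / 2) ^ m)"
proof -
  have t': "norm t = 1" "t \<bullet> n = 0" using t by (auto simp: hsphere_def)
  obtain B where B: "orthonormal (insert n (insert t B))" "finite B" "n \<notin> insert t B" "t \<notin> B"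
    "card B + 2 = DIM('a)"
    by (rule orthonormal_completion[OF n t'])
  have cB: "card B = m" using B(5) m by simp
  \<comment> \<open>\<open>cone_measure_upper\<close> asks for a positive diameter bound; applying
    it to all e slightly above d also covers sets of diameter 0.\<close>
  have "\<mu> E \<le> ennreal (unit_ball_vol m * (d * (1 + 4 * d) / 2) ^ m) * 1"
  proof (rule ennreal_le_mult_limit)
    show "((\<lambda>d. unit_ball_vol m * (d * (1 + 4 * d) / 2) ^ m) \<longlongrightarrow>
        unit_ball_vol m * (d * (1 + 4 * d) / 2) ^ m) (at_right d)"
      by (intro tendsto_intros) auto
    fix e assume e: "d < e" "e < 1/4"
    have le: "norm (\<theta> - \<phi>) \<le> e" if "\<theta> \<in> E" "\<phi> \<in> E" for \<theta> \<phi>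
      using diam[OF that] e by linarith
    show "\<mu> E \<le> ennreal (unit_ball_vol m * (e * (1 + 4 * e) / 2) ^ m) * 1"
      using cone_measure_upper[OF B E _ _ le[OF _ t(2)] le] e d by (simp add: cB)
  qed (use d in auto)
  then show ?thesis by simp
qed

lemma gauge_le_cone_measure_cball:
  assumes t: "t \<in> hsphere n" and r: "0 < r"
  shows "ennreal (unit_ball_vol m * r ^ m) \<le> ennreal ((1 + r) ^ (m + 1)) * \<mu> (cball t r)"
proof -
  have t': "norm t = 1" "t \<bullet> n = 0" using t by (auto simp: hsphere_def)
  obtain B where B: "orthonormal (insert n (insert t B))" "finite B" "n \<notin> insert t B" "t \<notin> B"
    "card B + 2 = DIM('a)"
    by (rule orthonormal_completion[OF n t'])
  have cB: "card B = m" using B(5) m by simp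
  have "ennreal (unit_ball_vol m * r ^ m) =
      ennreal ((1 + r) ^ (m + 1)) * ennreal (unit_ball_vol m * r ^ m / (1 + r) ^ (m + 1))"
    using r by (subst ennreal_mult'[symmetric]) auto
  also have "\<dots> \<le> ennreal ((1 + r) ^ (m + 1)) * \<mu> (cball t r)"
    using cone_measure_cball_lower[OF B r] by (intro mult_left_mono) (auto simp: cB)
  finally show ?thesis .
qed

text \<open>Each piece of a fine cover has cone measure at most its gauge times (1 + 4 \<delta>)^m.
  Summing over the pieces and letting \<delta> tend to 0 removes the distortion factor.\<close>

lemma cone_measure_le_hausdorff:
  assumes E: "E \<in> sets borel" "E \<subseteq> hsphere n"
  shows "\<mu> E \<le> hausdorff_outer m E"
proof (cases "hausdorff_outer m E = top")
  case False
  have "\<mu> E \<le> ennreal ((1 + 4 * 0) ^ m) * hausdorff_outer m E"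
  proof (rule ennreal_le_mult_limit[where f = "\<lambda>\<delta>. (1 + 4 * \<delta>) ^ m" and a = 0 and b = "1/4"])
    fix \<delta> :: real assume \<delta>: "0 < \<delta>" "\<delta> < 1/4"
    have "\<mu> E \<le> ennreal ((1 + 4 * \<delta>) ^ m) * (\<Sum>i. hausdorff_gauge m (F i))"
      if F: "E \<subseteq> (\<Union>i. F i)" "\<forall>i. bounded (F i) \<and> diameter (F i) \<le> \<delta>" for F :: "nat \<Rightarrow> 'a set"
    proof -
      \<comment> \<open>Closures are Borel and have the same diameter. Pieces that miss E are
        dropped, so that each remaining one contains a point of the sphere from which to
        project.\<close>
      define A where "A i = (if F i \<inter> E = {} then {} else closure (F i))" for i
      have A: "A i \<in> sets borel" for i by (simp add: A_def)
      have piece: "\<mu> (A i) \<le> ennreal ((1 + 4 * \<delta>) ^ m) * hausdorff_gauge m (F i)" for i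
      proof (cases "F i \<inter> E = {}")
        case False
        then obtain t where t: "t \<in> F i" "t \<in> hsphere n" using E by blast
        define d where "d = diameter (F i)"
        have bF: "bounded (F i)" using F by blast
        have d: "0 \<le> d" "d \<le> \<delta>" using F by (auto simp: d_def diameter_ge_0)
        have "\<mu> (closure (F i)) \<le> ennreal (unit_ball_vol m * (d * (1 + 4 * d) / 2) ^ m)"
        proof (rule cone_measure_le_of_diameter)
          show "t \<in> hsphere n" "t \<in> closure (F i)" using t closure_subset by auto
          fix \<theta> \<phi> assume "\<theta> \<in> closure (F i)" "\<phi> \<in> closure (F i)"
          then have "dist \<theta> \<phi> \<le> diameter (closure (F i))"
            using bF by (intro diameter_bounded_bound) auto
          then show "norm (\<theta> - \<phi>) \<le> d" using bF by (simp add: d_def diameter_closure dist_norm)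
        qed (use d \<delta> in auto)
        also have "\<dots> \<le> ennreal ((1 + 4 * \<delta>) ^ m * (unit_ball_vol m * (d / 2) ^ m))"
        proof (rule ennreal_leI)
          have "(d * (1 + 4 * d) / 2) ^ m \<le> ((1 + 4 * \<delta>) * (d / 2)) ^ m"
          proof (rule power_mono)
            have "d * (1 + 4 * d) \<le> d * (1 + 4 * \<delta>)" using d by (intro mult_left_mono) auto
            then show "d * (1 + 4 * d) / 2 \<le> (1 + 4 * \<delta>) * (d / 2)" by (simp add: mult.commute)
          qed (use d in auto)
          then have "unit_ball_vol m * (d * (1 + 4 * d) / 2) ^ m \<le> unit_ball_vol m * ((1 + 4 * \<delta>) * (d / 2)) ^ m"
            by (intro mult_left_mono) auto
          then show "unit_ball_vol m * (d * (1 + 4 * d) / 2) ^ m \<le> (1 + 4 * \<delta>) ^ m * (unit_ball_vol m * (d / 2) ^ m)"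
            by (simp only: power_mult_distrib mult_ac)
        qed
        also have "\<dots> = ennreal ((1 + 4 * \<delta>) ^ m) * hausdorff_gauge m (F i)"
          using t \<delta> by (subst ennreal_mult') (auto simp: hausdorff_gauge_def d_def)
        finally show ?thesis using False by (simp add: A_def)
      qed (simp add: A_def)
      have "E \<subseteq> (\<Union>i. A i)"
      proof
        fix x assume "x \<in> E"
        then obtain i where "x \<in> F i" using F by blast
        then have "x \<in> A i" using \<open>x \<in> E\<close> closure_subset[of "F i"] by (auto simp: A_def)
        then show "x \<in> (\<Union>i. A i)" by blast
      qed
      then have "\<mu> E \<le> \<mu> (\<Union>i. A i)" using A by (intro emeasure_mono) auto
      also have "\<dots> \<le> (\<Sum>i. \<mu> (A i))" using A by (intro emeasure_subadditive_countably) auto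
      also have "\<dots> \<le> (\<Sum>i. ennreal ((1 + 4 * \<delta>) ^ m) * hausdorff_gauge m (F i))"
        by (intro suminf_le piece) auto
      finally show ?thesis by simp
    qed
    \<comment> \<open>Dividing by the constant allows the comparison with the infimum over all
      covers.\<close>
    then have "\<mu> E / ennreal ((1 + 4 * \<delta>) ^ m) \<le> hausdorff_pre m \<delta> E"
      unfolding hausdorff_pre_def using \<delta>
      by (intro INF_greatest) (auto intro!: divide_le_posI_ennreal simp: ennreal_zero_less_divide)
    also have "\<dots> \<le> hausdorff_outer m E" using \<delta> by (intro hausdorff_pre_le_outer)
    finally have "ennreal ((1 + 4 * \<delta>) ^ m) * (\<mu> E / ennreal ((1 + 4 * \<delta>) ^ m))
        \<le> ennreal ((1 + 4 * \<delta>) ^ m) * hausdorff_outer m E" by (rule mult_left_mono) simp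
    moreover have "ennreal ((1 + 4 * \<delta>) ^ m) * (\<mu> E / ennreal ((1 + 4 * \<delta>) ^ m)) = \<mu> E"
      using \<delta> by (intro ennreal_mult_divide_cancel) simp
    ultimately show "\<mu> E \<le> ennreal ((1 + 4 * \<delta>) ^ m) * hausdorff_outer m E" by simp
  qed (use False in \<open>auto intro!: tendsto_eq_intros\<close>)
  then show ?thesis by simp
qed simp

text \<open>The covering lemma applied to all small closed balls inside U that are centred on the
  sphere; only such centres admit the estimates of the cone measure.\<close>

lemma Vitali_hsphere:
  assumes U: "open U" and \<rho>: "0 < \<rho>"
  obtains J :: "nat set" and a :: "nat \<Rightarrow> 'a" and r where
    "\<forall>k\<in>J. a k \<in> hsphere n \<and> 0 < r k \<and> r k \<le> \<rho> \<and> cball (a k) (r k) \<subseteq> U"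
    "disjoint_family (\<lambda>k. if k \<in> J then cball (a k) (r k) else {})"
    "U \<inter> hsphere n \<subseteq> (\<Union>k. if k \<in> J then cball (a k) (5 * r k) else {})"
proof -
  define K where "K = {(\<theta>, s). \<theta> \<in> U \<inter> hsphere n \<and> 0 < s \<and> s \<le> \<rho> \<and> cball \<theta> s \<subseteq> U}"
  have "U \<inter> hsphere n \<subseteq> (\<Union>p\<in>K. cball (fst p) (snd p))"
  proof
    fix \<theta> assume \<theta>: "\<theta> \<in> U \<inter> hsphere n"
    then obtain e where e: "e > 0" "cball \<theta> e \<subseteq> U" using U open_contains_cball by blast
    then have "(\<theta>, min e \<rho>) \<in> K" using \<theta> \<rho> by (auto simp: K_def)
    moreover have "\<theta> \<in> cball \<theta> (min e \<rho>)" using e \<rho> by simp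
    ultimately show "\<theta> \<in> (\<Union>p\<in>K. cball (fst p) (snd p))" by force
  qed
  moreover have "0 < snd p \<and> snd p \<le> \<rho>" if "p \<in> K" for p using that by (auto simp: K_def)
  ultimately obtain C where C: "countable C" "C \<subseteq> K"
    "pairwise (\<lambda>i j. disjnt (cball (fst i) (snd i)) (cball (fst j) (snd j))) C"
    "U \<inter> hsphere n \<subseteq> (\<Union>i\<in>C. cball (fst i) (5 * snd i))"
    by (rule Vitali_covering_lemma_cballs)
  \<comment> \<open>The countable family is indexed by natural numbers; indices outside J stand for
    the empty set, whose gauge and measure are 0.\<close>
  define J where "J = to_nat_on C ` C"
  define g where "g = from_nat_into C"
  have gC: "g k \<in> C" if "k \<in> J" for k using that C(1) by (auto simp: J_def g_def)
  have ginj: "k = l" if "k \<in> J" "l \<in> J" "g k = g l" for k l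
    using that C(1) by (auto simp: J_def g_def)
  show ?thesis
  proof (rule that[of J "\<lambda>k. fst (g k)" "\<lambda>k. snd (g k)"])
    have "g k \<in> K" if "k \<in> J" for k using gC[OF that] C(2) by blast
    then show "\<forall>k\<in>J. fst (g k) \<in> hsphere n \<and> 0 < snd (g k) \<and> snd (g k) \<le> \<rho> \<and>
        cball (fst (g k)) (snd (g k)) \<subseteq> U"
      by (auto simp: K_def case_prod_beta)
  next
    show "disjoint_family (\<lambda>k. if k \<in> J then cball (fst (g k)) (snd (g k)) else {})"
      unfolding disjoint_family_on_def
    proof (intro ballI impI)
      fix k l :: nat assume "k \<noteq> l"
      then show "(if k \<in> J then cball (fst (g k)) (snd (g k)) else {}) \<inter>
          (if l \<in> J then cball (fst (g l)) (snd (g l)) else {}) = {}"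
        using C(3) gC[of k] gC[of l] ginj[of k l] by (auto simp: pairwise_def disjnt_def)
    qed
  next
    have "\<exists>k\<in>J. p = g k" if "p \<in> C" for p
      using that C(1) by (auto simp: J_def g_def intro!: bexI[of _ p])
    then show "U \<inter> hsphere n \<subseteq> (\<Union>k. if k \<in> J then cball (fst (g k)) (5 * snd (g k)) else {})"
      using C(4) by fastforce
  qed
qed

text \<open>In the base 10, a factor 5 is the Vitali enlargement and a factor 2 absorbs the gnomonic
  distortion 1 + 40 r. The other power bounds the factor (1 + r)^(m+1) of
  \<open>gauge_le_cone_measure_cball\<close>. In \<open>cball_5_bounds\<close> the restriction r <=
  1/80 ensures that 40 r is at most 1 and that the diameter 10 r is below 1/4.\<close>

definition doubling :: real where "doubling = 10 ^ m * 2 ^ (m + 1)"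

lemma doubling_ge_1: "1 \<le> doubling"
proof -
  have "(1::real) * 1 \<le> 10 ^ m * 2 ^ (m + 1)" by (intro mult_mono one_le_power) auto
  then show ?thesis by (simp add: doubling_def)
qed

lemma cball_5_bounds:
  assumes t: "t \<in> hsphere n" and r: "0 < r" "r \<le> 1 / 80"
  shows "\<mu> (cball t (5 * r)) \<le> ennreal doubling * \<mu> (cball t r)"
    and "hausdorff_gauge m (cball t (5 * r)) \<le> ennreal doubling * \<mu> (cball t r)"
proof -
  have "ennreal (unit_ball_vol m * (10 * r) ^ m) = ennreal (10 ^ m) * ennreal (unit_ball_vol m * r ^ m)"
    using r by (subst ennreal_mult'[symmetric]) (auto simp: power_mult_distrib mult_ac)
  also have "\<dots> \<le> ennreal (10 ^ m) * (ennreal ((1 + r) ^ (m + 1)) * \<mu> (cball t r))"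
    by (intro mult_left_mono gauge_le_cone_measure_cball t r) simp
  also have "\<dots> \<le> ennreal (10 ^ m) * (ennreal (2 ^ (m + 1)) * \<mu> (cball t r))"
    using r by (intro mult_left_mono mult_right_mono ennreal_leI power_mono) auto
  also have "\<dots> = ennreal doubling * \<mu> (cball t r)"
    by (simp add: doubling_def ennreal_mult' mult.assoc)
  finally have key: "ennreal (unit_ball_vol m * (10 * r) ^ m) \<le> \<dots>" .
  have "\<mu> (cball t (5 * r))
      \<le> ennreal (unit_ball_vol m * (10 * r * (1 + 4 * (10 * r)) / 2) ^ m)"
  proof (rule cone_measure_le_of_diameter[OF _ t])
    fix \<theta> \<phi> assume "\<theta> \<in> cball t (5 * r)" "\<phi> \<in> cball t (5 * r)"
    then show "norm (\<theta> - \<phi>) \<le> 10 * r"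
      using dist_triangle[of \<theta> \<phi> t] by (simp add: dist_norm[symmetric] dist_commute)
  qed (use r in auto)
  also have "\<dots> \<le> ennreal (unit_ball_vol m * (10 * r) ^ m)"
  proof (intro ennreal_leI mult_left_mono power_mono)
    have "10 * r * (1 + 4 * (10 * r)) \<le> 10 * r * 2" using r by (intro mult_left_mono) auto
    then show "10 * r * (1 + 4 * (10 * r)) / 2 \<le> 10 * r" by simp
  qed (use r in auto)
  finally show "\<mu> (cball t (5 * r)) \<le> ennreal doubling * \<mu> (cball t r)"
    using key by (rule order_trans)
  have "hausdorff_gauge m (cball t (5 * r)) \<le> ennreal (unit_ball_vol m * (10 * r) ^ m)"
    using r by (subst hausdorff_gauge_cball) (auto intro!: ennreal_leI mult_left_mono power_mono)
  then show "hausdorff_gauge m (cball t (5 * r)) \<le> ennreal doubling * \<mu> (cball t r)"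
    using key by (rule order_trans)
qed

text \<open>The clause \<open>1 \<le> C\<close> makes the admissible constants bounded below, so
  that \<open>hausdorff_bound_1\<close> can take their infimum.\<close>

definition hausdorff_bound :: "real \<Rightarrow> bool" where
  "hausdorff_bound C \<longleftrightarrow> 1 \<le> C \<and> (\<forall>E\<in>sets borel. E \<subseteq> hsphere n \<longrightarrow>
     hausdorff_outer m E \<le> ennreal C * \<mu> E)"

text \<open>Outer regularity of the finite Borel measure \<open>cone_measure n\<close> replaces a
  Borel set by open neighbourhoods, for which Vitali coverings are available.\<close>

lemma hausdorff_boundI:
  assumes C: "1 \<le> C" and op: "\<And>U. open U \<Longrightarrow> hausdorff_outer m (U \<inter> hsphere n) \<le> ennreal C * \<mu> U"
  shows "hausdorff_bound C"
  unfolding hausdorff_bound_def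
proof (intro conjI C ballI impI)
  fix E assume E: "E \<in> sets borel" "E \<subseteq> hsphere n"
  interpret finite_measure "cone_measure n" by (rule finite_measure_cone_measure[OF n])
  have reg: "\<mu> E = (INF U\<in>{U. E \<subseteq> U \<and> open U}. \<mu> U)"
    using E by (intro outer_regular) auto
  have "hausdorff_outer m E / ennreal C \<le> \<mu> E"
    unfolding reg
  proof (rule INF_greatest)
    fix U assume "U \<in> {U. E \<subseteq> U \<and> open U}"
    then have U: "E \<subseteq> U" "open U" by auto
    have "hausdorff_outer m E \<le> hausdorff_outer m (U \<inter> hsphere n)"
      using U E by (intro hausdorff_outer_mono) auto
    also have "\<dots> \<le> ennreal C * \<mu> U" by (rule op) fact
    finally show "hausdorff_outer m E / ennreal C \<le> \<mu> U"
      using C by (intro divide_le_posI_ennreal) auto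
  qed
  then have "ennreal C * (hausdorff_outer m E / ennreal C) \<le> ennreal C * \<mu> E"
    by (rule mult_left_mono) simp
  moreover have "ennreal C * (hausdorff_outer m E / ennreal C) = hausdorff_outer m E"
    using C by (intro ennreal_mult_divide_cancel) simp
  ultimately show "hausdorff_outer m E \<le> ennreal C * \<mu> E" by simp
qed

text \<open>Provides some finite constant from which improvement can start: the enlarged Vitali
  balls cover, and their gauges are controlled by the cone measures of the original balls, which are
  disjoint and contained in U.\<close>

lemma hausdorff_bound_doubling: "hausdorff_bound doubling"
proof (rule hausdorff_boundI[OF doubling_ge_1])
  fix U :: "'a set" assume U: "open U"
  show "hausdorff_outer m (U \<inter> hsphere n) \<le> ennreal doubling * \<mu> U"
    unfolding hausdorff_outer_def
  proof (rule SUP_least)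
    fix \<delta> :: real assume "\<delta> \<in> {0<..}"
    then have \<delta>: "\<delta> > 0" by simp
    \<comment> \<open>The enlarged balls have diameter 10 r, which must not exceed \<delta>; the
      bound 1/80 is that of \<open>cball_5_bounds\<close>.\<close>
    define \<rho> where "\<rho> = min (\<delta> / 10) (1 / 80)"
    have \<rho>0: "\<rho> > 0" using \<delta> by (simp add: \<rho>_def)
    obtain J :: "nat set" and a r where J:
      "\<forall>k\<in>J. a k \<in> hsphere n \<and> 0 < r k \<and> r k \<le> \<rho> \<and> cball (a k) (r k) \<subseteq> U"
      and disj: "disjoint_family (\<lambda>k. if k \<in> J then cball (a k) (r k) else {})"
      and cover: "U \<inter> hsphere n \<subseteq> (\<Union>k. if k \<in> J then cball (a k) (5 * r k) else {})"
      by (rule Vitali_hsphere[OF U \<rho>0])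
    have V: "a k \<in> hsphere n" "0 < r k" "r k \<le> \<rho>" "cball (a k) (r k) \<subseteq> U" if "k \<in> J" for k
      using J that by auto
    define A where "A k = (if k \<in> J then cball (a k) (r k) else {})" for k
    define A5 where "A5 k = (if k \<in> J then cball (a k) (5 * r k) else {})" for k
    have A5: "bounded (A5 k) \<and> diameter (A5 k) \<le> \<delta>" for k
      using V(2,3)[of k] \<delta> by (auto simp: A5_def \<rho>_def diameter_cball)
    have "hausdorff_pre m \<delta> (U \<inter> hsphere n) \<le> (\<Sum>k. hausdorff_gauge m (A5 k))"
      unfolding hausdorff_pre_def using cover A5 by (intro INF_lower) (auto simp: A5_def)
    also have "\<dots> \<le> (\<Sum>k. ennreal doubling * \<mu> (A k))"
    proof (intro suminf_le)
      show "hausdorff_gauge m (A5 k) \<le> ennreal doubling * \<mu> (A k)" for k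
        using V(1-3)[of k] cball_5_bounds(2)[of "a k" "r k"]
        by (cases "k \<in> J") (auto simp: A5_def A_def \<rho>_def hausdorff_gauge_def)
    qed auto
    also have "\<dots> = ennreal doubling * (\<Sum>k. \<mu> (A k))" by simp
    also have "(\<Sum>k. \<mu> (A k)) = \<mu> (\<Union>k. A k)"
      using disj by (intro suminf_emeasure) (auto simp: A_def)
    also have "\<dots> \<le> \<mu> U" using V(4) U by (intro emeasure_mono) (auto simp: A_def split: if_splits)
    finally show "hausdorff_pre m \<delta> (U \<inter> hsphere n) \<le> ennreal doubling * \<mu> U"
      by (simp add: mult_left_mono)
  qed
qed

text \<open>Covering a fixed fraction of \<open>U\<close> by disjoint balls, whose cost is almost exactly their
  measure, strictly improves any constant larger than 1.\<close>

lemma hausdorff_bound_improve: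
  assumes C: "hausdorff_bound C" and \<epsilon>: "0 < \<epsilon>" "1 + \<epsilon> \<le> C"
  shows "hausdorff_bound (C - (C - 1 - \<epsilon>) / doubling)"
proof (rule hausdorff_boundI)
  interpret finite_measure "cone_measure n" by (rule finite_measure_cone_measure[OF n])
  let ?D = doubling
  let ?me = "measure (cone_measure n)"
  define C' where "C' = C - (C - 1 - \<epsilon>) / ?D"
  have "(C - 1 - \<epsilon>) / ?D \<le> (C - 1 - \<epsilon>) / 1"
    using \<epsilon> doubling_ge_1 by (intro divide_left_mono) auto
  then have "(C - 1 - \<epsilon>) / ?D \<le> C - 1 - \<epsilon>" by (simp only: div_by_1)
  then show C'1: "1 \<le> C - (C - 1 - \<epsilon>) / ?D" using \<epsilon> by linarith
  have CE: "hausdorff_outer m E \<le> ennreal C * \<mu> E" if "E \<in> sets borel" "E \<subseteq> hsphere n" for E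
    using C that by (simp add: hausdorff_bound_def)
  have D0: "0 < ?D" using doubling_ge_1 by linarith
  have "((\<lambda>\<rho>. (1 + \<rho>) ^ (m + 1)) \<longlongrightarrow> (1 + 0) ^ (m + 1)) (at_right (0::real))"
    by (intro tendsto_intros)
  then have "\<forall>\<^sub>F \<rho> in at_right (0::real). (1 + \<rho>) ^ (m + 1) < 1 + \<epsilon>"
    using \<epsilon> by (intro order_tendstoD(2)) auto
  then obtain b where b: "b > 0" "\<And>\<rho>. 0 < \<rho> \<Longrightarrow> \<rho> < b \<Longrightarrow> (1 + \<rho>) ^ (m + 1) < 1 + \<epsilon>"
    unfolding eventually_at_right_field by auto
  fix U :: "'a set" assume U: "open U"
  show "hausdorff_outer m (U \<inter> hsphere n) \<le> ennreal (C - (C - 1 - \<epsilon>) / ?D) * \<mu> U"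
    unfolding hausdorff_outer_def
  proof (rule SUP_least)
    fix \<delta> :: real assume "\<delta> \<in> {0<..}"
    then have \<delta>: "\<delta> > 0" by simp
    \<comment> \<open>Here the balls themselves serve as covering sets, with diameter 2 r at most
      \<delta>; the bound b / 2 keeps (1 + r)^(m+1) below 1 + \<epsilon>.\<close>
    define \<rho> where "\<rho> = min (min (\<delta> / 2) (1 / 80)) (b / 2)"
    have \<rho>0: "\<rho> > 0" using \<delta> b by (simp add: \<rho>_def)
    obtain J :: "nat set" and a r where J:
      "\<forall>k\<in>J. a k \<in> hsphere n \<and> 0 < r k \<and> r k \<le> \<rho> \<and> cball (a k) (r k) \<subseteq> U"
      and disj: "disjoint_family (\<lambda>k. if k \<in> J then cball (a k) (r k) else {})"
      and cover: "U \<inter> hsphere n \<subseteq> (\<Union>k. if k \<in> J then cball (a k) (5 * r k) else {})"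
      by (rule Vitali_hsphere[OF U \<rho>0])
    have V: "a k \<in> hsphere n" "0 < r k" "r k \<le> \<rho>" "cball (a k) (r k) \<subseteq> U" if "k \<in> J" for k
      using J that by auto
    define A where "A k = (if k \<in> J then cball (a k) (r k) else {})" for k
    define A5 where "A5 k = (if k \<in> J then cball (a k) (5 * r k) else {})" for k
    define W where "W = (\<Union>k. A k)"
    have A_sets: "A k \<in> sets borel" "A5 k \<in> sets borel" for k by (auto simp: A_def A5_def)
    then have W_sets: "W \<in> sets borel" by (auto simp: W_def)
    have WU: "W \<subseteq> U" using V(4) by (auto simp: W_def A_def split: if_splits)
    have sumW: "(\<Sum>k. \<mu> (A k)) = \<mu> W"
      unfolding W_def using disj A_sets by (intro suminf_emeasure) (auto simp: A_def)
    \<comment> \<open>By the doubling estimate the disjoint balls carry at least the fraction 1 /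
      \<open>doubling\<close> of the measure of U.\<close>
    have "\<mu> U = \<mu> (U \<inter> hsphere n)" using U by (subst cone_measure_Int_hsphere[OF n]) auto
    also have "\<dots> \<le> \<mu> (\<Union>k. A5 k)"
      using cover A_sets by (intro emeasure_mono) (auto simp: A5_def)
    also have "\<dots> \<le> (\<Sum>k. \<mu> (A5 k))" using A_sets by (intro emeasure_subadditive_countably) auto
    also have "\<dots> \<le> (\<Sum>k. ennreal ?D * \<mu> (A k))"
    proof (intro suminf_le)
      show "\<mu> (A5 k) \<le> ennreal ?D * \<mu> (A k)" for k
        using V(1-3)[of k] cball_5_bounds(1)[of "a k" "r k"]
        by (cases "k \<in> J") (auto simp: A5_def A_def \<rho>_def)
    qed auto
    also have "\<dots> = ennreal ?D * \<mu> W" by (simp only: ennreal_suminf_cmult sumW)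
    also have "\<dots> = ennreal (?D * ?me W)"
      using D0 by (simp add: emeasure_eq_measure ennreal_mult')
    finally have UW: "?me U \<le> ?D * ?me W"
      using D0 by (simp add: emeasure_eq_measure)
    have gauge: "hausdorff_gauge m (A k) \<le> ennreal (1 + \<epsilon>) * \<mu> (A k)" for k
    proof (cases "k \<in> J")
      case True
      note k = V(1-3)[OF True]
      have "hausdorff_gauge m (A k) = ennreal (unit_ball_vol m * r k ^ m)"
        using True k by (simp add: A_def hausdorff_gauge_cball)
      also have "\<dots> \<le> ennreal ((1 + r k) ^ (m + 1)) * \<mu> (A k)"
        using gauge_le_cone_measure_cball[OF k(1,2)] True by (simp add: A_def)
      also have "\<dots> \<le> ennreal (1 + \<epsilon>) * \<mu> (A k)"
      proof -
        have "r k < b" using k b by (simp add: \<rho>_def)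
        then have "(1 + r k) ^ (m + 1) \<le> 1 + \<epsilon>" using b(2)[of "r k"] k by simp
        then show ?thesis by (intro mult_right_mono ennreal_leI) auto
      qed
      finally show ?thesis .
    qed (simp add: A_def hausdorff_gauge_def)
    have "hausdorff_pre m \<delta> (U \<inter> hsphere n) \<le> hausdorff_pre m \<delta> (W \<union> (U \<inter> hsphere n - W))"
      by (rule hausdorff_pre_mono) auto
    also have "\<dots> \<le> hausdorff_pre m \<delta> W + hausdorff_pre m \<delta> (U \<inter> hsphere n - W)"
      using \<delta> by (intro hausdorff_pre_subadditive) simp
    also have "\<dots> \<le> ennreal (1 + \<epsilon>) * \<mu> W + ennreal C * \<mu> (U - W)"
    proof (rule add_mono)
      have A: "bounded (A k) \<and> diameter (A k) \<le> \<delta>" for k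
        using V(2,3)[of k] \<delta> by (auto simp: A_def \<rho>_def diameter_cball)
      have "hausdorff_pre m \<delta> W \<le> (\<Sum>k. hausdorff_gauge m (A k))"
        unfolding hausdorff_pre_def using A by (intro INF_lower) (auto simp: W_def)
      also have "\<dots> \<le> (\<Sum>k. ennreal (1 + \<epsilon>) * \<mu> (A k))" by (intro suminf_le gauge) auto
      also have "\<dots> = ennreal (1 + \<epsilon>) * \<mu> W" by (simp add: sumW)
      finally show "hausdorff_pre m \<delta> W \<le> ennreal (1 + \<epsilon>) * \<mu> W" .
      have "hausdorff_pre m \<delta> (U \<inter> hsphere n - W) \<le> hausdorff_outer m (U \<inter> hsphere n - W)"
        using \<delta> by (intro hausdorff_pre_le_outer)
      also have "\<dots> \<le> ennreal C * \<mu> (U \<inter> hsphere n - W)"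
        using U W_sets by (intro CE) auto
      also have "\<dots> \<le> ennreal C * \<mu> (U - W)"
        using U W_sets by (intro mult_left_mono emeasure_mono) auto
      finally show "hausdorff_pre m \<delta> (U \<inter> hsphere n - W) \<le> ennreal C * \<mu> (U - W)" .
    qed
    also have "\<mu> (U - W) = ennreal (?me U - ?me W)"
      using U W_sets WU by (simp add: emeasure_eq_measure finite_measure_Diff)
    also have "ennreal (1 + \<epsilon>) * \<mu> W + ennreal C * ennreal (?me U - ?me W)
        = ennreal ((1 + \<epsilon>) * ?me W + C * (?me U - ?me W))"
    proof -
      have "0 \<le> ?me U - ?me W" using finite_measure_mono[OF WU] U by simp
      then show ?thesis using \<epsilon>
        by (simp add: emeasure_eq_measure ennreal_mult'[symmetric] ennreal_plus[symmetric] del: ennreal_plus)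
    qed
    also have "\<dots> \<le> ennreal (C' * ?me U)"
    proof (rule ennreal_leI)
      \<comment> \<open>W costs 1 + \<epsilon> per unit of measure and the rest of U costs C, so the
        saving compared with C throughout is (C - 1 - \<epsilon>) times the measure of W.\<close>
      have "(C - 1 - \<epsilon>) * (?me U / ?D) \<le> (C - 1 - \<epsilon>) * ?me W"
        using UW D0 \<epsilon> by (intro mult_left_mono) (auto simp: field_simps)
      then show "(1 + \<epsilon>) * ?me W + C * (?me U - ?me W) \<le> C' * ?me U"
        by (simp add: C'_def algebra_simps)
    qed
    also have "\<dots> = ennreal (C - (C - 1 - \<epsilon>) / ?D) * \<mu> U"
      using C'1 by (simp add: C'_def emeasure_eq_measure ennreal_mult')
    finally show "hausdorff_pre m \<delta> (U \<inter> hsphere n) \<le> ennreal (C - (C - 1 - \<epsilon>) / ?D) * \<mu> U" .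
  qed
qed

text \<open>The infimum c of the admissible constants is itself admissible by passage to the limit.
  Were c above 1, the improvement with \<epsilon> = (c - 1) / 2 would give an admissible constant
  below c.\<close>

lemma hausdorff_bound_1: "hausdorff_bound 1"
proof -
  interpret finite_measure "cone_measure n" by (rule finite_measure_cone_measure[OF n])
  define c where "c = Inf (Collect hausdorff_bound)"
  have bdd: "bdd_below (Collect hausdorff_bound)"
    by (rule bdd_belowI[of _ 1]) (simp add: hausdorff_bound_def)
  have ne: "Collect hausdorff_bound \<noteq> {}" using hausdorff_bound_doubling by blast
  have c1: "1 \<le> c" unfolding c_def using ne by (intro cInf_greatest) (auto simp: hausdorff_bound_def)
  have "hausdorff_bound c"
    unfolding hausdorff_bound_def
  proof (intro conjI c1 ballI impI)
    fix E assume E: "E \<in> sets borel" "E \<subseteq> hsphere n"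
    show "hausdorff_outer m E \<le> ennreal c * \<mu> E"
    proof (rule ennreal_le_mult_limit[where f = "\<lambda>x. x" and b = "c + 1"])
      fix d assume "c < d"
      then obtain C where C: "hausdorff_bound C" "C < d"
        unfolding c_def using cInf_lessD[OF ne] by blast
      then have "hausdorff_outer m E \<le> ennreal C * \<mu> E"
        using E by (simp add: hausdorff_bound_def)
      also have "\<dots> \<le> ennreal d * \<mu> E"
        using C by (intro mult_right_mono ennreal_leI) auto
      finally show "hausdorff_outer m E \<le> ennreal d * \<mu> E" .
    qed (auto simp: emeasure_eq_measure)
  qed
  moreover have "c = 1"
  proof (rule ccontr)
    assume "c \<noteq> 1"
    with c1 have c: "1 < c" by simp
    have "hausdorff_bound (c - (c - 1 - (c - 1) / 2) / doubling)"
      using \<open>hausdorff_bound c\<close> c by (intro hausdorff_bound_improve) (auto simp: field_simps)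
    then have "c \<le> c - (c - 1 - (c - 1) / 2) / doubling"
      unfolding c_def using bdd by (intro cInf_lower) (auto simp: c_def)
    moreover have "0 < (c - 1 - (c - 1) / 2) / doubling"
      using c doubling_ge_1 by (intro divide_pos_pos) (auto simp: field_simps)
    ultimately show False by linarith
  qed
  ultimately show ?thesis by simp
qed

theorem hausdorff_measure_eq_cone_measure:
  assumes E: "E \<in> sets borel" "E \<subseteq> hsphere n"
  shows "emeasure (hausdorff_measure m) E = emeasure (cone_measure n) E"
  unfolding emeasure_hausdorff_measure[OF E(1)]
  using hausdorff_bound_1 cone_measure_le_hausdorff[OF E] E
  by (auto simp: hausdorff_bound_def intro: antisym)

end

subsection \<open>Averaging over anisotropic dilations\<close>

text \<open>In the variable lambda = t powr \<beta> the powers with exponents \<alpha> and -\<alpha>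
  cancel, and the integral becomes (1 - \<alpha>) k a^k times that of lambda^(-1-k) over (a,
  1).\<close>

lemma nn_integral_averaging_weight:
  fixes a \<alpha> :: real and k :: nat
  assumes a: "0 < a" "a < 1" and \<alpha>: "0 < \<alpha>" "\<alpha> < 1" and k: "k \<ge> 1"
  defines "\<beta> \<equiv> 1 / (1 - \<alpha>)"
  shows "(\<integral>\<^sup>+t. indicator {0<..<1} t * (indicator {a<..} (t powr \<beta>) *
      ennreal (real k * a ^ k * (t powr \<beta>) powr (\<alpha> - 1 - real k))) \<partial>lborel) = ennreal ((1 - \<alpha>) * (1 - a ^ k))"
proof -
  \<comment> \<open>The parameter at which \<open>t powr \<beta>\<close> equals a.\<close>
  define t0 where "t0 = a powr (1 - \<alpha>)"
  have t0: "0 < t0" "t0 < 1" using a \<alpha> powr_less_mono2[of "1 - \<alpha>" a 1] by (simp_all add: t0_def)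
  have \<beta>: "0 < \<beta>" "\<beta> * (1 - \<alpha>) = 1" "\<beta> * (\<alpha> - 1 - real k) = - 1 - \<beta> * real k"
    using \<alpha> by (simp_all add: \<beta>_def field_simps)
  have t0\<beta>: "t0 powr \<beta> = a" using a \<beta> by (simp add: t0_def powr_powr mult.commute)
  have iff: "a < t powr \<beta> \<longleftrightarrow> t0 < t" if "0 < t" for t
  proof
    show "a < t powr \<beta>" if "t0 < t" using powr_less_mono2[of \<beta> t0 t] \<beta> t0 that by (simp add: t0\<beta>)
    show "t0 < t" if "a < t powr \<beta>"
    proof (rule ccontr)
      assume "\<not> t0 < t"
      then have "t powr \<beta> \<le> t0 powr \<beta>" using \<beta> \<open>0 < t\<close> by (intro powr_mono2) auto
      with that show False by (simp add: t0\<beta>)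
    qed
  qed
  have "(\<integral>\<^sup>+t. indicator {0<..<1} t * (indicator {a<..} (t powr \<beta>) *
      ennreal (real k * a ^ k * (t powr \<beta>) powr (\<alpha> - 1 - real k))) \<partial>lborel)
      = (\<integral>\<^sup>+t. ennreal (real k * a ^ k * t powr (- 1 - \<beta> * real k)) * indicator {t0..1} t \<partial>lborel)"
  proof (rule nn_integral_cong_AE)
    have "AE t in lborel. t \<noteq> t0" "AE t in lborel. t \<noteq> 1" by (rule AE_lborel_singleton)+
    then show "AE t in lborel. indicator {0<..<1} t * (indicator {a<..} (t powr \<beta>) *
      ennreal (real k * a ^ k * (t powr \<beta>) powr (\<alpha> - 1 - real k))) =
      ennreal (real k * a ^ k * t powr (- 1 - \<beta> * real k)) * indicator {t0..1} t"
    proof eventually_elim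
      case (elim t)
      show ?case
      proof (cases "0 < t")
        case True
        then show ?thesis using elim iff[OF True] t0 \<beta>(3)
          by (auto simp: indicator_def powr_powr)
      next
        case False
        then show ?thesis using t0 by (auto simp: indicator_def)
      qed
    qed
  qed
  also have "\<dots> = ennreal (- ((1 - \<alpha>) * a ^ k * 1 powr (- \<beta> * real k)) - - ((1 - \<alpha>) * a ^ k * t0 powr (- \<beta> * real k)))"
  proof (rule nn_integral_FTC_Icc[where F = "\<lambda>t. - ((1 - \<alpha>) * a ^ k * t powr (- \<beta> * real k))"])
    fix t assume t: "t \<in> {t0..1}"
    have "0 < t" using t t0 by simp
    then have "((\<lambda>t. - ((1 - \<alpha>) * a ^ k * t powr (- \<beta> * real k))) has_real_derivative
        - ((1 - \<alpha>) * a ^ k * ((- \<beta> * real k) * t powr (- \<beta> * real k - 1)))) (at t)"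
      by (intro DERIV_minus DERIV_cmult has_real_derivative_powr)
    moreover have e: "- \<beta> * real k - 1 = - 1 - \<beta> * real k" by simp
    moreover have "- ((1 - \<alpha>) * a ^ k * ((- \<beta> * real k) * t powr (- \<beta> * real k - 1)))
        = (\<beta> * (1 - \<alpha>)) * real k * a ^ k * t powr (- \<beta> * real k - 1)" by (simp add: mult_ac)
    ultimately show "((\<lambda>t. - ((1 - \<alpha>) * a ^ k * t powr (- \<beta> * real k))) has_real_derivative
        real k * a ^ k * t powr (- 1 - \<beta> * real k)) (at t)"
      unfolding \<beta>(2) e by (simp only: mult_1_left)
  qed (use a t0 in auto)
  also have "t0 powr (- \<beta> * real k) = 1 / a ^ k"
  proof -
    have "t0 powr (- \<beta> * real k) = (t0 powr \<beta>) powr (- real k)" by (simp add: powr_powr)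
    then show ?thesis using a by (simp add: t0\<beta> powr_minus powr_realpow divide_inverse)
  qed
  finally show ?thesis using a by (simp add: algebra_simps)
qed

locale anisotropic_norm =
  fixes n :: "'a::euclidean_space" and nrm :: "'a \<Rightarrow> real" and c0 :: real
  assumes n: "norm n = 1" and dim: "DIM('a) \<ge> 2"
    and nrm_cont: "continuous_on UNIV nrm"
    and nrm_hom: "\<And>c x. nrm (c *\<^sub>R x) = \<bar>c\<bar> * nrm x"
    and c0: "0 < c0" "c0 \<le> 1" and nrm_lower: "\<And>x. c0 * norm x \<le> nrm x"
begin

text \<open>The cylinder over the base of \<open>slab\<close>, unbounded along n because the
  blown-up sets may reach heights other than those between 0 and 1.\<close>

definition punctured :: "'a set" where
  "punctured = {z. 0 < norm (perp n z) \<and> norm (perp n z) < 1}"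

lemma sets_punctured [measurable]: "punctured \<in> sets borel"
  unfolding punctured_def by measurable

lemma nrm_measurable [measurable]: "nrm \<in> borel_measurable borel"
  using nrm_cont by (rule borel_measurable_continuous_onI)

lemma nrm_nonneg: "0 \<le> nrm x"
  using nrm_lower[of x] c0 by (smt (verit) mult_nonneg_nonneg norm_ge_zero)

text \<open>Write the left weight as an integral over t, exchange the integrals and substitute
  \<open>aniso n l z\<close> with l = t powr \<beta>. The Jacobian l^(N+1), the kernel factor
  l^(-N-\<alpha>) and the weight l^k l^(\<alpha>-1-k) multiply to 1, so besides the set only the
  height in the kernel still depends on l.\<close>

lemma averaging:
  fixes P :: "'a set" and \<alpha> :: real
  assumes [measurable]: "P \<in> sets borel" and \<alpha>: "0 < \<alpha>" "\<alpha> < 1"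
  defines "k \<equiv> DIM('a) - 1" and "\<beta> \<equiv> 1 / (1 - \<alpha>)"
  shows "(\<integral>\<^sup>+z. indicator (punctured \<inter> P) z * ennreal ((1 - \<alpha>) * (1 - norm (perp n z) ^ k) /
        nrm z powr (DIM('a) + \<alpha>)) \<partial>lborel) =
    (\<integral>\<^sup>+t. indicator {0<..<1} t * (\<integral>\<^sup>+z. indicator (punctured \<inter> aniso n (t powr \<beta>) -` P) z *
        ennreal (real k * norm (perp n z) ^ k /
          nrm (perp n z + (t powr \<beta> * (z \<bullet> n)) *\<^sub>R n) powr (DIM('a) + \<alpha>)) \<partial>lborel) \<partial>lborel)"
proof -
  let ?J = "\<lambda>t. \<integral>\<^sup>+z. indicator (punctured \<inter> aniso n (t powr \<beta>) -` P) z *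
    ennreal (real k * norm (perp n z) ^ k / nrm (perp n z + (t powr \<beta> * (z \<bullet> n)) *\<^sub>R n) powr (DIM('a) + \<alpha>)) \<partial>lborel"
  have k: "k \<ge> 1" "real DIM('a) = real k + 1" using dim by (auto simp: k_def)
  define w where "w z = 1 / nrm z powr (DIM('a) + \<alpha>)" for z
  have w0: "0 \<le> w z" for z by (simp add: w_def)
  have [measurable]: "w \<in> borel_measurable borel" unfolding w_def by measurable
  define g where "g t z = indicator {0<..<1} t * (indicator {norm (perp n z)<..} (t powr \<beta>) *
      ennreal (real k * norm (perp n z) ^ k * (t powr \<beta>) powr (\<alpha> - 1 - real k)))" for t :: real and z :: 'a
  have g_alt: "g t z = (if 0 < t \<and> t < 1 \<and> norm (perp n z) < t powr \<beta> then
      ennreal (real k * norm (perp n z) ^ k * (t powr \<beta>) powr (\<alpha> - 1 - real k)) else 0)" for t z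
    unfolding g_def
    by (cases "0 < t"; cases "t < 1"; cases "norm (perp n z) < t powr \<beta>") simp_all
  have [measurable]: "(\<lambda>(t, z). g t z) \<in> borel_measurable (borel \<Otimes>\<^sub>M borel)"
    unfolding g_alt by measurable
  have "(\<integral>\<^sup>+z. indicator (punctured \<inter> P) z * ennreal ((1 - \<alpha>) * (1 - norm (perp n z) ^ k) /
        nrm z powr (DIM('a) + \<alpha>)) \<partial>lborel)
      = (\<integral>\<^sup>+z. \<integral>\<^sup>+t. indicator (punctured \<inter> P) z * ennreal (w z) * g t z \<partial>lborel \<partial>lborel)"
  proof (rule nn_integral_cong)
    fix z :: 'a
    show "indicator (punctured \<inter> P) z * ennreal ((1 - \<alpha>) * (1 - norm (perp n z) ^ k) /
        nrm z powr (DIM('a) + \<alpha>)) = (\<integral>\<^sup>+t. indicator (punctured \<inter> P) z * ennreal (w z) * g t z \<partial>lborel)"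
    proof (cases "z \<in> punctured \<inter> P")
      case True
      then have nz: "0 < norm (perp n z)" "norm (perp n z) < 1" by (auto simp: punctured_def)
      have "(\<integral>\<^sup>+t. g t z \<partial>lborel) = ennreal ((1 - \<alpha>) * (1 - norm (perp n z) ^ k))"
        using nn_integral_averaging_weight[of "norm (perp n z)" \<alpha> k] nz \<alpha> k(1) by (simp add: g_def \<beta>_def)
      then show ?thesis using True w0[of z]
        by (simp add: nn_integral_cmult ennreal_mult'[symmetric]) (simp add: w_def mult.commute)
    qed simp
  qed
  also have "\<dots> = (\<integral>\<^sup>+t. \<integral>\<^sup>+z. indicator (punctured \<inter> P) z * ennreal (w z) * g t z \<partial>lborel \<partial>lborel)"
    by (rule nn_integral_lborel_swap) measurable
  also have "\<dots> = (\<integral>\<^sup>+t. indicator {0<..<1} t * ?J t \<partial>lborel)"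
  proof (rule nn_integral_cong)
    fix t :: real
    show "(\<integral>\<^sup>+z. indicator (punctured \<inter> P) z * ennreal (w z) * g t z \<partial>lborel) =
        indicator {0<..<1} t * ?J t"
    proof (cases "0 < t \<and> t < 1")
      case True
      define l where "l = t powr \<beta>"
      have \<beta>0: "0 < \<beta>" using \<alpha> by (simp add: \<beta>_def)
      have l: "0 < l" "l < 1" using True \<beta>0 powr_less_mono2[of \<beta> t 1] by (simp_all add: l_def)
      have "(\<integral>\<^sup>+z. indicator (punctured \<inter> P) z * ennreal (w z) * g t z \<partial>lborel) =
          ennreal (l ^ (DIM('a) + 1)) * (\<integral>\<^sup>+z. indicator (punctured \<inter> P) (aniso n l z) *
            ennreal (w (aniso n l z)) * g t (aniso n l z) \<partial>lborel)"
        by (rule nn_integral_aniso[OF _ n l(1)]) measurable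
      also have "\<dots> = (\<integral>\<^sup>+z. ennreal (l ^ (DIM('a) + 1)) * (indicator (punctured \<inter> P) (aniso n l z) *
            ennreal (w (aniso n l z)) * g t (aniso n l z)) \<partial>lborel)"
        by (rule nn_integral_cmult[symmetric]) measurable
      also have "\<dots> = ?J t"
      proof (rule nn_integral_cong)
        fix z :: 'a
        define y where "y = perp n z"
        have py: "norm (perp n (aniso n l z)) = l * norm y"
          using l by (simp add: aniso_simps[OF n] y_def)
        \<comment> \<open>The weight restricts to |y| < l before the substitution; dilating turns
          this into |y| < 1, a domain that is the same for all t.\<close>
        have mem: "(aniso n l z \<in> punctured \<and> norm (perp n (aniso n l z)) < l) = (z \<in> punctured)"
        proof -
          have "l * norm y < l \<longleftrightarrow> norm y < 1" using l by simp
          moreover have "norm y < 1 \<Longrightarrow> l * norm y < 1" using l by (smt (verit) mult_less_cancel_left2 norm_ge_zero)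
          ultimately show ?thesis unfolding punctured_def mem_Collect_eq py
            using l by (auto simp: y_def[symmetric] zero_less_mult_iff)
        qed
        show "ennreal (l ^ (DIM('a) + 1)) * (indicator (punctured \<inter> P) (aniso n l z) *
            ennreal (w (aniso n l z)) * g t (aniso n l z)) =
          indicator (punctured \<inter> aniso n (t powr \<beta>) -` P) z *
          ennreal (real k * norm (perp n z) ^ k /
          nrm (perp n z + (t powr \<beta> * (z \<bullet> n)) *\<^sub>R n) powr (DIM('a) + \<alpha>))"
        proof (cases "z \<in> punctured \<and> aniso n l z \<in> P")
          case zin: True
          have an: "aniso n l z = l *\<^sub>R (y + (l * (z \<bullet> n)) *\<^sub>R n)"
            by (simp add: aniso_def y_def scaleR_add_right power2_eq_square mult.assoc)
          have wl: "w (aniso n l z) = l powr (- (DIM('a) + \<alpha>)) * w (y + (l * (z \<bullet> n)) *\<^sub>R n)"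
            unfolding an w_def nrm_hom powr_minus using l nrm_nonneg by (simp add: powr_mult divide_inverse)
          have gl: "g t (aniso n l z) = ennreal (real k * (l * norm y) ^ k * l powr (\<alpha> - 1 - real k))"
            using zin mem True unfolding g_alt py l_def[symmetric] by simp
          have powers: "l ^ (DIM('a) + 1) * l powr (- (DIM('a) + \<alpha>)) * (l ^ k * l powr (\<alpha> - 1 - real k)) = 1"
          proof -
            have "l ^ (DIM('a) + 1) = l powr (real DIM('a) + 1)" "l ^ k = l powr (real k)"
              using l by (simp_all add: powr_realpow[symmetric] add.commute del: power_Suc)
            then have "l ^ (DIM('a) + 1) * l powr (- (DIM('a) + \<alpha>)) * (l ^ k * l powr (\<alpha> - 1 - real k))
              = l powr ((real DIM('a) + 1) + (- (DIM('a) + \<alpha>)) + (real k + (\<alpha> - 1 - real k)))"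
              by (simp only: powr_add)
            also have "(real DIM('a) + 1) + (- (DIM('a) + \<alpha>)) + (real k + (\<alpha> - 1 - real k)) = 0"
              by simp
            finally show ?thesis using l by simp
          qed
          have "ennreal (l ^ (DIM('a) + 1)) * (indicator (punctured \<inter> P) (aniso n l z) *
            ennreal (w (aniso n l z)) * g t (aniso n l z)) = ennreal (l ^ (DIM('a) + 1) *
            (l powr (- (DIM('a) + \<alpha>)) * w (y + (l * (z \<bullet> n)) *\<^sub>R n) * (real k * (l * norm y) ^ k * l powr (\<alpha> - 1 - real k))))"
            unfolding gl wl using zin mem l w0 by (simp add: ennreal_mult''[symmetric] ennreal_mult'[symmetric] w0)
          also have "l ^ (DIM('a) + 1) * (l powr (- (DIM('a) + \<alpha>)) * w (y + (l * (z \<bullet> n)) *\<^sub>R n) *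
              (real k * (l * norm y) ^ k * l powr (\<alpha> - 1 - real k)))
            = (l ^ (DIM('a) + 1) * l powr (- (DIM('a) + \<alpha>)) * (l ^ k * l powr (\<alpha> - 1 - real k))) *
              (real k * norm y ^ k * w (y + (l * (z \<bullet> n)) *\<^sub>R n))"
            unfolding power_mult_distrib by (simp only: mult_ac)
          finally show ?thesis unfolding powers using zin
            by (simp add: w_def y_def l_def)
        next
          case False
          then have "z \<notin> punctured \<inter> aniso n (t powr \<beta>) -` P" by (auto simp: l_def)
          moreover have "indicator (punctured \<inter> P) (aniso n l z) * g t (aniso n l z) = 0"
            using False mem unfolding g_alt l_def[symmetric] by (auto simp: indicator_def)
          ultimately show ?thesis by (auto simp: mult_ac)
        qed
      qed
      finally show ?thesis using True by simp
    next
      case False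
      then have "g t z = 0" for z by (auto simp: g_alt)
      then show ?thesis using False by (auto simp: indicator_def)
    qed
  qed
  finally show ?thesis .
qed

end

subsection \<open>The limit for thin sets\<close>

text \<open>On the dyadic shell between r 2^j and r 2^(j+1) the integrand is at most (r 2^j)^(-N-e)
  and the volume is of order (r 2^j)^N, which leaves a geometric series with ratio 2^(-e).\<close>

lemma nn_integral_far_finite:
  fixes r e :: real
  assumes r: "0 < r" and e: "0 < e"
  shows "(\<integral>\<^sup>+z. indicator (- ball (0 :: 'a::euclidean_space) r) z *
    ennreal (1 / norm z powr (DIM('a) + e)) \<partial>lborel) < \<infinity>"
proof -
  let ?N = "DIM('a)"
  define q where "q = 2 powr (- e)"
  have q: "0 < q" "q < 1" using e powr_less_mono[of "-e" 0 2] by (simp_all add: q_def)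
  define c where "c = unit_ball_vol ?N * 2 ^ ?N * r powr (- e)"
  have c: "0 \<le> c" using r by (simp add: c_def)
  define R where "R j = r * 2 ^ j" for j :: nat
  have R: "0 < R j" for j using r by (simp add: R_def)
  have point: "indicator (- ball 0 r) z * ennreal (1 / norm z powr (?N + e)) \<le>
      (\<Sum>j. ennreal (1 / R j powr (?N + e)) * indicator (ball 0 (R (Suc j))) z)" for z :: 'a
  proof (cases "z \<in> ball 0 r")
    case False
    then have z: "r \<le> norm z" by simp
    have "\<exists>j. norm z < R (Suc j)"
    proof -
      obtain j where "norm z / r < 2 ^ j" using real_arch_pow[of 2 "norm z / r"] by auto
      then have "norm z < R j" using r by (simp add: R_def field_simps)
      also have "R j \<le> R (Suc j)" using r by (simp add: R_def)
      finally show ?thesis by blast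
    qed
    define j where "j = (LEAST j. norm z < R (Suc j))"
    have j: "norm z < R (Suc j)" unfolding j_def using \<open>\<exists>j. norm z < R (Suc j)\<close> by (rule LeastI_ex)
    have Rj: "R j \<le> norm z"
    proof (cases j)
      case 0
      then show ?thesis using z by (simp add: R_def)
    next
      case (Suc i)
      then have "\<not> norm z < R (Suc i)" unfolding j_def by (intro not_less_Least) simp
      then show ?thesis using Suc by simp
    qed
    have "R j powr (?N + e) \<le> norm z powr (?N + e)"
      using Rj R[of j] e by (intro powr_mono2) auto
    then have "1 / norm z powr (?N + e) \<le> 1 / R j powr (?N + e)"
      using R[of j] by (intro frac_le) auto
    then have "indicator (- ball 0 r) z * ennreal (1 / norm z powr (?N + e)) \<le> ennreal (1 / R j powr (?N + e)) * indicator (ball 0 (R (Suc j))) z"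
      using False j by (simp add: ennreal_leI)
    also have "\<dots> \<le> (\<Sum>i. ennreal (1 / R i powr (?N + e)) * indicator (ball 0 (R (Suc i))) z)"
    proof -
      have single: "F j \<le> suminf F" for F :: "nat \<Rightarrow> ennreal"
        using sum_le_suminf[of F "{j}"] by simp
      show ?thesis by (rule single)
    qed
    finally show ?thesis .
  qed simp
  have piece: "(\<integral>\<^sup>+z. ennreal (1 / R j powr (?N + e)) * indicator (ball (0::'a) (R (Suc j))) z \<partial>lborel) = ennreal (c * q ^ j)" for j
  proof -
    have "(\<integral>\<^sup>+z. ennreal (1 / R j powr (?N + e)) * indicator (ball (0::'a) (R (Suc j))) z \<partial>lborel)
        = ennreal (1 / R j powr (?N + e)) * ennreal (unit_ball_vol ?N * R (Suc j) ^ ?N)"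
      using R[of "Suc j"]
      by (subst nn_integral_cmult) (auto simp: emeasure_ball intro!: borel_measurable_indicator)
    also have "\<dots> = ennreal (1 / R j powr (?N + e) * (unit_ball_vol ?N * R (Suc j) ^ ?N))"
      using R[of j] by (subst ennreal_mult'[symmetric]) auto
    also have "1 / R j powr (?N + e) * (unit_ball_vol ?N * R (Suc j) ^ ?N) = c * q ^ j"
    proof -
      have a: "R (Suc j) ^ ?N = 2 ^ ?N * R j powr ?N"
        using R[of j] by (simp add: R_def power_mult_distrib powr_realpow mult_ac)
      have b: "1 / R j powr (?N + e) = R j powr (- ?N) * R j powr (- e)"
        by (simp add: powr_add[symmetric] powr_minus_divide[symmetric])
      have d: "R j powr (- e) = r powr (- e) * q ^ j"
        using r by (simp add: R_def powr_mult q_def powr_realpow[symmetric] powr_powr mult.commute)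
      have f: "R j powr (- ?N) * R j powr ?N = 1" using R[of j] by (simp add: powr_add[symmetric])
      have "1 / R j powr (?N + e) * (unit_ball_vol ?N * R (Suc j) ^ ?N)
          = (R j powr (- ?N) * R j powr ?N) * (unit_ball_vol ?N * 2 ^ ?N * R j powr (- e))"
        unfolding a b by (simp only: mult_ac)
      then show ?thesis unfolding f d c_def by (simp only: mult_ac mult_1_left)
    qed
    finally show ?thesis .
  qed
  have "(\<integral>\<^sup>+z. indicator (- ball (0 :: 'a) r) z * ennreal (1 / norm z powr (?N + e)) \<partial>lborel)
      \<le> (\<integral>\<^sup>+z. (\<Sum>j. ennreal (1 / R j powr (?N + e)) * indicator (ball (0::'a) (R (Suc j))) z) \<partial>lborel)"
    by (intro nn_integral_mono point)
  also have "\<dots> = (\<Sum>j. \<integral>\<^sup>+z. ennreal (1 / R j powr (?N + e)) * indicator (ball (0::'a) (R (Suc j))) z \<partial>lborel)"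
    by (intro nn_integral_suminf borel_measurable_times_ennreal borel_measurable_const borel_measurable_indicator) simp
  also have "\<dots> = (\<Sum>j. ennreal (c * q ^ j))" by (simp only: piece)
  also have "\<dots> = ennreal (c * (1 / (1 - q)))"
  proof (rule suminf_ennreal_eq)
    show "(\<lambda>j. c * q ^ j) sums (c * (1 / (1 - q)))"
      using q by (intro sums_mult geometric_sums) simp
  qed (use q c in simp)
  also have "\<dots> < \<infinity>" by simp
  finally show ?thesis .
qed

lemma powr_at_left_1_tendsto_0:
  fixes t :: real
  assumes t: "0 < t" "t < 1" and a: "\<And>i. a i < 1" "a \<longlonglongrightarrow> 1"
  shows "(\<lambda>i. t powr (1 / (1 - a i))) \<longlonglongrightarrow> 0"
proof -
  have "(\<lambda>i. 1 - a i) \<longlonglongrightarrow> 1 - 1" by (intro tendsto_intros a)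
  then have "filterlim (\<lambda>i. 1 - a i) (at_right 0) sequentially"
    using a by (intro tendsto_imp_filterlim_at_right) auto
  then have "filterlim (\<lambda>i. inverse (1 - a i)) at_top sequentially"
    by (rule filterlim_compose[OF filterlim_inverse_at_top_right])
  then have "filterlim (\<lambda>i. ln t * inverse (1 - a i)) at_bot sequentially"
    using t by (intro filterlim_tendsto_neg_mult_at_bot[where c = "ln t"]) auto
  then have "(\<lambda>i. exp (ln t * inverse (1 - a i))) \<longlonglongrightarrow> 0"
    by (rule filterlim_compose[OF exp_at_bot])
  then show ?thesis using t by (simp add: powr_def divide_inverse mult.commute)
qed

context anisotropic_norm
begin

text \<open>Over each y the region has length 2 M |y|^2 along n, which exactly compensates the
  singularity 1 / |y|^2 left by the averaged kernel.\<close>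

definition dominator :: "real \<Rightarrow> 'a \<Rightarrow> ennreal" where
  "dominator M z = indicator {z \<in> punctured. \<bar>z \<bullet> n\<bar> \<le> M * (norm (perp n z))\<^sup>2} z *
     ennreal (1 / (norm (perp n z))\<^sup>2)"

lemma dominator_measurable [measurable]: "dominator M \<in> borel_measurable borel"
  unfolding dominator_def by measurable

lemma nn_integral_dominator:
  assumes M: "0 \<le> M"
  shows "(\<integral>\<^sup>+z. dominator M z \<partial>lborel) < \<infinity>"
proof -
  have "(\<integral>\<^sup>+z. dominator M z \<partial>lborel) =
      (\<integral>\<^sup>+z. indicator {0<..<1} (z \<bullet> n) * (\<integral>\<^sup>+s. dominator M (perp n z + s *\<^sub>R n) \<partial>lborel) \<partial>lborel)"
    by (rule nn_integral_direction[OF _ n]) measurable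
  also have "\<dots> \<le> (\<integral>\<^sup>+z. ennreal (2 * M) * indicator (ball (0::'a) 2) z \<partial>lborel)"
  proof (rule nn_integral_mono)
    fix z :: 'a
    define y where "y = perp n z"
    have yn: "perp n (y + s *\<^sub>R n) = y" "(y + s *\<^sub>R n) \<bullet> n = s" for s
      using perp_simps[OF n] perp_inner[OF n] by (auto simp: y_def)
    show "indicator {0<..<1} (z \<bullet> n) * (\<integral>\<^sup>+s. dominator M (perp n z + s *\<^sub>R n) \<partial>lborel)
        \<le> ennreal (2 * M) * indicator (ball 0 2) z"
    proof (cases "z \<in> slab n")
      case True
      then have y: "0 < norm y" "norm y < 1" by (auto simp: slab_def y_def)
      have "dominator M (y + s *\<^sub>R n) = ennreal (1 / (norm y)\<^sup>2) * indicator {- (M * (norm y)\<^sup>2)..M * (norm y)\<^sup>2} s" for s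
        unfolding dominator_def yn using y by (auto simp: punctured_def yn indicator_def abs_le_iff)
      then have "(\<integral>\<^sup>+s. dominator M (y + s *\<^sub>R n) \<partial>lborel) = ennreal (1 / (norm y)\<^sup>2) * ennreal (2 * (M * (norm y)\<^sup>2))"
        using M by (simp add: nn_integral_cmult)
      also have "\<dots> = ennreal (2 * M)"
        using y M by (subst ennreal_mult'[symmetric]) auto
      finally show ?thesis using slab_subset_ball[OF n] True
        by (auto simp: y_def indicator_def)
    next
      case False
      have zero: "indicator {0<..<1} (z \<bullet> n) * dominator M (y + s *\<^sub>R n) = 0" for s
      proof (cases "0 < z \<bullet> n \<and> z \<bullet> n < 1")
        case True
        then have "\<not> (0 < norm y \<and> norm y < 1)" using False by (simp add: slab_def y_def)
        then have "y + s *\<^sub>R n \<notin> punctured" by (simp only: punctured_def mem_Collect_eq yn not_False_eq_True)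
        then show ?thesis by (simp add: dominator_def)
      qed (auto simp: indicator_def)
      have "indicator {0<..<1} (z \<bullet> n) * (\<integral>\<^sup>+s. dominator M (perp n z + s *\<^sub>R n) \<partial>lborel)
          = (\<integral>\<^sup>+s. indicator {0<..<1} (z \<bullet> n) * dominator M (y + s *\<^sub>R n) \<partial>lborel)"
        unfolding y_def by (rule nn_integral_cmult[symmetric]) measurable
      also have "\<dots> = 0" unfolding zero by simp
      finally show ?thesis by (simp only: zero_le)
    qed
  qed
  also have "\<dots> = ennreal (2 * M) * emeasure lborel (ball (0::'a) 2)"
    by (rule nn_integral_cmult_indicator) simp
  also have "\<dots> < \<infinity>"
    using emeasure_bounded_finite[of "ball (0::'a) 2"] by (simp add: ennreal_mult_less_top)
  finally show ?thesis .
qed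

text \<open>As c0 a is at most 1, raising the exponent from N + \<alpha> to N + 1 lowers the
  denominator, which frees the bound from \<alpha>. Of the N + 1 factors a in it, N - 1 cancel
  against the numerator.\<close>

lemma kernel_bound:
  fixes a \<alpha> :: real
  assumes y: "0 < a" "a < 1" and v: "c0 * a \<le> nrm v" and \<alpha>: "0 < \<alpha>" "\<alpha> < 1"
  shows "a ^ (DIM('a) - 1) / nrm v powr (DIM('a) + \<alpha>) \<le> (1 / c0 ^ (DIM('a) + 1)) / a\<^sup>2"
proof -
  have ca: "0 < c0 * a" "c0 * a \<le> 1" using c0 y by (auto intro: mult_le_one)
  have "(c0 * a) ^ (DIM('a) + 1) = (c0 * a) powr (real (DIM('a) + 1))" using ca by (simp only: powr_realpow)
  also have "\<dots> \<le> (c0 * a) powr (DIM('a) + \<alpha>)" using ca \<alpha> by (intro powr_mono') auto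
  also have "\<dots> \<le> nrm v powr (DIM('a) + \<alpha>)" using ca v \<alpha> by (intro powr_mono2) auto
  finally have "a ^ (DIM('a) - 1) / nrm v powr (DIM('a) + \<alpha>) \<le> a ^ (DIM('a) - 1) / (c0 * a) ^ (DIM('a) + 1)"
    using ca y by (intro frac_le) simp_all
  also have "(c0 * a) ^ (DIM('a) + 1) = c0 ^ (DIM('a) + 1) * (a ^ (DIM('a) - 1) * a\<^sup>2)"
  proof -
    have "DIM('a) + 1 = (DIM('a) - 1) + 2" using dim by linarith
    then have "a ^ (DIM('a) + 1) = a ^ (DIM('a) - 1) * a\<^sup>2" by (metis power_add)
    then show ?thesis by (simp only: power_mult_distrib)
  qed
  also have "a ^ (DIM('a) - 1) / (c0 ^ (DIM('a) + 1) * (a ^ (DIM('a) - 1) * a\<^sup>2)) = (1 / c0 ^ (DIM('a) + 1)) / a\<^sup>2"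
    using y c0 by (simp add: field_simps)
  finally show ?thesis .
qed


text \<open>The averaged kernel at dilation 0 and \<alpha> = 1; it no longer depends on the height
  along n.\<close>

definition weight_limit :: "'a \<Rightarrow> ennreal" where
  "weight_limit z = ennreal (real (DIM('a) - 1) * norm (perp n z) ^ (DIM('a) - 1) /
     nrm (perp n z) powr (real DIM('a) + 1))"

lemma weight_limit_measurable [measurable]: "weight_limit \<in> borel_measurable borel"
  unfolding weight_limit_def by measurable

lemma perp_add_lower:
  "c0 * norm (perp n z) \<le> nrm (perp n z + s *\<^sub>R n)"
proof -
  have "norm (perp n (perp n z + s *\<^sub>R n)) \<le> norm (perp n z + s *\<^sub>R n)"
    by (rule norm_perp_le[OF n])
  then have "c0 * norm (perp n z) \<le> c0 * norm (perp n z + s *\<^sub>R n)"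
    using c0 by (simp add: perp_simps[OF n])
  then show ?thesis using nrm_lower order_trans by blast
qed

definition bound_const :: real where
  "bound_const = real (DIM('a) - 1) * (1 / c0 ^ (DIM('a) + 1))"

lemma bound_const_nonneg: "0 \<le> bound_const"
  using c0 by (simp add: bound_const_def)

lemma kernel_le_dominator:
  fixes \<alpha> s :: real
  assumes z: "z \<in> punctured" "\<bar>z \<bullet> n\<bar> \<le> M * (norm (perp n z))\<^sup>2" and \<alpha>: "0 < \<alpha>" "\<alpha> < 1"
  shows "ennreal (real (DIM('a) - 1) * norm (perp n z) ^ (DIM('a) - 1) /
          nrm (perp n z + s *\<^sub>R n) powr (DIM('a) + \<alpha>)) \<le> ennreal bound_const * dominator M z"
proof -
  have "real (DIM('a) - 1) * (norm (perp n z) ^ (DIM('a) - 1) /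
          nrm (perp n z + s *\<^sub>R n) powr (DIM('a) + \<alpha>))
      \<le> real (DIM('a) - 1) * ((1 / c0 ^ (DIM('a) + 1)) / (norm (perp n z))\<^sup>2)"
    using z \<alpha> by (intro mult_left_mono kernel_bound perp_add_lower) (auto simp: punctured_def)
  then have "ennreal (real (DIM('a) - 1) * norm (perp n z) ^ (DIM('a) - 1) /
          nrm (perp n z + s *\<^sub>R n) powr (DIM('a) + \<alpha>))
      \<le> ennreal (bound_const * (1 / (norm (perp n z))\<^sup>2))"
    by (intro ennreal_leI) (simp add: bound_const_def mult.assoc)
  also have "\<dots> = ennreal bound_const * dominator M z"
    using z bound_const_nonneg by (simp add: dominator_def ennreal_mult'[symmetric])
  finally show ?thesis .
qed

text \<open>The integral over P splits into the part away from the origin (\<open>far\<close>) and,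
  near the origin, the parts with weights |y|^k (\<open>rem\<close>) and 1 - |y|^k
  (\<open>main\<close>). The first two are 1 - a i times a bound independent of i. The third is
  rewritten by \<open>averaging\<close> and converges by dominated convergence, in z and then in
  t.\<close>

lemma thin_set_limit:
  fixes P P0 :: "'a set" and r M :: real and a :: "nat \<Rightarrow> real"
  assumes [measurable]: "P \<in> sets borel" "P0 \<in> sets borel"
    and r: "0 < r" "r \<le> 1" and M: "0 \<le> M"
    and thin: "\<And>z. z \<in> P \<Longrightarrow> norm z < r \<Longrightarrow> \<bar>z \<bullet> n\<bar> \<le> M * (norm (perp n z))\<^sup>2"
    and blowup: "AE z in lborel. z \<in> punctured \<longrightarrow> (\<forall>\<^sub>F l in at_right 0. aniso n l z \<in> P \<longleftrightarrow> z \<in> P0)"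
    and a: "\<And>i. 1 / 2 < a i" "\<And>i. a i < 1" "a \<longlonglongrightarrow> 1"
  shows "(\<lambda>i. \<integral>\<^sup>+z. indicator P z * ennreal ((1 - a i) / nrm z powr (DIM('a) + a i)) \<partial>lborel)
      \<longlonglongrightarrow> (\<integral>\<^sup>+z. indicator (punctured \<inter> P0) z * weight_limit z \<partial>lborel)" (is "?F \<longlonglongrightarrow> ?L")
    and "(\<integral>\<^sup>+z. indicator (punctured \<inter> P0) z * weight_limit z \<partial>lborel) < \<infinity>"
proof -
  let ?N = "DIM('a)"
  define k where "k = ?N - 1"
  let ?T = "\<lambda>i z. ennreal ((1 - a i) / nrm z powr (?N + a i))"
  let ?R = "\<lambda>i z. ennreal ((1 - a i) * norm (perp n z) ^ k / nrm z powr (?N + a i))"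
  let ?S = "\<lambda>i z. ennreal ((1 - a i) * (1 - norm (perp n z) ^ k) / nrm z powr (?N + a i))"
  define Q where "Q = P \<inter> ball 0 r"
  have [measurable]: "Q \<in> sets borel" "P - ball 0 r \<in> sets borel" unfolding Q_def by (auto intro: assms)
  have a0: "0 < a i" for i using a(1)[of i] by simp
  define C where "C = ennreal bound_const * (\<integral>\<^sup>+z. dominator M z \<partial>lborel)"
  have C: "C < \<infinity>" unfolding C_def using nn_integral_dominator[OF M] by (simp add: ennreal_mult_less_top)
  define G where "G i l z = indicator (punctured \<inter> aniso n l -` Q) z *
        ennreal (real k * norm (perp n z) ^ k /
          nrm (perp n z + (l * (z \<bullet> n)) *\<^sub>R n) powr (?N + a i))" for i l z
  have G_meas [measurable]: "G i l \<in> borel_measurable borel" for i l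
  proof -
    have [measurable]: "aniso n l -` Q \<in> sets borel"
      using measurable_sets[OF aniso_measurable' \<open>Q \<in> sets borel\<close>, of n l] by simp
    show ?thesis unfolding G_def by measurable
  qed
  have QM: "\<bar>z \<bullet> n\<bar> \<le> M * (norm (perp n z))\<^sup>2" if "aniso n l z \<in> Q" "0 < l" for l z
  proof -
    have "\<bar>aniso n l z \<bullet> n\<bar> \<le> M * (norm (perp n (aniso n l z)))\<^sup>2"
      using that by (intro thin) (auto simp: Q_def)
    then have "l\<^sup>2 * \<bar>z \<bullet> n\<bar> \<le> l\<^sup>2 * (M * (norm (perp n z))\<^sup>2)"
      by (simp add: aniso_simps[OF n] power_mult_distrib abs_mult mult_ac)
    then show ?thesis using that by simp
  qed
  have G_le: "G i l z \<le> ennreal bound_const * dominator M z" if "0 < l" for i l z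
    using kernel_le_dominator[OF _ QM[OF _ that] a0[of i] a(2)[of i], of z "l * (z \<bullet> n)"]
    by (cases "z \<in> punctured \<inter> aniso n l -` Q") (auto simp: G_def k_def)
  have G_int_le: "(\<integral>\<^sup>+z. G i l z \<partial>lborel) \<le> C" if "0 < l" for i l
  proof -
    have "(\<integral>\<^sup>+z. G i l z \<partial>lborel) \<le> (\<integral>\<^sup>+z. ennreal bound_const * dominator M z \<partial>lborel)"
      by (intro nn_integral_mono G_le that)
    then show ?thesis by (simp add: C_def nn_integral_cmult)
  qed
  \<comment> \<open>Stated for every null sequence of dilations: the outer limit uses it at each
    fixed t, and finiteness of the limit uses it for one explicit sequence.\<close>
  have inner: "(\<lambda>i. \<integral>\<^sup>+z. G i (l i) z \<partial>lborel) \<longlonglongrightarrow> ?L"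
    if l: "\<And>i. 0 < l i" "l \<longlonglongrightarrow> 0" for l
  proof (rule nn_integral_dominated_convergence[where w = "\<lambda>z. ennreal bound_const * dominator M z"])
    show "(\<integral>\<^sup>+z. ennreal bound_const * dominator M z \<partial>lborel) < \<infinity>"
      using C by (simp add: C_def nn_integral_cmult)
    show "AE z in lborel. G j (l j) z \<le> ennreal bound_const * dominator M z" for j
      using G_le[OF l(1)] by auto
    show "AE z in lborel. (\<lambda>i. G i (l i) z) \<longlonglongrightarrow> indicator (punctured \<inter> P0) z * weight_limit z"
      using blowup
    proof eventually_elim
      case (elim z)
      have lr: "filterlim l (at_right 0) sequentially"
        using l by (intro tendsto_imp_filterlim_at_right) auto
      show ?case
      proof (cases "z \<in> punctured")
        case True
        define y where "y = perp n z"
        have y0: "0 < norm y" using True by (auto simp: punctured_def y_def)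
        have ny: "0 < nrm y"
        proof -
          have "0 < c0 * norm y" using y0 c0 by simp
          then show ?thesis using nrm_lower[of y] by linarith
        qed
        have "(\<lambda>i. aniso n (l i) z) \<longlonglongrightarrow> 0 *\<^sub>R perp n z + (0\<^sup>2 * (z \<bullet> n)) *\<^sub>R n"
          unfolding aniso_def by (intro tendsto_intros l)
        then have "(\<lambda>i. norm (aniso n (l i) z)) \<longlonglongrightarrow> 0" by (simp add: tendsto_norm_zero)
        then have "\<forall>\<^sub>F i in sequentially. norm (aniso n (l i) z) < r"
          using r by (intro order_tendstoD(2))
        moreover have "\<forall>\<^sub>F i in sequentially. aniso n (l i) z \<in> P \<longleftrightarrow> z \<in> P0"
          using elim True lr by (auto simp: filterlim_iff)
        ultimately have ev: "\<forall>\<^sub>F i in sequentially. aniso n (l i) z \<in> Q \<longleftrightarrow> z \<in> P0"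
          by eventually_elim (auto simp: Q_def)
        have "(\<lambda>i. y + (l i * (z \<bullet> n)) *\<^sub>R n) \<longlonglongrightarrow> y + (0 * (z \<bullet> n)) *\<^sub>R n"
          by (intro tendsto_intros l)
        then have "(\<lambda>i. nrm (y + (l i * (z \<bullet> n)) *\<^sub>R n)) \<longlonglongrightarrow> nrm y"
          using nrm_cont by (intro isCont_tendsto_compose[where g = nrm]) (auto simp: continuous_on_eq_continuous_at)
        moreover have "(\<lambda>i. real ?N + a i) \<longlonglongrightarrow> real ?N + 1" by (intro tendsto_intros a)
        ultimately have "(\<lambda>i. nrm (y + (l i * (z \<bullet> n)) *\<^sub>R n) powr (?N + a i)) \<longlonglongrightarrow> nrm y powr (real ?N + 1)"
          using ny by (intro tendsto_powr) auto
        then have lim: "(\<lambda>i. ennreal (real k * norm y ^ k / nrm (y + (l i * (z \<bullet> n)) *\<^sub>R n) powr (?N + a i)))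
            \<longlonglongrightarrow> ennreal (real k * norm y ^ k / nrm y powr (real ?N + 1))"
          using ny by (intro tendsto_ennrealI tendsto_divide tendsto_const) auto
        show ?thesis
        proof (cases "z \<in> P0")
          case P0: True
          have "\<forall>\<^sub>F i in sequentially. ennreal (real k * norm y ^ k / nrm (y + (l i * (z \<bullet> n)) *\<^sub>R n) powr (?N + a i)) = G i (l i) z"
            using ev by eventually_elim (use True P0 in \<open>simp add: G_def y_def\<close>)
          from Lim_transform_eventually[OF lim this] show ?thesis
            using True P0 by (simp add: weight_limit_def k_def y_def)
        next
          case False
          have "\<forall>\<^sub>F i in sequentially. 0 = G i (l i) z"
            using ev by eventually_elim (use False in \<open>simp add: G_def\<close>)
          from Lim_transform_eventually[OF tendsto_const this] show ?thesis
            using False by simp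
        qed
      qed (simp add: G_def)
    qed
  qed measurable
  define l where "l i t = t powr (1 / (1 - a i))" for i t
  have outer: "(\<lambda>i. \<integral>\<^sup>+t. indicator {0<..<1} t * (\<integral>\<^sup>+z. G i (l i t) z \<partial>lborel) \<partial>lborel)
      \<longlonglongrightarrow> (\<integral>\<^sup>+t. indicator {0<..<1::real} t * ?L \<partial>lborel)"
  proof (rule nn_integral_dominated_convergence[where w = "\<lambda>t. indicator {0<..<1} t * C"])
    show "(\<integral>\<^sup>+t. indicator {0<..<1::real} t * C \<partial>lborel) < \<infinity>"
      using C by (simp add: nn_integral_multc)
    show "AE t in lborel. indicator {0<..<1} t * (\<integral>\<^sup>+z. G j (l j t) z \<partial>lborel) \<le> indicator {0<..<1} t * C" for j
      using G_int_le by (auto simp: l_def indicator_def)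
    show "AE t in lborel. (\<lambda>i. indicator {0<..<1} t * (\<integral>\<^sup>+z. G i (l i t) z \<partial>lborel))
        \<longlonglongrightarrow> indicator {0<..<1} t * ?L"
    proof (rule AE_I2)
      fix t :: real
      show "(\<lambda>i. indicator {0<..<1} t * (\<integral>\<^sup>+z. G i (l i t) z \<partial>lborel)) \<longlonglongrightarrow> indicator {0<..<1} t * ?L"
      proof (cases "0 < t \<and> t < 1")
        case True
        then have "(\<lambda>i. \<integral>\<^sup>+z. G i (l i t) z \<partial>lborel) \<longlonglongrightarrow> ?L"
          using powr_at_left_1_tendsto_0[of t a] a by (intro inner) (auto simp: l_def)
        then show ?thesis using True by simp
      qed (auto simp: indicator_def)
    qed
    have [measurable]: "(\<lambda>(t, z). G i (l i t) z) \<in> borel_measurable (borel \<Otimes>\<^sub>M borel)" for i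
    proof -
      have "(\<lambda>(t, z). aniso n (l i t) z) \<in> borel \<Otimes>\<^sub>M borel \<rightarrow>\<^sub>M borel"
        unfolding aniso_def l_def by measurable
      then have [measurable]: "(\<lambda>p. aniso n (l i (fst p)) (snd p)) \<in> borel \<Otimes>\<^sub>M borel \<rightarrow>\<^sub>M borel"
        by (simp add: case_prod_beta')
      have "(\<lambda>(t, z). G i (l i t) z) = (\<lambda>p. indicator punctured (snd p) * indicator Q (aniso n (l i (fst p)) (snd p)) *
        ennreal (real k * norm (perp n (snd p)) ^ k /
          nrm (perp n (snd p) + (l i (fst p) * (snd p \<bullet> n)) *\<^sub>R n) powr (?N + a i)))"
        by (auto simp: G_def indicator_def fun_eq_iff)
      also have "\<dots> \<in> borel_measurable (borel \<Otimes>\<^sub>M borel)"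
        unfolding l_def by measurable
      finally show ?thesis .
    qed
    show "(\<lambda>t. indicator {0<..<1} t * (\<integral>\<^sup>+z. G i (l i t) z \<partial>lborel)) \<in> borel_measurable lborel" for i
      by measurable
  qed measurable
  have main_eq: "(\<integral>\<^sup>+z. indicator (punctured \<inter> Q) z * ?S i z \<partial>lborel) = (\<integral>\<^sup>+t. indicator {0<..<1} t * (\<integral>\<^sup>+z. G i (l i t) z \<partial>lborel) \<partial>lborel)" for i
    unfolding G_def l_def k_def using a0[of i] a(2)[of i] by (intro averaging) auto
  define far where "far i = (\<integral>\<^sup>+z. indicator (P - ball 0 r) z * ?T i z \<partial>lborel)" for i
  define rem where "rem i = (\<integral>\<^sup>+z. indicator (punctured \<inter> Q) z *
      ?R i z \<partial>lborel)" for i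
  define main where "main i = (\<integral>\<^sup>+z. indicator (punctured \<inter> Q) z *
      ?S i z \<partial>lborel)" for i
  have split: "?F i = far i + rem i + main i" for i
  proof -
    have "indicator P z * ?T i z =
        indicator (P - ball 0 r) z * ?T i z +
        indicator (punctured \<inter> Q) z * ?R i z +
        indicator (punctured \<inter> Q) z * ?S i z" for z
    proof (cases "z \<in> Q")
      case True
      have y1: "norm (perp n z) < 1"
        using norm_perp_le[OF n, of z] True r by (simp add: Q_def)
      show ?thesis
      proof (cases "perp n z = 0")
        \<comment> \<open>On the axis thinness leaves only the origin, where both sides vanish:
          \<open>0 powr _\<close> is 0 and so is the quotient by it.\<close>
        case y0: True
        then have "z \<bullet> n = 0" using thin[of z] True by (simp add: Q_def)
        then have "z = 0" using perp_split[of z n] y0 by simp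
        then show ?thesis using nrm_hom[of 0 0] by (simp add: punctured_def perp_def)
      next
        case False
        then have pz: "z \<in> punctured" using y1 by (simp add: punctured_def)
        have pk: "norm (perp n z) ^ k \<le> 1" using y1 by (intro power_le_one) auto
        have "(1 - a i) / nrm z powr (?N + a i) = (1 - a i) * norm (perp n z) ^ k / nrm z powr (?N + a i) +
          (1 - a i) * (1 - norm (perp n z) ^ k) / nrm z powr (?N + a i)"
          by (simp add: add_divide_distrib[symmetric] algebra_simps)
        then have "?T i z =
          ?R i z +
          ?S i z"
          using a(2)[of i] pk by (subst ennreal_plus[symmetric]) auto
        then show ?thesis using True pz by (simp add: Q_def)
      qed
    next
      case False
      then show ?thesis by (auto simp: Q_def indicator_def)
    qed
    note point = this
    have add3: "(\<integral>\<^sup>+z. f z + g z + h z \<partial>lborel) =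
        (\<integral>\<^sup>+z. f z \<partial>lborel) + (\<integral>\<^sup>+z. g z \<partial>lborel) + (\<integral>\<^sup>+z. h z \<partial>lborel)"
      if [measurable]: "f \<in> borel_measurable borel" "g \<in> borel_measurable borel" "h \<in> borel_measurable borel"
      for f g h :: "'a \<Rightarrow> ennreal"
      by (simp add: nn_integral_add)
    show ?thesis unfolding far_def rem_def main_def point by (rule add3; measurable)
  qed
  have "(\<lambda>i. 1 - a i) \<longlonglongrightarrow> 1 - 1" by (intro tendsto_intros a)
  then have a_lim: "(\<lambda>i. ennreal (1 - a i)) \<longlonglongrightarrow> 0" using tendsto_ennrealI by fastforce
  have zero: "f \<longlonglongrightarrow> 0" if "\<And>i. f i \<le> D * ennreal (1 - a i)" "D < \<infinity>" for f D
  proof (rule tendsto_sandwich[OF _ _ tendsto_const])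
    show "(\<lambda>i. D * ennreal (1 - a i)) \<longlonglongrightarrow> 0"
      using ennreal_tendsto_cmult[OF _ a_lim, of D] that by simp
  qed (use that in auto)
  have far0: "far \<longlonglongrightarrow> 0"
  proof (rule zero)
    \<comment> \<open>Since a i > 1/2, the decay exponent N + a i may be lowered to N + 1/2 outside
      the ball. The excess power of |z| is at least r powr (a i - 1/2), hence at least r powr (1/2)
      because r is at most 1; c0 converts \<open>nrm\<close> into the Euclidean norm.\<close>
    define K where "K = r powr (- (1/2)) / c0 ^ (?N + 1)"
    have K: "0 \<le> K" using r c0 by (simp add: K_def)
    let ?I = "\<integral>\<^sup>+z. indicator (- ball (0::'a) r) z * ennreal (1 / norm z powr (?N + 1/2)) \<partial>lborel"
    show "ennreal K * ?I < \<infinity>" using nn_integral_far_finite[where 'a = 'a, OF r(1), of "1/2"] by (simp add: ennreal_mult_less_top)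
    fix i
    have "far i \<le> (\<integral>\<^sup>+z. (ennreal (1 - a i) * ennreal K) * (indicator (- ball (0::'a) r) z * ennreal (1 / norm z powr (?N + 1/2))) \<partial>lborel)"
      unfolding far_def
    proof (rule nn_integral_mono)
      fix z :: 'a
      show "indicator (P - ball 0 r) z * ?T i z \<le>
        (ennreal (1 - a i) * ennreal K) * (indicator (- ball (0::'a) r) z * ennreal (1 / norm z powr (?N + 1/2)))"
      proof (cases "z \<in> P - ball 0 r")
        case True
        then have z: "r \<le> norm z" by simp
        have z0: "0 < norm z" using z r by linarith
        have cz: "0 < c0 * norm z" using z0 c0 by simp
        have "c0 ^ (?N + 1) * (r powr (1/2) * norm z powr (?N + 1/2)) \<le> nrm z powr (?N + a i)"
        proof -
          have "c0 ^ (?N + 1) = c0 powr (real (?N + 1))" using c0 by (simp only: powr_realpow)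
          also have "\<dots> \<le> c0 powr (?N + a i)" using c0 a(2)[of i] by (intro powr_mono') auto
          finally have 1: "c0 ^ (?N + 1) \<le> c0 powr (?N + a i)" .
          have "r powr (1/2) \<le> r powr (a i - 1/2)" using r a(1,2)[of i] by (intro powr_mono') auto
          also have "\<dots> \<le> norm z powr (a i - 1/2)" using z r a(1)[of i] by (intro powr_mono2) auto
          finally have "r powr (1/2) * norm z powr (?N + 1/2) \<le> norm z powr (a i - 1/2) * norm z powr (?N + 1/2)"
            by (intro mult_right_mono) auto
          also have "\<dots> = norm z powr (?N + a i)" by (simp add: powr_add[symmetric] add.commute)
          finally have "c0 ^ (?N + 1) * (r powr (1/2) * norm z powr (?N + 1/2)) \<le> c0 powr (?N + a i) * norm z powr (?N + a i)"
            using 1 c0 by (intro mult_mono) auto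
          also have "\<dots> = (c0 * norm z) powr (?N + a i)" using c0 by (simp add: powr_mult)
          also have "\<dots> \<le> nrm z powr (?N + a i)" using cz a0[of i] nrm_lower by (intro powr_mono2) auto
          finally show ?thesis .
        qed
        then have "(1 - a i) / nrm z powr (?N + a i) \<le> (1 - a i) / (c0 ^ (?N + 1) * (r powr (1/2) * norm z powr (?N + 1/2)))"
          using a(2)[of i] c0 r z0 by (intro frac_le) auto
        also have "\<dots> = ((1 - a i) * K) * (1 / norm z powr (?N + 1/2))"
        proof -
          have "x / (A * (B * D)) = (x * ((1 / B) / A)) * (1 / D)" for x A B D :: real
            by (simp add: mult_ac)
          then show ?thesis unfolding K_def powr_minus_divide .
        qed
        finally have "?T i z \<le> ennreal (((1 - a i) * K) * (1 / norm z powr (?N + 1/2)))"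
          by (rule ennreal_leI)
        also have "\<dots> = (ennreal (1 - a i) * ennreal K) * ennreal (1 / norm z powr (?N + 1/2))"
          using a(2)[of i] K by (simp add: ennreal_mult'[symmetric])
        finally show ?thesis using True by simp
      next
        case False
        then have "indicator (P - ball 0 r) z = (0 :: ennreal)" by (rule indicator_simps)
        then show ?thesis by (simp only: mult_zero_left zero_le)
      qed
    qed
    also have "\<dots> = (ennreal (1 - a i) * ennreal K) * ?I" by (rule nn_integral_cmult) measurable
    finally show "far i \<le> ennreal K * ?I * ennreal (1 - a i)" by (simp only: mult_ac)
  qed
  have rem0: "rem \<longlonglongrightarrow> 0"
  proof (rule zero)
    show "C < \<infinity>" by fact
    fix i
    have "rem i \<le> (\<integral>\<^sup>+z. ennreal (1 - a i) * (ennreal bound_const * dominator M z) \<partial>lborel)"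
      unfolding rem_def
    proof (rule nn_integral_mono)
      fix z :: 'a
      show "indicator (punctured \<inter> Q) z * ?R i z
          \<le> ennreal (1 - a i) * (ennreal bound_const * dominator M z)"
      proof (cases "z \<in> punctured \<inter> Q")
        case True
        have k1: "1 \<le> real k" using dim by (simp add: k_def)
        have "(1 - a i) * norm (perp n z) ^ k / nrm z powr (?N + a i)
            \<le> (1 - a i) * (real k * norm (perp n z) ^ k / nrm z powr (?N + a i))"
        proof -
          have "1 * (norm (perp n z) ^ k / nrm z powr (?N + a i)) \<le> real k * (norm (perp n z) ^ k / nrm z powr (?N + a i))"
            using k1 by (intro mult_right_mono) auto
          then have "(1 - a i) * (norm (perp n z) ^ k / nrm z powr (?N + a i)) \<le> (1 - a i) * (real k * (norm (perp n z) ^ k / nrm z powr (?N + a i)))"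
            using a(2)[of i] by (intro mult_left_mono) auto
          then show ?thesis by simp
        qed
        then have "?R i z
            \<le> ennreal (1 - a i) * ennreal (real k * norm (perp n z) ^ k / nrm z powr (?N + a i))"
          using a(2)[of i] by (subst ennreal_mult'[symmetric]) (auto intro: ennreal_leI)
        also have "\<dots> \<le> ennreal (1 - a i) * (ennreal bound_const * dominator M z)"
        proof (rule mult_left_mono)
          have "\<bar>z \<bullet> n\<bar> \<le> M * (norm (perp n z))\<^sup>2" using True by (intro thin) (auto simp: Q_def)
          then have "ennreal (real k * norm (perp n z) ^ k /
              nrm (perp n z + (z \<bullet> n) *\<^sub>R n) powr (?N + a i)) \<le> ennreal bound_const * dominator M z"
            using True unfolding k_def by (intro kernel_le_dominator a0 a(2)) auto
          moreover have "perp n z + (z \<bullet> n) *\<^sub>R n = z" by (rule perp_split[symmetric])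
          ultimately show "ennreal (real k * norm (perp n z) ^ k / nrm z powr (?N + a i)) \<le> ennreal bound_const * dominator M z"
            by (simp only:)
        qed simp
        finally show ?thesis using True by simp
      qed simp
    qed
    also have "\<dots> = ennreal (1 - a i) * C"
      unfolding C_def by (simp add: nn_integral_cmult)
    finally show "rem i \<le> C * ennreal (1 - a i)" by (simp only: mult.commute)
  qed
  have "(\<integral>\<^sup>+t. indicator {0<..<1::real} t * ?L \<partial>lborel) = ?L"
    by (subst nn_integral_multc) simp_all
  then have "(\<lambda>i. main i) \<longlonglongrightarrow> ?L"
    using outer unfolding main_def main_eq by (simp only:)
  then have "(\<lambda>i. far i + rem i + main i) \<longlonglongrightarrow> 0 + 0 + ?L"
    using far0 rem0 by (intro tendsto_add)
  then show "?F \<longlonglongrightarrow> ?L" unfolding split by simp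
  \<comment> \<open>Any positive null sequence serves here: the limit of integrals bounded by C is
    bounded by C.\<close>
  have "(\<lambda>i. 1 / real (i + 2)) \<longlonglongrightarrow> 0"
    using LIMSEQ_ignore_initial_segment[OF lim_1_over_n, of 2] by simp
  then have "(\<lambda>i. \<integral>\<^sup>+z. G i (1 / real (i + 2)) z \<partial>lborel) \<longlonglongrightarrow> ?L"
    by (intro inner) simp_all
  moreover have "\<forall>\<^sub>F i in sequentially. (\<integral>\<^sup>+z. G i (1 / real (i + 2)) z \<partial>lborel) \<le> C"
    by (intro always_eventually allI G_int_le) simp
  ultimately have "?L \<le> C"
    by (rule tendsto_upperbound) simp
  then show "?L < \<infinity>" using C by (rule le_less_trans)
qed

end

subsection \<open>Second-order expansion and the limit integrals\<close>

lemma is_norm_properties: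
  fixes nrm :: "'a::euclidean_space \<Rightarrow> real"
  assumes "is_norm nrm"
  shows "continuous_on UNIV nrm" "\<exists>c>0. c \<le> 1 \<and> (\<forall>x. c * norm x \<le> nrm x)"
proof -
  have nonneg: "0 \<le> nrm x" and zero: "nrm x = 0 \<longleftrightarrow> x = 0" and hom: "nrm (c *\<^sub>R x) = \<bar>c\<bar> * nrm x"
    and tri: "nrm (x + y) \<le> nrm x + nrm y" for x y c
    using assms by (auto simp: is_norm_def)
  define C where "C = (\<Sum>b\<in>Basis. nrm b)"
  have C: "0 \<le> C" unfolding C_def by (intro sum_nonneg nonneg)
  have sum: "nrm (\<Sum>b\<in>B. f b) \<le> (\<Sum>b\<in>B. nrm (f b))" if "finite B" for B and f :: "'a \<Rightarrow> 'a"
    using that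
  proof induction
    case empty
    then show ?case using zero[of 0] by simp
  next
    case (insert b B)
    then show ?case using tri[of "f b" "\<Sum>b\<in>B. f b"] by simp
  qed
  have upper: "nrm x \<le> C * norm x" for x
  proof -
    have "nrm x = nrm (\<Sum>b\<in>Basis. (x \<bullet> b) *\<^sub>R b)" by (simp add: euclidean_representation)
    also have "\<dots> \<le> (\<Sum>b\<in>Basis. nrm ((x \<bullet> b) *\<^sub>R b))" by (rule sum) simp
    also have "\<dots> \<le> (\<Sum>b\<in>Basis. norm x * nrm b)"
      unfolding hom by (intro sum_mono mult_right_mono nonneg Basis_le_norm)
    finally show ?thesis by (simp add: C_def sum_distrib_left mult.commute)
  qed
  have diff: "\<bar>nrm x - nrm y\<bar> \<le> C * norm (x - y)" for x y
  proof -
    have "nrm x \<le> nrm (x - y) + nrm y" "nrm y \<le> nrm (y - x) + nrm x"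
      using tri[of "x - y" y] tri[of "y - x" x] by simp_all
    then show ?thesis using upper[of "x - y"] upper[of "y - x"] by (simp add: norm_minus_commute)
  qed
  have "C-lipschitz_on UNIV nrm"
    using diff C by (intro lipschitz_onI) (auto simp: dist_norm)
  then show cont: "continuous_on UNIV nrm" by (rule lipschitz_on_continuous_on)
  have ne: "sphere (0::'a) 1 \<noteq> {}" by simp
  obtain \<xi> where \<xi>: "\<xi> \<in> sphere 0 1" "\<And>y. y \<in> sphere 0 1 \<Longrightarrow> nrm \<xi> \<le> nrm y"
    using continuous_attains_inf[OF compact_sphere ne continuous_on_subset[OF cont subset_UNIV]] by auto
  define c where "c = min 1 (nrm \<xi>)"
  have "\<xi> \<noteq> 0" using \<xi> by auto
  then have "0 < nrm \<xi>" using nonneg[of \<xi>] zero[of \<xi>] by linarith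
  then have "0 < c" by (simp add: c_def)
  moreover have "c \<le> 1" by (simp add: c_def)
  moreover have "c * norm x \<le> nrm x" for x
  proof (cases "x = 0")
    case False
    then have "nrm \<xi> \<le> nrm ((1 / norm x) *\<^sub>R x)" by (intro \<xi>(2)) simp
    then have "nrm \<xi> * norm x \<le> nrm x" using False by (simp add: hom field_simps)
    moreover have "c * norm x \<le> nrm \<xi> * norm x" by (intro mult_right_mono) (auto simp: c_def)
    ultimately show ?thesis by linarith
  qed (simp add: nonneg)
  ultimately show "\<exists>c>0. c \<le> 1 \<and> (\<forall>x. c * norm x \<le> nrm x)" by blast
qed

text \<open>The mean value theorem on the segment from x to x + z, applied to u minus its quadratic
  model, expresses the remainder as the error of the linear approximation of g at one point of the
  segment, paired with z. Differentiability of g at x makes this o(|z|^2).\<close>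

lemma second_order_Taylor:
  fixes u :: "'a::real_inner \<Rightarrow> real" and g :: "'a \<Rightarrow> 'a"
  assumes g: "\<And>y. GDERIV u y :> g y" and A: "(g has_derivative A) (at x)"
  shows "((\<lambda>z. (u (x + z) - u x - g x \<bullet> z - (z \<bullet> A z) / 2) / (norm z)\<^sup>2) \<longlongrightarrow> 0) (at 0)"
proof (rule LIM_I)
  fix e :: real assume e: "0 < e"
  interpret A: bounded_linear A using A by (rule has_derivative_bounded_linear)
  obtain d where d: "0 < d" "\<And>y. norm (y - x) < d \<Longrightarrow> norm (g y - g x - A (y - x)) \<le> e / 2 * norm (y - x)"
    using A e unfolding has_derivative_at_alt by (meson half_gt_zero)
  show "\<exists>d>0. \<forall>z. z \<noteq> 0 \<and> norm (z - 0) < d \<longrightarrow>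
      norm ((u (x + z) - u x - g x \<bullet> z - (z \<bullet> A z) / 2) / (norm z)\<^sup>2 - 0) < e"
  proof (intro exI conjI allI impI)
    fix z :: 'a assume z: "z \<noteq> 0 \<and> norm (z - 0) < d"
    define \<phi> where "\<phi> t = u (x + t *\<^sub>R z) - t * (g x \<bullet> z) - t\<^sup>2 / 2 * (z \<bullet> A z)" for t
    define \<psi> where "\<psi> t = g (x + t *\<^sub>R z) \<bullet> z - g x \<bullet> z - t * (z \<bullet> A z)" for t
    have der: "(\<phi> has_real_derivative \<psi> t) (at t)" for t
    proof -
      have "((\<lambda>t. x + t *\<^sub>R z) has_derivative (\<lambda>h. h *\<^sub>R z)) (at t)"
        by (auto intro!: derivative_eq_intros)
      then have "((\<lambda>t. u (x + t *\<^sub>R z)) has_derivative (\<lambda>h. (h *\<^sub>R z) \<bullet> g (x + t *\<^sub>R z))) (at t)"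
        using g[of "x + t *\<^sub>R z", unfolded gderiv_def] by (rule has_derivative_compose)
      then have "((\<lambda>t. u (x + t *\<^sub>R z)) has_real_derivative g (x + t *\<^sub>R z) \<bullet> z) (at t)"
        unfolding has_field_derivative_def by (rule has_derivative_eq_rhs) (simp add: inner_commute fun_eq_iff)
      then show ?thesis unfolding \<phi>_def \<psi>_def
        by (auto intro!: derivative_eq_intros simp: field_simps)
    qed
    obtain t where t: "0 < t" "t < 1" "\<phi> 1 - \<phi> 0 = (1 - 0) * \<psi> t"
      using MVT2[of 0 1 \<phi> \<psi>] der by auto
    have "\<psi> t = (g (x + t *\<^sub>R z) - g x - A (t *\<^sub>R z)) \<bullet> z"
      by (simp add: \<psi>_def inner_diff_left inner_diff_right A.scaleR inner_commute)
    then have "\<bar>\<psi> t\<bar> \<le> norm (g (x + t *\<^sub>R z) - g x - A (t *\<^sub>R z)) * norm z"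
      using Cauchy_Schwarz_ineq2 by metis
    also have "\<dots> \<le> (e / 2 * norm (t *\<^sub>R z)) * norm z"
    proof (rule mult_right_mono)
      have "norm (t *\<^sub>R z) \<le> 1 * norm z" using t unfolding norm_scaleR by (intro mult_right_mono) auto
      also have "\<dots> < d" using z by simp
      finally have "norm (t *\<^sub>R z) < d" .
      then show "norm (g (x + t *\<^sub>R z) - g x - A (t *\<^sub>R z)) \<le> e / 2 * norm (t *\<^sub>R z)"
        using d(2)[of "x + t *\<^sub>R z"] by simp
    qed simp
    also have "\<dots> \<le> (e / 2 * norm z) * norm z"
      using t e unfolding norm_scaleR by (intro mult_right_mono mult_left_mono) (auto intro: mult_left_le_one_le)
    finally have "\<bar>\<psi> t\<bar> \<le> e / 2 * (norm z)\<^sup>2" by (simp add: power2_eq_square)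
    moreover have "u (x + z) - u x - g x \<bullet> z - (z \<bullet> A z) / 2 = \<psi> t"
      using t(3) by (simp add: \<phi>_def A.zero)
    ultimately have "\<bar>u (x + z) - u x - g x \<bullet> z - (z \<bullet> A z) / 2\<bar> / (norm z)\<^sup>2 \<le> e / 2"
      using z by (simp add: field_simps)
    also have "\<dots> < e" using e by simp
    finally show "norm ((u (x + z) - u x - g x \<bullet> z - (z \<bullet> A z) / 2) / (norm z)\<^sup>2 - 0) < e"
      by (simp add: abs_divide)
  qed (rule d)
qed

context anisotropic_norm
begin

text \<open>On the limiting paraboloid the blow-up limit is 0 and decides no sign, so this set has
  to be negligible: every line parallel to n meets the graph in a single point.\<close>

lemma graph_null:
  fixes h :: "'a \<Rightarrow> real"
  assumes [measurable]: "h \<in> borel_measurable borel"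
  shows "AE z in lborel. z \<bullet> n \<noteq> h (perp n z)"
proof -
  let ?E = "{z \<in> space borel. z \<bullet> n = h (perp n z)}"
  have E: "?E \<in> sets borel" by measurable
  have "emeasure lborel ?E = (\<integral>\<^sup>+z. indicator ?E z \<partial>lborel)" using E by simp
  also have "\<dots> = (\<integral>\<^sup>+z. indicator {0<..<1} (z \<bullet> n) * (\<integral>\<^sup>+s. indicator ?E (perp n z + s *\<^sub>R n) \<partial>lborel) \<partial>lborel)"
    using E by (intro nn_integral_direction n borel_measurable_indicator) simp
  also have "\<dots> = (\<integral>\<^sup>+z. indicator {0<..<1} (z \<bullet> n) * emeasure lborel {h (perp n z)} \<partial>lborel)"
  proof (rule nn_integral_cong)
    fix z :: 'a
    have "indicator ?E (perp n z + s *\<^sub>R n) = (indicator {h (perp n z)} s :: ennreal)" for s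
      using perp_simps[OF n] perp_inner[OF n] by (simp add: indicator_def)
    then show "indicator {0<..<1} (z \<bullet> n) * (\<integral>\<^sup>+s. indicator ?E (perp n z + s *\<^sub>R n) \<partial>lborel) =
        indicator {0<..<1} (z \<bullet> n) * emeasure lborel {h (perp n z)}" by simp
  qed
  also have "\<dots> = 0" by simp
  finally have "?E \<in> null_sets lborel" using E by (simp add: null_sets_def)
  then have "AE z in lborel. z \<notin> ?E" by (rule AE_not_in)
  then show ?thesis by eventually_elim simp
qed

text \<open>The weight is constant along n, so each fibre contributes its length. Since
  \<open>ennreal\<close> sends negative numbers to 0, \<open>ennreal (h y)\<close> and
  \<open>ennreal (- h y)\<close> are the lengths of the two fibres whatever the sign of
  \<open>h y\<close>; they are the positive and negative parts of h.\<close>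

lemma nn_integral_between:
  fixes h :: "'a \<Rightarrow> real" and w :: "'a \<Rightarrow> ennreal"
  assumes [measurable]: "h \<in> borel_measurable borel" "w \<in> borel_measurable borel"
    and w: "\<And>z. w z = w (perp n z)"
  shows "(\<integral>\<^sup>+z. indicator (punctured \<inter> {z. z \<bullet> n + h (perp n z) > 0 \<and> z \<bullet> n \<le> 0}) z * w z \<partial>lborel)
      = (\<integral>\<^sup>+z. indicator (slab n) z * (w z * ennreal (h (perp n z))) \<partial>lborel)" (is ?A)
    and "(\<integral>\<^sup>+z. indicator (punctured \<inter> {z. z \<bullet> n + h (perp n z) < 0 \<and> z \<bullet> n > 0}) z * w z \<partial>lborel)
      = (\<integral>\<^sup>+z. indicator (slab n) z * (w z * ennreal (- h (perp n z))) \<partial>lborel)" (is ?B)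
proof -
  have gen: "(\<integral>\<^sup>+z. indicator (punctured \<inter> {z. z \<bullet> n \<in> I (perp n z)}) z * w z \<partial>lborel)
      = (\<integral>\<^sup>+z. indicator (slab n) z * (w z * emeasure lborel (I (perp n z))) \<partial>lborel)"
    if m: "{z. z \<bullet> n \<in> I (perp n z)} \<in> sets borel" and I: "\<And>z. I z \<in> sets borel" for I
  proof -
    let ?E = "punctured \<inter> {z. z \<bullet> n \<in> I (perp n z)}"
    have [measurable]: "?E \<in> sets borel" using m by auto
    have "(\<integral>\<^sup>+z. indicator ?E z * w z \<partial>lborel) =
      (\<integral>\<^sup>+z. indicator {0<..<1} (z \<bullet> n) * (\<integral>\<^sup>+s. indicator ?E (perp n z + s *\<^sub>R n) * w (perp n z + s *\<^sub>R n) \<partial>lborel) \<partial>lborel)"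
      by (rule nn_integral_direction[OF _ n]) measurable
    also have "\<dots> = (\<integral>\<^sup>+z. indicator (slab n) z * (w z * emeasure lborel (I (perp n z))) \<partial>lborel)"
    proof (rule nn_integral_cong)
      fix z :: 'a
      define y where "y = perp n z"
      have yn: "perp n (y + s *\<^sub>R n) = y" "(y + s *\<^sub>R n) \<bullet> n = s" for s
        using perp_simps[OF n] perp_inner[OF n] by (auto simp: y_def)
      have wy: "w (y + s *\<^sub>R n) = w z" for s using w[of z] w[of "y + s *\<^sub>R n"] by (simp add: yn y_def[symmetric])
      have "indicator ?E (y + s *\<^sub>R n) * w (y + s *\<^sub>R n) = (indicator punctured z * w z) * indicator (I y) s" for s
        unfolding wy by (simp add: indicator_def punctured_def yn y_def[symmetric])
      then have "(\<integral>\<^sup>+s. indicator ?E (y + s *\<^sub>R n) * w (y + s *\<^sub>R n) \<partial>lborel) = (indicator punctured z * w z) * emeasure lborel (I y)"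
        using I by (simp add: nn_integral_cmult)
      moreover have "indicator (slab n) z = (indicator {0<..<1} (z \<bullet> n) * indicator punctured z :: ennreal)"
        by (auto simp: slab_def punctured_def indicator_def)
      ultimately show "indicator {0<..<1} (z \<bullet> n) * (\<integral>\<^sup>+s. indicator ?E (perp n z + s *\<^sub>R n) * w (perp n z + s *\<^sub>R n) \<partial>lborel) =
        indicator (slab n) z * (w z * emeasure lborel (I (perp n z)))"
        by (simp add: y_def mult_ac)
    qed
    finally show ?thesis .
  qed
  have "emeasure lborel {- c<..0} = ennreal c" for c :: real
    by (cases "0 \<le> c") (auto simp: ennreal_neg)
  moreover have "{z. z \<bullet> n \<in> {- h (perp n z)<..0}} \<in> sets borel"
    unfolding greaterThanAtMost_iff greaterThanLessThan_iff by measurable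
  moreover have "{z. z \<bullet> n + h (perp n z) > 0 \<and> z \<bullet> n \<le> 0} = {z. z \<bullet> n \<in> {- h (perp n z)<..0}}"
    by auto
  ultimately show ?A using gen[of "\<lambda>y. {- h y<..0}"] by simp
  have "emeasure lborel {0<..<- c} = ennreal (- c)" for c :: real
    by (cases "c \<le> 0") (auto simp: ennreal_neg)
  moreover have "{z. z \<bullet> n \<in> {0<..<- h (perp n z)}} \<in> sets borel"
    unfolding greaterThanAtMost_iff greaterThanLessThan_iff by measurable
  moreover have "{z. z \<bullet> n + h (perp n z) < 0 \<and> z \<bullet> n > 0} = {z. z \<bullet> n \<in> {0<..<- h (perp n z)}}"
    by auto
  ultimately show ?B using gen[of "\<lambda>y. {0<..<- h y}"] by simp
qed

lemma integral_cone_measure: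
  fixes F :: "'a \<Rightarrow> real"
  assumes [measurable]: "F \<in> borel_measurable borel"
  shows "integral\<^sup>L (cone_measure n) F =
    (LINT z|lborel. real (DIM('a) - 1) * indicator (slab n) z * F (perp_dir n z))"
proof -
  have "cone_measure n = distr (density lborel (\<lambda>z. ennreal (real (DIM('a) - 1) * indicator (slab n) z))) borel (perp_dir n)"
    by (simp add: cone_measure_def ennreal_mult' ennreal_indicator)
  then have "integral\<^sup>L (cone_measure n) F =
      (LINT z|density lborel (\<lambda>z. ennreal (real (DIM('a) - 1) * indicator (slab n) z)). F (perp_dir n z))"
    by (simp add: integral_distr)
  also have "\<dots> = (LINT z|lborel. (real (DIM('a) - 1) * indicator (slab n) z) *\<^sub>R F (perp_dir n z))"
    by (rule integral_density) auto
  finally show ?thesis by simp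
qed

end

text \<open>The two measures are compared only on Borel subsets of the sphere, hence the passage
  through restricted spaces.\<close>

lemma set_integral_hausdorff_eq_cone_measure:
  fixes n :: "'a::euclidean_space" and f :: "'a \<Rightarrow> 'b::{banach, second_countable_topology}"
  assumes n: "norm n = 1" and m: "m + 2 = DIM('a)"
  shows "(LINT \<theta>:hsphere n|hausdorff_measure m. f \<theta>) = (LINT \<theta>:hsphere n|cone_measure n. f \<theta>)"
proof -
  have "restrict_space (hausdorff_measure m) (hsphere n) = restrict_space (cone_measure n) (hsphere n)"
  proof (rule measure_eqI)
    show "sets (restrict_space (hausdorff_measure m) (hsphere n)) = sets (restrict_space (cone_measure n) (hsphere n))"
      by (simp add: sets_restrict_space)
    fix A assume "A \<in> sets (restrict_space (hausdorff_measure m) (hsphere n))"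
    then have A: "A \<in> sets borel" "A \<subseteq> hsphere n"
      by (auto simp: sets_restrict_space)
    then show "emeasure (restrict_space (hausdorff_measure m) (hsphere n)) A =
        emeasure (restrict_space (cone_measure n) (hsphere n)) A"
      by (simp add: emeasure_restrict_space hausdorff_measure_eq_cone_measure[OF n m])
  qed
  then show ?thesis
    unfolding set_lebesgue_integral_def by (simp add: integral_restrict_space[symmetric])
qed

lemma trace_tensor_mult: "trace (tensor v v ** (A :: real^'n^'n)) = v \<bullet> (A *v v)"
proof -
  have "trace (tensor v v ** A) = (\<Sum>i\<in>UNIV. \<Sum>k\<in>UNIV. v $ i * v $ k * A $ k $ i)"
    by (simp add: trace_def matrix_matrix_mult_def tensor_def)
  also have "\<dots> = (\<Sum>k\<in>UNIV. \<Sum>i\<in>UNIV. v $ i * v $ k * A $ k $ i)" by (rule sum.swap)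
  also have "\<dots> = v \<bullet> (A *v v)"
    by (simp add: inner_vec_def matrix_vector_mult_def sum_distrib_left mult_ac)
  finally show ?thesis .
qed

lemma enn2real_tendsto:
  fixes L :: ennreal
  assumes "(f \<longlongrightarrow> L) F" "L < \<infinity>"
  shows "((\<lambda>i. enn2real (f i)) \<longlongrightarrow> enn2real L) F"
  using assms by (intro tendsto_enn2real) (auto simp: ennreal_enn2real_if less_top)

lemma trace_scaleR_mult: "trace ((c *\<^sub>R M) ** (A :: real^'n^'n)) = c * trace (M ** A)"
  by (simp add: trace_def matrix_matrix_mult_def sum_distrib_left mult.assoc)

lemma trace_add_mult: "trace ((M + M') ** (A :: real^'n^'n)) = trace (M ** A) + trace (M' ** A)"
  by (simp add: trace_def matrix_matrix_mult_def sum.distrib distrib_right)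

theorem proposition4p1:
  fixes nrm :: "real ^ 'n \<Rightarrow> real"
    and u :: "real ^ 'n \<Rightarrow> real"
    and x :: "real ^ 'n"
  assumes "CARD('n) \<ge> 2"
    and "is_norm nrm"
    and "C2 u"
    and "norm (grad u x) \<noteq> 0"
  shows "((\<lambda>\<alpha>. kappa \<alpha> nrm x u) \<longlongrightarrow>
      1 / (2 * norm (grad u x)) *
        trace ((LINT \<theta>:sphere 0 1 \<inter> orth_compl (grad u x)|hausdorff_measure (CARD('n) - 2).
                  (1 / nrm \<theta> ^ (CARD('n) + 1)) *\<^sub>R tensor \<theta> \<theta>)
               ** hessian u x))
    (at_left 1)"
proof -
  define p where "p = grad u x"
  define n where "n = p /\<^sub>R norm p"
  define A where "A = frechet_derivative (grad u) (at x)"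
  define m where "m = CARD('n) - 2"
  have p0: "0 < norm p" using assms(4) by (simp add: p_def)
  have n1: "norm n = 1" using p0 by (simp add: n_def)
  have p_inner: "p \<bullet> z = norm p * (z \<bullet> n)" for z
    using p0 by (simp add: n_def inner_commute)
  have dimN: "DIM((real,'n) vec) = CARD('n)" by simp
  have m: "m + 2 = DIM((real,'n) vec)" using assms(1) by (simp add: m_def)
  obtain c0 where c0: "0 < c0" "c0 \<le> 1" "\<And>z. c0 * norm z \<le> nrm z"
    using is_norm_properties(2)[OF assms(2)] by auto
  have nrm_cont: "continuous_on UNIV nrm" by (rule is_norm_properties(1)[OF assms(2)])
  interpret anisotropic_norm n nrm c0
    using n1 assms(1,2) c0 nrm_cont by unfold_locales (auto simp: is_norm_def)
  have u_diff: "u differentiable (at z)" for z using assms(3) by (simp add: C2_def)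
  have Ader: "(grad u has_derivative A) (at x)"
    using assms(3) by (simp add: C2_def A_def frechet_derivative_works)
  interpret A: bounded_linear A using Ader by (rule has_derivative_bounded_linear)
  have hess: "hessian u x *v w = A w" for w
    unfolding hessian_def A_def[symmetric] using matrix_vector_mul(3)[OF A.bounded_linear_axioms] by metis
  have u_cont: "continuous_on UNIV (\<lambda>z. u (x + z))"
    using u_diff by (intro continuous_at_imp_continuous_on ballI continuous_at_compose[of _ "\<lambda>z. x + z" u, unfolded o_def])
      (auto intro!: continuous_intros differentiable_imp_continuous_within)
  have [measurable]: "(\<lambda>z. u (x + z)) \<in> borel_measurable borel"
    by (rule borel_measurable_continuous_onI[OF u_cont])
  have A_cont: "continuous_on UNIV A" by (intro linear_continuous_on A.bounded_linear_axioms)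
  have [measurable]: "A \<in> borel_measurable borel" by (rule borel_measurable_continuous_onI[OF A_cont])
  define rem where "rem z = u (x + z) - u x - p \<bullet> z - (z \<bullet> A z) / 2" for z
  have Taylor: "((\<lambda>z. rem z / (norm z)\<^sup>2) \<longlongrightarrow> 0) (at 0)"
    using second_order_Taylor[OF GDERIV_grad[OF u_diff] Ader] by (simp add: rem_def p_def)
  define h where "h y = (y \<bullet> A y) / (2 * norm p)" for y
  have [measurable]: "h \<in> borel_measurable borel" unfolding h_def by measurable
  define P where "P = {z. u (x + z) \<ge> u x \<and> p \<bullet> z \<le> 0}"
  define Q where "Q = {z. u (x + z) < u x \<and> p \<bullet> z > 0}"
  define P0 where "P0 = {z. z \<bullet> n + h (perp n z) > 0 \<and> z \<bullet> n \<le> 0}"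
  define Q0 where "Q0 = {z. z \<bullet> n + h (perp n z) < 0 \<and> z \<bullet> n > 0}"
  have P_sets: "P \<in> sets borel"
    unfolding P_def by measurable
  have Q_sets: "Q \<in> sets borel"
    unfolding Q_def by measurable
  have P0_sets: "P0 \<in> sets borel"
    unfolding P0_def by measurable
  have Q0_sets: "Q0 \<in> sets borel"
    unfolding Q0_def by measurable

  \<comment> \<open>Thinness of the two sets near the origin\<close>
  obtain r M where r: "0 < r" "r \<le> 1" and M: "0 \<le> M"
    and thin: "\<And>z. z \<in> P \<union> Q \<Longrightarrow> norm z < r \<Longrightarrow> \<bar>z \<bullet> n\<bar> \<le> M * (norm (perp n z))\<^sup>2"
  proof -
    obtain d where d: "0 < d" "\<And>z. z \<noteq> 0 \<Longrightarrow> norm z < d \<Longrightarrow> \<bar>rem z / (norm z)\<^sup>2\<bar> < 1"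
      using LIM_D[OF Taylor, of 1] by auto
    obtain K where K: "0 < K" "\<And>z. norm (A z) \<le> norm z * K" using A.pos_bounded by blast
    \<comment> \<open>The 1 bounds the Taylor remainder relative to |z|^2, and K / 2 bounds the
      quadratic term.\<close>
    define C where "C = 1 + K / 2"
    have C: "0 < C" using K by (simp add: C_def)
    \<comment> \<open>The last bound gives 2 C |s| <= |p| for the height s of z, so that the term C
      s^2 below is at most half of |p| |s| and can be absorbed on the left.\<close>
    define r where "r = min (min d 1) (norm p / (2 * C))"
    have bound: "\<bar>u (x + z) - u x - p \<bullet> z\<bar> \<le> C * (norm z)\<^sup>2" if "norm z < d" for z
    proof (cases "z = 0")
      case False
      have "\<bar>rem z\<bar> \<le> (norm z)\<^sup>2" using d(2)[OF False that] False by (simp add: abs_divide divide_less_eq)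
      moreover have "\<bar>z \<bullet> A z\<bar> \<le> norm z * norm (A z)" by (rule Cauchy_Schwarz_ineq2)
      then have "\<bar>z \<bullet> A z\<bar> \<le> K * (norm z)\<^sup>2"
        using mult_left_mono[OF K(2)[of z], of "norm z"] by (simp add: power2_eq_square mult_ac)
      moreover have "u (x + z) - u x - p \<bullet> z = rem z + (z \<bullet> A z) / 2" by (simp add: rem_def)
      ultimately show ?thesis by (simp add: C_def distrib_right)
    qed simp
    show ?thesis
    proof (rule that[of r "2 * C / norm p"])
      show "0 < r" "r \<le> 1" using d C p0 by (auto simp: r_def)
      show "0 \<le> 2 * C / norm p" using C by simp
      fix z assume z: "z \<in> P \<union> Q" "norm z < r"
      define s where "s = z \<bullet> n"
      \<comment> \<open>In both sets the increment of u and its linear part p \<bullet> z do not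
        have the same strict sign, so their difference is at least as large as |p \<bullet>
        z|.\<close>
      have "\<bar>p \<bullet> z\<bar> \<le> C * (norm z)\<^sup>2"
        using bound[of z] z by (auto simp: P_def Q_def r_def)
      then have 1: "norm p * \<bar>s\<bar> \<le> C * (norm (perp n z))\<^sup>2 + C * s\<^sup>2"
        using norm_perp_Pythagoras[OF n1, of z] p0
        by (simp add: p_inner s_def abs_mult distrib_left)
      have "\<bar>s\<bar> \<le> norm z * norm n" unfolding s_def by (rule Cauchy_Schwarz_ineq2)
      then have "\<bar>s\<bar> \<le> norm p / (2 * C)" using z n1 by (simp add: r_def)
      then have "(2 * C) * \<bar>s\<bar> \<le> norm p" using C by (simp add: field_simps)
      then have "((2 * C) * \<bar>s\<bar>) * \<bar>s\<bar> \<le> norm p * \<bar>s\<bar>" by (rule mult_right_mono) simp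
      then have "2 * (C * s\<^sup>2) \<le> norm p * \<bar>s\<bar>" by (simp add: power2_eq_square mult.assoc)
      with 1 have "norm p * \<bar>s\<bar> \<le> 2 * C * (norm (perp n z))\<^sup>2" by linarith
      then show "\<bar>z \<bullet> n\<bar> \<le> 2 * C / norm p * (norm (perp n z))\<^sup>2"
        using p0 by (simp add: s_def field_simps)
    qed
  qed

  \<comment> \<open>Blow-up under the anisotropic dilations\<close>
  have blowup_lim: "((\<lambda>l. (u (x + aniso n l z) - u x) / l\<^sup>2) \<longlongrightarrow> norm p * (z \<bullet> n + h (perp n z))) (at_right 0)"
    if z: "z \<in> punctured" for z
  proof -
    define y where "y = perp n z"
    define s where "s = z \<bullet> n"
    \<comment> \<open>Factoring out one power of l leaves v l, which tends to y. The linear term is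
      then of order l^2, like the quadratic one, and the Taylor remainder vanishes relative to
      l^2.\<close>
    define v where "v l = y + (l * s) *\<^sub>R n" for l
    have y0: "y \<noteq> 0" using z by (auto simp: punctured_def y_def)
    have an: "aniso n l z = l *\<^sub>R v l" for l
      by (simp add: aniso_def v_def y_def s_def scaleR_add_right power2_eq_square mult.assoc)
    have v_lim: "(v \<longlongrightarrow> y) (at_right 0)"
      unfolding v_def by (auto intro!: tendsto_eq_intros)
    have "((\<lambda>l. aniso n l z) \<longlongrightarrow> 0) (at_right 0)"
      unfolding an using v_lim by (auto intro!: tendsto_eq_intros)
    moreover have "\<forall>\<^sub>F l in at_right 0. aniso n l z \<noteq> 0"
      using eventually_at_right_less[of "0::real"]
    proof eventually_elim
      case (elim l)
      then have "perp n (aniso n l z) \<noteq> 0" using y0 by (simp add: aniso_simps[OF n1] y_def)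
      then show ?case by (auto simp: perp_def)
    qed
    ultimately have "filterlim (\<lambda>l. aniso n l z) (at 0) (at_right 0)"
      by (simp add: filterlim_at)
    then have "((\<lambda>l. rem (aniso n l z) / (norm (aniso n l z))\<^sup>2) \<longlongrightarrow> 0) (at_right 0)"
      by (rule filterlim_compose[OF Taylor])
    then have "((\<lambda>l. norm p * s + (v l \<bullet> A (v l)) / 2 + rem (aniso n l z) / (norm (aniso n l z))\<^sup>2 * (norm (v l))\<^sup>2)
        \<longlongrightarrow> norm p * s + (y \<bullet> A y) / 2 + 0 * (norm y)\<^sup>2) (at_right 0)"
      by (intro tendsto_intros v_lim A.tendsto) simp_all
    moreover have "\<forall>\<^sub>F l in at_right 0. norm p * s + (v l \<bullet> A (v l)) / 2 +
        rem (aniso n l z) / (norm (aniso n l z))\<^sup>2 * (norm (v l))\<^sup>2 = (u (x + aniso n l z) - u x) / l\<^sup>2"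
      using eventually_at_right_less[of "0::real"]
    proof eventually_elim
      case (elim l)
      have v0: "v l \<noteq> 0"
      proof
        assume "v l = 0"
        then have "perp n (v l) = 0" by (simp add: perp_def)
        then show False using y0 by (simp add: v_def perp_simps[OF n1] y_def)
      qed
      have "u (x + aniso n l z) - u x = rem (aniso n l z) + p \<bullet> aniso n l z + (aniso n l z \<bullet> A (aniso n l z)) / 2"
        by (simp add: rem_def)
      also have "p \<bullet> aniso n l z = l\<^sup>2 * (norm p * s)"
        by (simp add: p_inner aniso_simps[OF n1] s_def)
      also have "aniso n l z \<bullet> A (aniso n l z) = l\<^sup>2 * (v l \<bullet> A (v l))"
        by (simp add: an A.scaleR power2_eq_square)
      finally have eq: "u (x + aniso n l z) - u x =
          rem (aniso n l z) + l\<^sup>2 * (norm p * s) + l\<^sup>2 * (v l \<bullet> A (v l)) / 2" .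
      have "(u (x + aniso n l z) - u x) / l\<^sup>2 = rem (aniso n l z) / l\<^sup>2 + norm p * s + (v l \<bullet> A (v l)) / 2"
        unfolding eq using elim by (simp add: add_divide_distrib)
      moreover have "rem (aniso n l z) / (norm (aniso n l z))\<^sup>2 * (norm (v l))\<^sup>2 = rem (aniso n l z) / l\<^sup>2"
        using v0 elim by (simp add: an power_mult_distrib)
      ultimately show ?case by simp
    qed
    ultimately have "((\<lambda>l. (u (x + aniso n l z) - u x) / l\<^sup>2) \<longlongrightarrow> norm p * s + (y \<bullet> A y) / 2) (at_right 0)"
      using Lim_transform_eventually by fastforce
    moreover have "norm p * s + (y \<bullet> A y) / 2 = norm p * (z \<bullet> n + h (perp n z))"
      using p0 by (simp add: h_def s_def y_def field_simps)
    ultimately show ?thesis by simp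
  qed
  have sign_blowup: "(\<forall>\<^sub>F l in at_right 0. aniso n l z \<in> P \<longleftrightarrow> z \<in> P0) \<and> (\<forall>\<^sub>F l in at_right 0. aniso n l z \<in> Q \<longleftrightarrow> z \<in> Q0)"
    if z: "z \<in> punctured" and q: "z \<bullet> n \<noteq> - h (perp n z)" for z
  proof -
    have pT: "p \<bullet> aniso n l z \<le> 0 \<longleftrightarrow> z \<bullet> n \<le> 0" if "0 < l" for l
      using that p0 by (simp add: p_inner aniso_simps[OF n1] mult_le_0_iff)
    show ?thesis
    proof (cases "z \<bullet> n + h (perp n z) > 0")
      case True
      have "\<forall>\<^sub>F l in at_right 0. 0 < (u (x + aniso n l z) - u x) / l\<^sup>2"
        using True p0 by (intro order_tendstoD(1)[OF blowup_lim[OF z]]) simp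
      then have "\<forall>\<^sub>F l in at_right 0. (aniso n l z \<in> P \<longleftrightarrow> z \<in> P0) \<and> (aniso n l z \<in> Q \<longleftrightarrow> z \<in> Q0)"
        using eventually_at_right_less[of "0::real"]
      proof eventually_elim
        case (elim l)
        then have "u (x + aniso n l z) > u x" by (simp add: zero_less_divide_iff)
        then show ?case using True pT[OF elim(2)] by (auto simp: P_def Q_def P0_def Q0_def)
      qed
      then show ?thesis by (auto elim: eventually_mono)
    next
      case False
      then have neg: "z \<bullet> n + h (perp n z) < 0" using q by linarith
      have "\<forall>\<^sub>F l in at_right 0. (u (x + aniso n l z) - u x) / l\<^sup>2 < 0"
        using neg p0 by (intro order_tendstoD(2)[OF blowup_lim[OF z]]) (simp add: mult_pos_neg)
      then have "\<forall>\<^sub>F l in at_right 0. (aniso n l z \<in> P \<longleftrightarrow> z \<in> P0) \<and> (aniso n l z \<in> Q \<longleftrightarrow> z \<in> Q0)"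
        using eventually_at_right_less[of "0::real"]
      proof eventually_elim
        case (elim l)
        then have "u (x + aniso n l z) < u x" by (simp add: divide_less_0_iff)
        then show ?case using neg pT[OF elim(2)] by (auto simp: P_def Q_def P0_def Q0_def)
      qed
      then show ?thesis by (auto elim: eventually_mono)
    qed
  qed
  have AE_q: "AE z in lborel. z \<bullet> n \<noteq> - h (perp n z)"
    using graph_null[of "\<lambda>y. - h y"] by simp
  have blowup_P: "AE z in lborel. z \<in> punctured \<longrightarrow> (\<forall>\<^sub>F l in at_right 0. aniso n l z \<in> P \<longleftrightarrow> z \<in> P0)"
    and blowup_Q: "AE z in lborel. z \<in> punctured \<longrightarrow> (\<forall>\<^sub>F l in at_right 0. aniso n l z \<in> Q \<longleftrightarrow> z \<in> Q0)"
    using AE_q by (eventually_elim, use sign_blowup in blast)+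

  \<comment> \<open>Convergence of the curvature to a difference of two volumes\<close>
  define LP where "LP = (\<integral>\<^sup>+z. indicator (punctured \<inter> P0) z * weight_limit z \<partial>lborel)"
  define LQ where "LQ = (\<integral>\<^sup>+z. indicator (punctured \<inter> Q0) z * weight_limit z \<partial>lborel)"
  have meas: "measure (nu \<alpha> nrm) E =
      enn2real (\<integral>\<^sup>+z. indicator E z * ennreal ((1 - \<alpha>) / nrm z powr (DIM((real,'n) vec) + \<alpha>)) \<partial>lborel)"
    if "E \<in> sets borel" for E and \<alpha> :: real
    unfolding nu_def measure_def using that
    by (subst emeasure_density) (auto simp: mult.commute)
  have seq: "(\<lambda>i. kappa (a i) nrm x u) \<longlonglongrightarrow> enn2real LP - enn2real LQ"
    if a: "\<And>i. a i < 1" "\<And>i. 1 / 2 < a i" "a \<longlonglongrightarrow> 1" for a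
  proof -
    have "kappa (a i) nrm x u =
        enn2real (\<integral>\<^sup>+z. indicator P z * ennreal ((1 - a i) / nrm z powr (DIM((real,'n) vec) + a i)) \<partial>lborel) -
        enn2real (\<integral>\<^sup>+z. indicator Q z * ennreal ((1 - a i) / nrm z powr (DIM((real,'n) vec) + a i)) \<partial>lborel)" for i
    proof -
      have "kappa (a i) nrm x u = measure (nu (a i) nrm) P - measure (nu (a i) nrm) Q"
        by (simp add: kappa_def P_def Q_def p_def)
      then show ?thesis by (simp only: meas[OF P_sets] meas[OF Q_sets])
    qed
    moreover have "(\<lambda>i. enn2real (\<integral>\<^sup>+z. indicator P z * ennreal ((1 - a i) / nrm z powr (DIM((real,'n) vec) + a i)) \<partial>lborel)
      - enn2real (\<integral>\<^sup>+z. indicator Q z * ennreal ((1 - a i) / nrm z powr (DIM((real,'n) vec) + a i)) \<partial>lborel))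
      \<longlonglongrightarrow> enn2real LP - enn2real LQ"
      unfolding LP_def LQ_def
      by (intro tendsto_diff enn2real_tendsto
          thin_set_limit[OF P_sets P0_sets r M thin blowup_P a(2,1,3)]
          thin_set_limit[OF Q_sets Q0_sets r M thin blowup_Q a(2,1,3)]) auto
    ultimately show ?thesis by simp
  qed
  have LP_fin: "LP < \<infinity>" and LQ_fin: "LQ < \<infinity>"
  proof -
    \<comment> \<open>The offset 3 makes even the first term, 2/3, exceed 1/2 strictly.\<close>
    define a where "a i = 1 - 1 / real (i + 3)" for i
    have a: "1 / 2 < a i" "a i < 1" for i by (auto simp: a_def field_simps)
    have "(\<lambda>i. 1 - 1 / real (i + 3)) \<longlonglongrightarrow> 1 - 0"
      using LIMSEQ_ignore_initial_segment[OF lim_1_over_n, of 3] by (intro tendsto_diff tendsto_const) simp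
    then have a_lim: "a \<longlonglongrightarrow> 1" unfolding a_def by simp
    show "LP < \<infinity>" unfolding LP_def by (rule thin_set_limit(2)[OF P_sets P0_sets r M thin blowup_P a a_lim]) auto
    show "LQ < \<infinity>" unfolding LQ_def by (rule thin_set_limit(2)[OF Q_sets Q0_sets r M thin blowup_Q a a_lim]) auto
  qed
  have lim: "((\<lambda>\<alpha>. kappa \<alpha> nrm x u) \<longlongrightarrow> enn2real LP - enn2real LQ) (at_left 1)"
    by (rule tendsto_at_left_sequentially[of "1/2"]) (auto intro: seq)

  \<comment> \<open>From the difference of volumes to an integral against the cone measure\<close>
  let ?N = "DIM((real,'n) vec)"
  define W where "W z = real (?N - 1) * norm (perp n z) ^ (?N - 1) / nrm (perp n z) powr (real ?N + 1)" for z
  define f where "f z = indicator (slab n) z * (W z * h (perp n z))" for z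
  have W0: "0 \<le> W z" for z by (simp add: W_def)
  have wl: "weight_limit z = ennreal (W z)" for z by (simp add: weight_limit_def W_def)
  have [measurable]: "W \<in> borel_measurable borel" unfolding W_def by measurable
  have f_meas: "f \<in> borel_measurable borel" unfolding f_def by measurable
  have wl_perp: "weight_limit z = weight_limit (perp n z)" for z
    by (simp add: weight_limit_def perp_simps[OF n1])
  have "LP = (\<integral>\<^sup>+z. indicator (slab n) z * (weight_limit z * ennreal (h (perp n z))) \<partial>lborel)"
    unfolding LP_def P0_def by (rule nn_integral_between(1)[where h = h and w = weight_limit, OF _ _ wl_perp]) measurable
  also have "\<dots> = (\<integral>\<^sup>+z. ennreal (f z) \<partial>lborel)"
    by (intro nn_integral_cong) (simp add: f_def wl ennreal_mult'[OF W0, symmetric] split: split_indicator)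
  finally have LP_f: "LP = (\<integral>\<^sup>+z. ennreal (f z) \<partial>lborel)" .
  have "LQ = (\<integral>\<^sup>+z. indicator (slab n) z * (weight_limit z * ennreal (- h (perp n z))) \<partial>lborel)"
    unfolding LQ_def Q0_def by (rule nn_integral_between(2)[where h = h and w = weight_limit, OF _ _ wl_perp]) measurable
  also have "\<dots> = (\<integral>\<^sup>+z. ennreal (- f z) \<partial>lborel)"
    by (intro nn_integral_cong) (simp add: f_def wl ennreal_mult'[OF W0, symmetric] split: split_indicator)
  finally have LQ_f: "LQ = (\<integral>\<^sup>+z. ennreal (- f z) \<partial>lborel)" .
  \<comment> \<open>\<open>LP\<close> and \<open>LQ\<close> are the integrals of the positive and
    negative parts of f; both are finite, so their difference is a Lebesgue integral.\<close>
  have "integrable lborel f"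
    using f_meas LP_fin LQ_fin by (simp add: real_integrable_def LP_f LQ_f less_top)
  then have int_f: "enn2real LP - enn2real LQ = (LINT z|lborel. f z)"
    by (simp add: real_lebesgue_integral_def LP_f LQ_f)
  define F where "F \<theta> = indicator (hsphere n) \<theta> * (h \<theta> / nrm \<theta> ^ (?N + 1))" for \<theta>
  have F_meas: "F \<in> borel_measurable borel" unfolding F_def by measurable
  \<comment> \<open>On the slab W is homogeneous of degree -2 in y and h of degree 2, so f depends
    only on the direction of y.\<close>
  have "f z = real (?N - 1) * indicator (slab n) z * F (perp_dir n z)" for z
  proof (cases "z \<in> slab n")
    case True
    define y where "y = perp n z"
    have y: "0 < norm y" using True by (simp add: slab_def y_def)
    have ny: "0 < nrm y"
    proof -
      have "0 < c0 * norm y" using y c0 by simp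
      then show ?thesis using nrm_lower[of y] by linarith
    qed
    have dir: "perp_dir n z = inverse (norm y) *\<^sub>R y" by (simp add: perp_dir_def y_def)
    have 1: "h (perp_dir n z) = h y / (norm y)\<^sup>2"
    proof -
      have "h (c *\<^sub>R y) = c\<^sup>2 * h y" for c by (simp add: h_def A.scaleR power2_eq_square)
      then show ?thesis by (simp add: dir power_inverse divide_inverse mult.commute)
    qed
    have 2: "nrm (perp_dir n z) = nrm y / norm y"
      using y by (simp add: dir nrm_hom divide_inverse mult.commute)
    have 3: "nrm y powr (real ?N + 1) = nrm y ^ (?N + 1)"
      using powr_realpow[OF ny, of "?N + 1"] by (simp add: add.commute)
    have "?N + 1 = (?N - 1) + 2" using dim by linarith
    then have 4: "norm y ^ (?N + 1) = norm y ^ (?N - 1) * (norm y)\<^sup>2" by (metis power_add)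
    have "F (perp_dir n z) = (h y / (norm y)\<^sup>2) / (nrm y ^ (?N + 1) / norm y ^ (?N + 1))"
      using perp_dir_in_hsphere[OF n1 True] by (simp add: F_def 1 2 power_divide)
    also have "\<dots> = norm y ^ (?N - 1) / nrm y ^ (?N + 1) * h y"
      unfolding 4 using y by simp
    finally have 5: "F (perp_dir n z) = norm y ^ (?N - 1) / nrm y ^ (?N + 1) * h y" .
    show ?thesis using True unfolding f_def W_def y_def[symmetric] 3 5 by simp
  qed (simp add: f_def)
  then have "(LINT z|lborel. f z) = integral\<^sup>L (cone_measure n) F"
    by (simp add: integral_cone_measure[OF F_meas])

  \<comment> \<open>From the cone measure to the trace formula\<close>
  define G where "G \<theta> = (1 / nrm \<theta> ^ (CARD('n) + 1)) *\<^sub>R tensor \<theta> \<theta>" for \<theta> :: "real ^ 'n"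
  have sph: "sphere 0 1 \<inter> orth_compl p = hsphere n"
    using p0 by (auto simp: hsphere_def orth_compl_def n_def)
  have cone_int: "integrable (cone_measure n) (\<lambda>\<theta>. indicator (hsphere n) \<theta> *\<^sub>R G \<theta>)"
  proof -
    interpret finite_measure "cone_measure n" by (rule finite_measure_cone_measure[OF n1])
    have cl: "closed (hsphere n)"
    proof -
      have "hsphere n = sphere 0 1 \<inter> {\<theta>. \<theta> \<bullet> n = 0}" by (auto simp: hsphere_def)
      then show ?thesis by (auto intro!: closed_Int closed_Collect_eq continuous_intros)
    qed
    have "bounded (hsphere n)" using bounded_sphere hsphere_subset_sphere by (rule bounded_subset)
    then have cpt: "compact (hsphere n)" using cl by (simp add: compact_eq_bounded_closed)
    have nz: "nrm \<theta> \<noteq> 0" if "\<theta> \<in> hsphere n" for \<theta>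
      using nrm_lower[of \<theta>] c0(1) that by (auto simp: hsphere_def)
    have cG: "continuous_on (hsphere n) G"
      unfolding G_def tensor_def
      by (intro continuous_intros continuous_on_vec_lambda continuous_on_subset[OF nrm_cont]) (auto simp: nz)
    obtain b where b: "\<And>\<theta>. \<theta> \<in> hsphere n \<Longrightarrow> norm (G \<theta>) \<le> b"
      using compact_imp_bounded[OF compact_continuous_image[OF cG cpt]] by (auto simp: bounded_iff)
    show ?thesis
    proof (rule integrable_const_bound[of _ "max b 0"])
      show "AE \<theta> in cone_measure n. norm (indicator (hsphere n) \<theta> *\<^sub>R G \<theta>) \<le> max b 0"
        using b by (auto simp: indicator_def le_max_iff_disj)
      show "(\<lambda>\<theta>. indicator (hsphere n) \<theta> *\<^sub>R G \<theta>) \<in> borel_measurable (cone_measure n)"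
        unfolding measurable_cong_sets[OF sets_cone_measure refl]
        using sets_hsphere cG by (rule borel_measurable_continuous_on_indicator)
    qed
  qed
  \<comment> \<open>As a bounded linear functional, the trace against the Hessian can be moved
    inside the matrix-valued Bochner integral.\<close>
  have tr_lin: "bounded_linear (\<lambda>M. trace (M ** hessian u x) / (2 * norm p))"
  proof (rule linear_conv_bounded_linear[THEN iffD1])
    show "linear (\<lambda>M. trace (M ** hessian u x) / (2 * norm p))"
      by (rule linearI)
        (simp_all add: trace_add_mult add_divide_distrib trace_scaleR_mult)
  qed
  have "trace ((LINT \<theta>:sphere 0 1 \<inter> orth_compl p|hausdorff_measure m. G \<theta>) ** hessian u x) / (2 * norm p)
      = trace ((LINT \<theta>|cone_measure n. indicator (hsphere n) \<theta> *\<^sub>R G \<theta>) ** hessian u x) / (2 * norm p)"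
    unfolding sph set_integral_hausdorff_eq_cone_measure[OF n1 m] by (simp add: set_lebesgue_integral_def)
  also have "\<dots> = (LINT \<theta>|cone_measure n. trace ((indicator (hsphere n) \<theta> *\<^sub>R G \<theta>) ** hessian u x) / (2 * norm p))"
    by (rule integral_bounded_linear[OF tr_lin cone_int, symmetric])
  also have "\<dots> = integral\<^sup>L (cone_measure n) F"
  proof (rule Bochner_Integration.integral_cong[OF refl])
    fix \<theta> :: "real ^ 'n"
    have "trace (G \<theta> ** hessian u x) = 1 / nrm \<theta> ^ (CARD('n) + 1) * trace (tensor \<theta> \<theta> ** hessian u x)"
      by (simp only: G_def trace_scaleR_mult)
    then show "trace ((indicator (hsphere n) \<theta> *\<^sub>R G \<theta>) ** hessian u x) / (2 * norm p) = F \<theta>"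
      by (simp add: F_def trace_scaleR_mult trace_tensor_mult hess h_def)
  qed
  finally have "enn2real LP - enn2real LQ =
      trace ((LINT \<theta>:sphere 0 1 \<inter> orth_compl p|hausdorff_measure m. G \<theta>) ** hessian u x) / (2 * norm p)"
    using int_f \<open>(LINT z|lborel. f z) = integral\<^sup>L (cone_measure n) F\<close> by simp
  then show ?thesis using lim by (simp add: G_def m_def p_def)
qed

end
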